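(* The quantum Lax matrix $\mathcal L$ for the Koornwinder–van Diejen system (the $2n\times2n$ matrix representing the Cherednik operator $Y_1$ on $M'$) is $\mathcal L=\mathcal P\mathcal Q$, with $\mathcal P,\mathcal Q$ the explicit matrices given in the context. The classical Lax matrix is found as $L=PQ$, where $P=\mathcal P$, while $Q$ is obtained from $\mathcal Q$ by setting $q=1$ in the definitions of $\widetilde u,\widetilde v$ and by replacing $t(\epsilon_j)$ with $e^{\beta p_j}$ (with $p_{n+i}=-p_i$ for $1\le i\le n$).
   Context: $V=\mathbb C^n$ with standard orthonormal basis $\epsilon_i$ and coordinates $x_i$; $\mathbb C(V)$: meromorphic functions on $V$; $W=\mathfrak S_n\ltimes\{\pm1\}^n$ acts by signed permutations. $\mathfrak s_{ij}$ transposes $x_i,x_j$; $\mathfrak s_i$ changes the sign of $x_i$; $\mathfrak s_{ij}^+=\mathfrak s_{ij}\mathfrak s_i\mathfrak s_j$. For fixed $c$, $q=e^c$, and $\lambda\in\Lambda=\bigoplus\mathbb Z\epsilon_i$, $t(\lambda)$ acts on $V$ by $x\mapsto x-c\lambda$ and on functions by $f(x)\mapsto f(x+c\lambda)$; $\mathcal D_q$ is the algebra generated by $\mathbb C(V)$ and $t(\Lambda)$. **Cherednik operator.** $s_0,\dots,s_n$ act on $V$ by $s_0:(x_1,\dots,x_n)\mapsto(c-x_1,x_2,\dots,x_n)$, $s_i=\mathfrak s_{i,i+1}$ ($1\le i\le n-1$), $s_n=\mathfrak s_n$. Parameters $\tau_0,\tau_0^\vee,\tau_n,\tau_n^\vee,\tau$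 are nonzero, $\tau_1=\dots=\tau_{n-1}=\tau$. With $a_0=c-2x_1$, $a_i=x_i-x_{i+1}$, $a_n=2x_n$ set $$\mathbf c_i=\frac{\tau^{-1}-\tau e^{a_i}}{1-e^{a_i}}\ (1\le i\le n-1),\qquad \mathbf c_i=\tau_i^{-1}\frac{(1-\tau_i\tau_i^\vee e^{a_i/2})(1+\tau_i(\tau_i^\vee)^{-1}e^{a_i/2})}{1-e^{a_i}}\ (i=0,n),$$ $T_i=\tau_i+\mathbf c_i(s_i-1)\in\mathcal D_q*W$, and $Y_1=T_1\cdots T_{n-1}T_nT_{n-1}\cdots T_1T_0$. **Matrices.** $W'\subset W$ is the stabiliser of $\epsilon_1$, $e'=|W'|^{-1}\sum_{w\in W'}w$, $M=\mathrm{Ind}_{\mathcal D_q}^{\mathcal D_q*W}\mathbb C(V)\cong\mathbb CW\otimes\mathbb C(V)$, $M'=e'M$ (preserved by $Y_1$). Elements of $M'$ are $\sum_{j=1}^{2n}e'r_jf_j$ with $r_i=\mathfrak s_{1i}$, $r_{n+i}=\mathfrak s_{1i}^+$ ($1\le i\le n$), $r_1=\mathrm{id}$, $r_{n+1}=\mathfrak s_1$; the matrix $(Z_{kj})$ of $Z$ is defined by $Z\sum_je'r_jf_j=\sum_{k,j}e'r_kZ_{kj}f_j$. Put $a(z)=\frac{\tau^{-1}-\tau e^z}{1-e^z}$, $b(z)=\frac{\tau-\tau^{-1}}{1-e^z}$, $u(z)=\tau_n^{-1}\frac{(1-\tau_n\tau_n^\vee e^z)(1+\tau_n(\tau_n^\vee)^{-1}e^z)}{1-e^{2z}}$,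 $\widetilde u(z)=\tau_0^{-1}\frac{(1-\tau_0\tau_0^\vee q^{1/2}e^z)(1+\tau_0(\tau_0^\vee)^{-1}q^{1/2}e^z)}{1-qe^{2z}}$, $\widetilde v(z)=\tau_0-\widetilde u(z)$. Extend to $1\le i\le2n$ by $\epsilon_{n+i}=-\epsilon_i$, $x_{n+i}=-x_i$, and write $a_{ij}=a(x_i-x_j)$, $b_{ij}=b(x_i-x_j)$, $a_{ij}^+=a(x_i+x_j)$, $u_i=u(x_i)$, $\widetilde u_i=\widetilde u(x_i)$, $\widetilde v_i=\widetilde v(x_i)$. Then $$\mathcal P_{ij}=u_jb_{ij}a_{ij}^+\prod_{l=1}^{2n}{}'a_{jl}\ (i-j\ne0,\pm n),\quad \mathcal P_{ii}=u_i\prod_{l=1}^{2n}{}'a_{il},\quad \mathcal P_{ij}=\tau^{2n-2}\tau_n-\sum_{l\ne j}\mathcal P_{il}\ (i-j=\pm n),$$ $$\mathcal Q_{ii}=\widetilde u_it(\epsilon_i),\quad\mathcal Q_{ij}=\widetilde v_i\ (i-j=\pm n),\quad\mathcal Q_{ij}=0\ (i-j\ne0,\pm n),$$ where $\prod'$ excludes the $l$ for which $l-i$ or $l-j$ is in $\{0,\pm n\}$. **Classical limit.** $c=-\mathrm i\hbar\beta$, $\hbar\to0$ (so $q\to1$), with $t(\lambda)\mapsto e^{\beta p_\lambda}$, $p_i$ the momentum conjugate to $x_i$. The classical Lax matrix $L$ is the classical limit of $\mathcal L$. *)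

theory Defs
  imports "HOL-Complex_Analysis.Complex_Analysis" "HOL-Library.Function_Algebras"
begin

no_notation fps_nth (infixl "$" 75)

definition holo :: "(complex^'n) set \<Rightarrow> (complex^'n \<Rightarrow> complex) \<Rightarrow> bool" where
  "holo U f \<longleftrightarrow> (\<forall>x\<in>U. \<exists>D. (f has_derivative D) (at x) \<and> (\<forall>a v. D (a *s v) = a * D v))"

definition quot_on :: "(complex^'n \<Rightarrow> complex) \<Rightarrow> complex^'n \<Rightarrow> real
    \<Rightarrow> (complex^'n \<Rightarrow> complex) \<Rightarrow> (complex^'n \<Rightarrow> complex) \<Rightarrow> bool" where
  "quot_on F p r g h \<longleftrightarrow> 0 < r \<and> holo (ball p r) g \<and> holo (ball p r) h \<and>
     (\<exists>y\<in>ball p r. h y \<noteq> 0) \<and> (\<forall>x\<in>ball p r. h x \<noteq> 0 \<longrightarrow> F x = g x / h x)"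

text \<open>A total function represents a meromorphic function if near every point it is a quotient
  of holomorphic functions \<open>g / h\<close> with \<open>h\<close> not identically zero; its values on the zero set
  of \<open>h\<close> are arbitrary. Two such functions represent the same meromorphic function if they
  agree on an open dense set.\<close>

definition mero_fun :: "(complex^'n \<Rightarrow> complex) \<Rightarrow> bool" where
  "mero_fun F \<longleftrightarrow> (\<forall>p. \<exists>r g h. quot_on F p r g h)"

definition mero_eq :: "(complex^'n \<Rightarrow> complex) \<Rightarrow> (complex^'n \<Rightarrow> complex) \<Rightarrow> bool" where
  "mero_eq F G \<longleftrightarrow> mero_fun F \<and> mero_fun G \<and>
     (\<exists>U. open U \<and> closure U = UNIV \<and> (\<forall>x\<in>U. F x = G x))"

lemma holo_subset: "holo U f \<Longrightarrow> S \<subseteq> U \<Longrightarrow> holo S f"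
  by (auto simp: holo_def)

lemma holo_const [simp]: "holo U (\<lambda>_. c)"
  unfolding holo_def by (intro ballI exI[of _ "\<lambda>_. 0"]) simp

lemma holo_add: assumes "holo U f" "holo U g" shows "holo U (\<lambda>x. f x + g x)"
  unfolding holo_def
proof
  fix x assume x: "x \<in> U"
  obtain D where D: "(f has_derivative D) (at x)" "\<And>a v. D (a *s v) = a * D v"
    using assms(1) x unfolding holo_def by (metis (no_types))
  obtain E where E: "(g has_derivative E) (at x)" "\<And>a v. E (a *s v) = a * E v"
    using assms(2) x unfolding holo_def by (metis (no_types))
  have "((\<lambda>x. f x + g x) has_derivative (\<lambda>v. D v + E v)) (at x)"
    using has_derivative_add[OF D(1) E(1)] .
  then show "\<exists>D. ((\<lambda>x. f x + g x) has_derivative D) (at x) \<and> (\<forall>a v. D (a *s v) = a * D v)"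
    by (intro exI conjI allI, assumption) (simp add: D(2) E(2) distrib_left mult.assoc mult.left_commute)
qed

lemma holo_mult: assumes "holo U f" "holo U g" shows "holo U (\<lambda>x. f x * g x)"
  unfolding holo_def
proof
  fix x assume x: "x \<in> U"
  obtain D where D: "(f has_derivative D) (at x)" "\<And>a v. D (a *s v) = a * D v"
    using assms(1) x unfolding holo_def by (metis (no_types))
  obtain E where E: "(g has_derivative E) (at x)" "\<And>a v. E (a *s v) = a * E v"
    using assms(2) x unfolding holo_def by (metis (no_types))
  have "((\<lambda>x. f x * g x) has_derivative (\<lambda>v. f x * E v + D v * g x)) (at x)"
    using has_derivative_mult[OF D(1) E(1)] .
  then show "\<exists>D. ((\<lambda>x. f x * g x) has_derivative D) (at x) \<and> (\<forall>a v. D (a *s v) = a * D v)"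
    by (intro exI conjI allI, assumption) (simp add: D(2) E(2) distrib_left mult.assoc mult.left_commute)
qed

lemma holo_continuous_on: "holo U f \<Longrightarrow> continuous_on U f"
  unfolding holo_def
  by (rule continuous_at_imp_continuous_on) (blast intro: has_derivative_continuous)

lemma bounded_linear_vector_scalar: "bounded_linear (\<lambda>s::complex. s *s (v::complex^'n))"
proof -
  have "linear (\<lambda>s::complex. s *s v)"
    by (intro linearI) (auto simp: vec_eq_iff algebra_simps)
  then show ?thesis by (simp add: linear_conv_bounded_linear)
qed

lemma holo_line:
  assumes "holo U f"
  shows "(\<lambda>s. f (q + s *s v)) holomorphic_on {s. q + s *s v \<in> U}"
proof (rule holomorphic_onI)
  fix s assume "s \<in> {s. q + s *s v \<in> U}"
  then obtain D where D: "(f has_derivative D) (at (q + s *s v))" "\<And>a v. D (a *s v) = a * D v"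
    using assms unfolding holo_def by auto
  have "((\<lambda>s. q + s *s v) has_derivative (\<lambda>h. h *s v)) (at s)"
    using has_derivative_add[OF has_derivative_const
      bounded_linear.has_derivative[OF bounded_linear_vector_scalar has_derivative_ident]]
    by simp
  from has_derivative_compose[OF this D(1)]
  have "((\<lambda>s. f (q + s *s v)) has_derivative (\<lambda>h. h * D v)) (at s)"
    by (simp add: D(2))
  then have "((\<lambda>s. f (q + s *s v)) has_field_derivative (D v)) (at s)"
    by (simp add: has_field_derivative_def mult_commute_abs)
  then show "(\<lambda>s. f (q + s *s v)) field_differentiable at s within {s. q + s *s v \<in> U}"
    using field_differentiable_def field_differentiable_at_within by blast
qed

lemma holo_identity:
  assumes f: "holo U f" and U: "open U" "convex U"
    and S: "open S" "S \<noteq> {}" "S \<subseteq> U" and 0: "\<And>x. x \<in> S \<Longrightarrow> f x = 0" and x: "x \<in> U"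
  shows "f x = 0"
proof -
  obtain q where q: "q \<in> S" using S by auto
  let ?g = "\<lambda>s::complex. q + s *s (x - q)"
  have cont: "continuous_on UNIV ?g"
    by (intro continuous_intros linear_continuous_on bounded_linear_vector_scalar)
  have oU: "open (?g -` U)" and oS: "open (?g -` S)"
    using cont U S open_vimage by blast+
  have cv: "convex (?g -` U)"
    unfolding convex_def
  proof (intro ballI allI impI)
    fix s t :: complex and a b :: real
    assume *: "s \<in> ?g -` U" "t \<in> ?g -` U" "0 \<le> a" "0 \<le> b" "a + b = 1"
    have "?g (a *\<^sub>R s + b *\<^sub>R t) = (a + b) *\<^sub>R q + (a *\<^sub>R s + b *\<^sub>R t) *s (x - q)"
      using * by simp
    also have "\<dots> = a *\<^sub>R ?g s + b *\<^sub>R ?g t"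
      by (simp add: vec_eq_iff algebra_simps)
    also have "\<dots> \<in> U" using * by (intro convexD[OF U(2)]) simp_all
    finally show "a *\<^sub>R s + b *\<^sub>R t \<in> ?g -` U" by simp
  qed
  have hol: "(\<lambda>s. f (?g s)) holomorphic_on (?g -` U)"
    using holo_line[OF f, of q "x - q"] by (simp add: vimage_def)
  have "0 \<in> ?g -` S" using q by simp
  then have ne: "?g -` S \<noteq> {}" by blast
  have sub: "?g -` S \<subseteq> ?g -` U" using S(3) by blast
  have "f (?g 1) = 0"
  proof (rule analytic_continuation_open[OF oS oU ne convex_connected[OF cv] sub hol
      holomorphic_on_const])
    show "f (?g s) = 0" if "s \<in> ?g -` S" for s using that 0 by simp
    show "1 \<in> ?g -` U" using x by simp
  qed
  then show ?thesis by simp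
qed

lemma holo_open_nonzero:
  assumes "holo U f" "open U" shows "open {x \<in> U. f x \<noteq> 0}"
proof -
  have "{x \<in> U. f x \<noteq> 0} = U \<inter> f -` (- {0})" by blast
  then show ?thesis
    using continuous_open_preimage[OF holo_continuous_on[OF assms(1)] assms(2), of "- {0}"]
    by (metis open_Compl closed_singleton)
qed

lemma holo_dense_identity:
  assumes f: "holo U f" and U: "open U" "convex U"
    and S: "open S" "S \<noteq> {}" "S \<subseteq> U" and T: "closure T = UNIV"
    and 0: "\<And>x. x \<in> S \<inter> T \<Longrightarrow> f x = 0" and x: "x \<in> U"
  shows "f x = 0"
proof (rule holo_identity[OF f U S _ x])
  fix y assume y: "y \<in> S"
  have op: "open {x \<in> S. f x \<noteq> 0}"
    by (rule holo_open_nonzero[OF holo_subset[OF f S(3)] S(1)])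
  have "{x \<in> S. f x \<noteq> 0} \<inter> T = {}" using 0 by blast
  then have "{x \<in> S. f x \<noteq> 0} = {}"
    using open_Int_closure_eq_empty[OF op, of T] T by simp
  then show "f y = 0" using y by blast
qed

lemma quot_onD:
  assumes "quot_on F p r g h"
  shows "0 < r" "holo (ball p r) g" "holo (ball p r) h" "\<exists>y\<in>ball p r. h y \<noteq> 0"
    "\<And>x. x \<in> ball p r \<Longrightarrow> h x \<noteq> 0 \<Longrightarrow> F x = g x / h x"
  using assms unfolding quot_on_def by blast+

lemma quot_onI:
  assumes "0 < r" "holo (ball p r) g" "holo (ball p r) h" "\<exists>y\<in>ball p r. h y \<noteq> 0"
    "\<And>x. x \<in> ball p r \<Longrightarrow> h x \<noteq> 0 \<Longrightarrow> F x = g x / h x"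
  shows "quot_on F p r g h"
  using assms unfolding quot_on_def by blast

lemma quot_on_shrink:
  assumes q: "quot_on F p r g h" and s: "0 < s" and sub: "ball q s \<subseteq> ball p r"
  shows "quot_on F q s g h"
proof (rule quot_onI[OF s])
  show "holo (ball q s) g" "holo (ball q s) h"
    using quot_onD(2,3)[OF q] holo_subset sub by blast+
  show "\<exists>y\<in>ball q s. h y \<noteq> 0"
  proof (rule ccontr)
    assume "\<not> ?thesis"
    then have 0: "\<And>x. x \<in> ball q s \<Longrightarrow> h x = 0" by blast
    have ne: "ball q s \<noteq> {}" using s by simp
    have "h x = 0" if "x \<in> ball p r" for x
      using holo_identity[OF quot_onD(3)[OF q] open_ball convex_ball open_ball ne sub 0 that] .
    then show False using quot_onD(4)[OF q] by blast
  qed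
  show "F x = g x / h x" if "x \<in> ball q s" "h x \<noteq> 0" for x
    using quot_onD(5)[OF q] that sub by blast
qed

lemma holo_mult_nonzero:
  assumes g: "holo (ball p r) g" and h: "holo (ball p r) h"
    and ne: "\<exists>y\<in>ball p r. g y \<noteq> 0" "\<exists>y\<in>ball p r. h y \<noteq> 0"
  shows "\<exists>y\<in>ball p r. g y * h y \<noteq> 0"
proof (rule ccontr)
  let ?S = "{x \<in> ball p r. g x \<noteq> 0}"
  assume not: "\<not> ?thesis"
  have S: "open ?S" "?S \<noteq> {}" "?S \<subseteq> ball p r"
    using holo_open_nonzero[OF g open_ball] ne(1) by blast+
  have 0: "h x = 0" if "x \<in> ?S" for x
    using not that mult_eq_0_iff[of "g x" "h x"] by blast
  have "h x = 0" if "x \<in> ball p r" for x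
    using holo_identity[OF h open_ball convex_ball S 0 that] .
  then show False using ne(2) by blast
qed

lemma mero_fun_common:
  assumes "mero_fun F" "mero_fun G"
  obtains r g h g' h' where "quot_on F p r g h" "quot_on G p r g' h'"
proof -
  obtain r g h where 1: "quot_on F p r g h" using assms(1) unfolding mero_fun_def by blast
  obtain r' g' h' where 2: "quot_on G p r' g' h'" using assms(2) unfolding mero_fun_def by blast
  have "0 < min r r'" using quot_onD(1)[OF 1] quot_onD(1)[OF 2] by simp
  then show thesis
    using that quot_on_shrink[OF 1, of "min r r'" p] quot_on_shrink[OF 2, of "min r r'" p]
      subset_ball[of "min r r'" r p] subset_ball[of "min r r'" r' p] by simp
qed

lemma mero_fun_const [simp]: "mero_fun (\<lambda>_::complex^'n. c)"
  unfolding mero_fun_def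
proof
  fix p :: "complex^'n"
  have "quot_on (\<lambda>_. c) p 1 (\<lambda>_. c) (\<lambda>_. 1)"
    by (rule quot_onI) (auto intro: exI[of _ p])
  then show "\<exists>r g h. quot_on (\<lambda>_. c) p r g h" by blast
qed

lemma mero_fun_add:
  assumes "mero_fun F" "mero_fun G" shows "mero_fun (\<lambda>x. F x + G x)"
  unfolding mero_fun_def
proof
  fix p
  obtain r g h g' h' where *: "quot_on F p r g h" "quot_on G p r g' h'"
    using mero_fun_common[OF assms] .
  note hol = quot_onD(2,3)[OF *(1)] quot_onD(2,3)[OF *(2)]
  note F = quot_onD(5)[OF *(1)] and G = quot_onD(5)[OF *(2)]
  have "quot_on (\<lambda>x. F x + G x) p r (\<lambda>x. g x * h' x + g' x * h x) (\<lambda>x. h x * h' x)"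
  proof (rule quot_onI)
    show "\<exists>y\<in>ball p r. h y * h' y \<noteq> 0" "0 < r"
      using holo_mult_nonzero[OF hol(2,4)] quot_onD(1,4)[OF *(1)] quot_onD(4)[OF *(2)] by blast+
    fix x assume "x \<in> ball p r" "h x * h' x \<noteq> 0"
    then show "F x + G x = (g x * h' x + g' x * h x) / (h x * h' x)"
      using F[of x] G[of x] by (simp add: add_divide_distrib)
  qed (intro holo_mult holo_add hol)+
  then show "\<exists>r g h. quot_on (\<lambda>x. F x + G x) p r g h" by blast
qed

lemma mero_fun_mult:
  assumes "mero_fun F" "mero_fun G" shows "mero_fun (\<lambda>x. F x * G x)"
  unfolding mero_fun_def
proof
  fix p
  obtain r g h g' h' where *: "quot_on F p r g h" "quot_on G p r g' h'"
    using mero_fun_common[OF assms] .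
  note hol = quot_onD(2,3)[OF *(1)] quot_onD(2,3)[OF *(2)]
  note F = quot_onD(5)[OF *(1)] and G = quot_onD(5)[OF *(2)]
  have "quot_on (\<lambda>x. F x * G x) p r (\<lambda>x. g x * g' x) (\<lambda>x. h x * h' x)"
  proof (rule quot_onI)
    show "\<exists>y\<in>ball p r. h y * h' y \<noteq> 0" "0 < r"
      using holo_mult_nonzero[OF hol(2,4)] quot_onD(1,4)[OF *(1)] quot_onD(4)[OF *(2)] by blast+
    fix x assume "x \<in> ball p r" "h x * h' x \<noteq> 0"
    then show "F x * G x = (g x * g' x) / (h x * h' x)"
      using F[of x] G[of x] by (simp add: add_divide_distrib)
  qed (intro holo_mult holo_add hol)+
  then show "\<exists>r g h. quot_on (\<lambda>x. F x * G x) p r g h" by blast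
qed

lemma mero_fun_uminus: "mero_fun F \<Longrightarrow> mero_fun (\<lambda>x. - F x)"
  using mero_fun_mult[of "\<lambda>_. -1" F] by simp

lemma mero_fun_diff: "mero_fun F \<Longrightarrow> mero_fun G \<Longrightarrow> mero_fun (\<lambda>x. F x - G x)"
  using mero_fun_add[of F "\<lambda>x. - G x"] mero_fun_uminus[of G] by simp

lemma mero_fun_inverse:
  assumes "mero_fun F" shows "mero_fun (\<lambda>x. inverse (F x))"
  unfolding mero_fun_def
proof
  fix p
  obtain r g h where *: "quot_on F p r g h" using assms unfolding mero_fun_def by blast
  show "\<exists>r g h. quot_on (\<lambda>x. inverse (F x)) p r g h"
  proof (cases "\<exists>y\<in>ball p r. g y \<noteq> 0")
    case True
    note hol = quot_onD(2,3)[OF *] and F = quot_onD(5)[OF *]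
    have "quot_on (\<lambda>x. inverse (F x)) p r (\<lambda>x. h x * h x) (\<lambda>x. g x * h x)"
    proof (rule quot_onI)
      show "\<exists>y\<in>ball p r. g y * h y \<noteq> 0" "0 < r"
        using holo_mult_nonzero[OF hol True] quot_onD(1,4)[OF *] by blast+
      fix x assume "x \<in> ball p r" "g x * h x \<noteq> 0"
      then show "inverse (F x) = (h x * h x) / (g x * h x)"
        using F[of x] by simp
    qed (intro holo_mult hol)+
    then show ?thesis by blast
  next
    case False
    then have "quot_on (\<lambda>x. inverse (F x)) p r (\<lambda>x. 0) h"
      using quot_onD[OF *] by (intro quot_onI) simp_all
    then show ?thesis by blast
  qed
qed

lemma open_dense_Int:
  fixes U T :: "'a::topological_space set"
  assumes "open U" "closure U = UNIV" "open T" "closure T = UNIV"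
  shows "open (U \<inter> T)" "closure (U \<inter> T) = UNIV"
proof -
  show "open (U \<inter> T)" using assms by blast
  have "closure U \<subseteq> closure (U \<inter> T)"
    using open_Int_closure_subset[OF assms(1), of T] assms(4)
    by (intro closure_minimal) auto
  then show "closure (U \<inter> T) = UNIV" using assms(2) by auto
qed

lemma mero_eqI:
  assumes "mero_fun F" "mero_fun G" "\<And>x. F x = G x" shows "mero_eq F G"
  using assms unfolding mero_eq_def by (intro conjI exI[of _ UNIV]) auto

lemma mero_eqD: "mero_eq F F \<Longrightarrow> mero_fun F"
  by (simp add: mero_eq_def)

lemmas mero_closed = mero_fun_add mero_fun_diff mero_fun_mult mero_fun_uminus mero_fun_inverse
  mero_fun_const

lemma mero_eqI2:
  assumes F: "mero_eq F F'" and G: "mero_eq G G'"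
    and "mero_fun (\<lambda>x. b (F x) (G x))" "mero_fun (\<lambda>x. b (F' x) (G' x))"
  shows "mero_eq (\<lambda>x. b (F x) (G x)) (\<lambda>x. b (F' x) (G' x))"
proof -
  obtain U T where *: "open U" "closure U = UNIV" "\<forall>x\<in>U. F x = F' x"
     "open T" "closure T = UNIV" "\<forall>x\<in>T. G x = G' x"
    using F G unfolding mero_eq_def by auto
  then show ?thesis
    unfolding mero_eq_def using assms(3,4) open_dense_Int[OF *(1,2,4,5)]
    by (intro conjI exI[of _ "U \<inter> T"]) auto
qed

lemma mero_eq_refl: "mero_fun F \<Longrightarrow> mero_eq F F"
  unfolding mero_eq_def by (auto intro: exI[of _ UNIV])

quotient_type (overloaded) 'n mero = "(complex^('n::finite)) \<Rightarrow> complex" / partial: mero_eq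
  morphisms rep_mero mero_of
proof (rule part_equivpI)
  show "\<exists>F. mero_eq F F" by (rule exI, rule mero_eq_refl, rule mero_fun_const)
  show "symp (mero_eq :: (complex^'n \<Rightarrow> complex) \<Rightarrow> _)"
    by (auto simp: mero_eq_def symp_def)
  show "transp (mero_eq :: (complex^'n \<Rightarrow> complex) \<Rightarrow> _)"
  proof (rule transpI)
    fix F G H :: "complex^'n \<Rightarrow> complex"
    assume *: "mero_eq F G" "mero_eq G H"
    then obtain U T where **: "open U" "closure U = UNIV" "\<forall>x\<in>U. F x = G x"
      "open T" "closure T = UNIV" "\<forall>x\<in>T. G x = H x"
      unfolding mero_eq_def by auto
    then show "mero_eq F H"
      using * open_dense_Int[OF **(1,2,4,5)]
      unfolding mero_eq_def by (intro conjI exI[of _ "U \<inter> T"]) auto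
  qed
qed


lemma mero_fun_dichotomy:
  assumes F: "mero_fun F"
  shows "(\<exists>U. open U \<and> closure U = UNIV \<and> (\<forall>x\<in>U. F x = 0)) \<or>
    (\<exists>U. open U \<and> closure U = UNIV \<and> (\<forall>x\<in>U. F x \<noteq> 0))"
proof -
  define vanish where
    "vanish p \<longleftrightarrow> (\<exists>r g h. quot_on F p r g h \<and> (\<forall>x\<in>ball p r. g x = 0))" for p
  have key: "\<forall>x\<in>ball p r. g x = 0"
    if q: "vanish q" and p: "quot_on F p r g h" and qp: "q \<in> ball p r" for p q r g h
  proof -
    obtain s' g' h' where 1: "quot_on F q s' g' h'" "\<forall>x\<in>ball q s'. g' x = 0"
      using q unfolding vanish_def by blast
    obtain e where e: "0 < e" "ball q e \<subseteq> ball p r"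
      by (rule openE[OF open_ball qp])
    define s where "s = min s' e"
    have s: "0 < s" "ball q s \<subseteq> ball p r" "ball q s \<subseteq> ball q s'"
      using quot_onD(1)[OF 1(1)] e by (auto simp: s_def)
    have p': "quot_on F q s g h" and q': "quot_on F q s g' h'"
      using quot_on_shrink[OF p s(1,2)] quot_on_shrink[OF 1(1) s(1,3)] .
    let ?T = "{x \<in> ball q s. h x * h' x \<noteq> 0}"
    have "?T \<noteq> {}"
      using holo_mult_nonzero[OF quot_onD(3)[OF p'] quot_onD(3)[OF q'] quot_onD(4)[OF p']
          quot_onD(4)[OF q']] by blast
    moreover have "open ?T"
      by (rule holo_open_nonzero[OF holo_mult[OF quot_onD(3)[OF p'] quot_onD(3)[OF q']] open_ball])
    moreover have "?T \<subseteq> ball p r" using s by blast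
    moreover have "g x = 0" if "x \<in> ?T" for x
    proof -
      have "x \<in> ball q s" "h x \<noteq> 0" "h' x \<noteq> 0" "g' x = 0" using that 1(2) s(3) by auto
      then show ?thesis using quot_onD(5)[OF p', of x] quot_onD(5)[OF q', of x] by simp
    qed
    ultimately show ?thesis
      using holo_identity[OF quot_onD(2)[OF p] open_ball convex_ball] by blast
  qed
  have "open {p. vanish p}"
  proof (subst open_contains_ball, intro ballI)
    fix p assume "p \<in> {p. vanish p}"
    then obtain r g h where 1: "quot_on F p r g h" "\<forall>x\<in>ball p r. g x = 0"
      unfolding vanish_def by blast
    have "vanish q" if qp: "q \<in> ball p r" for q
    proof -
      obtain e where e: "0 < e" "ball q e \<subseteq> ball p r"
        by (rule openE[OF open_ball qp])
      then show ?thesis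
        using quot_on_shrink[OF 1(1) e] 1(2) unfolding vanish_def by blast
    qed
    then show "\<exists>e>0. ball p e \<subseteq> {p. vanish p}" using quot_onD(1)[OF 1(1)] by blast
  qed
  moreover have "open (- {p. vanish p})"
  proof (subst open_contains_ball, intro ballI)
    fix p assume p: "p \<in> - {p. vanish p}"
    obtain r g h where 1: "quot_on F p r g h" using F unfolding mero_fun_def by blast
    then have "ball p r \<subseteq> - {p. vanish p}"
      using key[OF _ 1] p unfolding vanish_def by blast
    then show "\<exists>e>0. ball p e \<subseteq> - {p. vanish p}" using quot_onD(1)[OF 1(1)] by blast
  qed
  ultimately have "{p. vanish p} = {} \<or> {p. vanish p} = UNIV"
    using clopen[of "{p. vanish p}"] by (simp add: closed_def)
  then consider "\<And>p. vanish p" | "\<And>p. \<not> vanish p" by blast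
  then show ?thesis
  proof cases
    case 1
    have "p \<in> closure (interior {x. F x = 0})" for p
      unfolding closure_approachable
    proof (intro allI impI)
      fix e :: real assume e: "0 < e"
      obtain r g h where p: "quot_on F p r g h" "\<forall>x\<in>ball p r. g x = 0"
        using 1[of p] unfolding vanish_def by blast
      have m: "0 < min r e" "ball p (min r e) \<subseteq> ball p r"
        using quot_onD(1)[OF p(1)] e by auto
      have p': "quot_on F p (min r e) g h" by (rule quot_on_shrink[OF p(1) m])
      then obtain y where y: "y \<in> ball p (min r e)" "h y \<noteq> 0" using quot_onD(4) by blast
      have "F x = 0" if "x \<in> ball p (min r e)" "h x \<noteq> 0" for x
        using quot_onD(5)[OF p' that] p(2) m(2) that(1) by (metis div_0 subset_iff)
      then have "y \<in> interior {x. F x = 0}"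
        using y holo_open_nonzero[OF quot_onD(3)[OF p'] open_ball]
        by (intro interiorI[of "{x \<in> ball p (min r e). h x \<noteq> 0}"]) auto
      then show "\<exists>y\<in>interior {x. F x = 0}. dist y p < e"
        using y(1) by (auto simp: dist_commute)
    qed
    then show ?thesis
      using interior_subset by (intro disjI1 exI[of _ "interior {x. F x = 0}"]) blast
  next
    case 2
    have "p \<in> closure (interior {x. F x \<noteq> 0})" for p
      unfolding closure_approachable
    proof (intro allI impI)
      fix e :: real assume e: "0 < e"
      obtain r g h where p: "quot_on F p r g h" using F unfolding mero_fun_def by blast
      have m: "0 < min r e" "ball p (min r e) \<subseteq> ball p r"
        using quot_onD(1)[OF p(1)] e by auto
      have p': "quot_on F p (min r e) g h" by (rule quot_on_shrink[OF p(1) m])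
      have "\<exists>x\<in>ball p (min r e). g x \<noteq> 0" using 2[of p] p' unfolding vanish_def by blast
      then obtain y where y: "y \<in> ball p (min r e)" "g y * h y \<noteq> 0"
        using holo_mult_nonzero[OF quot_onD(2,3)[OF p'] _ quot_onD(4)[OF p']] by blast
      have "F x \<noteq> 0" if "x \<in> ball p (min r e)" "g x * h x \<noteq> 0" for x
        using quot_onD(5)[OF p' that(1)] that(2) by simp
      then have "y \<in> interior {x. F x \<noteq> 0}"
        using y holo_open_nonzero[OF holo_mult[OF quot_onD(2,3)[OF p']] open_ball]
        by (intro interiorI[of "{x \<in> ball p (min r e). g x * h x \<noteq> 0}"]) auto
      then show "\<exists>y\<in>interior {x. F x \<noteq> 0}. dist y p < e"
        using y(1) by (auto simp: dist_commute)
    qed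
    then show ?thesis
      using interior_subset by (intro disjI2 exI[of _ "interior {x. F x \<noteq> 0}"]) blast
  qed
qed

instantiation mero :: (finite) field
begin

lift_definition zero_mero :: "'a mero" is "\<lambda>_. 0" by (rule mero_eq_refl, rule mero_fun_const)
lift_definition one_mero :: "'a mero" is "\<lambda>_. 1" by (rule mero_eq_refl, rule mero_fun_const)
lift_definition plus_mero :: "'a mero \<Rightarrow> 'a mero \<Rightarrow> 'a mero" is "\<lambda>F G x. F x + G x"
  by (rule mero_eqI2) (simp_all add: mero_eq_def mero_fun_add)
lift_definition minus_mero :: "'a mero \<Rightarrow> 'a mero \<Rightarrow> 'a mero" is "\<lambda>F G x. F x - G x"
  by (rule mero_eqI2) (simp_all add: mero_eq_def mero_fun_diff)
lift_definition times_mero :: "'a mero \<Rightarrow> 'a mero \<Rightarrow> 'a mero" is "\<lambda>F G x. F x * G x"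
  by (rule mero_eqI2) (simp_all add: mero_eq_def mero_fun_mult)
lift_definition uminus_mero :: "'a mero \<Rightarrow> 'a mero" is "\<lambda>F x. - F x"
  by (rule mero_eqI2[where b = "\<lambda>a b. - a"]) (simp_all add: mero_eq_def mero_fun_uminus)
lift_definition inverse_mero :: "'a mero \<Rightarrow> 'a mero" is "\<lambda>F x. inverse (F x)"
  by (rule mero_eqI2[where b = "\<lambda>a b. inverse a"]) (simp_all add: mero_eq_def mero_fun_inverse)
definition divide_mero :: "'a mero \<Rightarrow> 'a mero \<Rightarrow> 'a mero" where
  "divide_mero f g = f * inverse g"

instance
proof
  fix a b c :: "'a mero"
  show "a * b * c = a * (b * c)"
    by transfer (rule mero_eqI; ((erule mero_eqD | rule mero_closed)+ | simp add: algebra_simps))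
  show "a * b = b * a"
    by transfer (rule mero_eqI; ((erule mero_eqD | rule mero_closed)+ | simp add: algebra_simps))
  show "1 * a = a"
    by transfer (rule mero_eqI; ((erule mero_eqD | rule mero_closed)+ | simp add: algebra_simps))
  show "a + b + c = a + (b + c)"
    by transfer (rule mero_eqI; ((erule mero_eqD | rule mero_closed)+ | simp add: algebra_simps))
  show "a + b = b + a"
    by transfer (rule mero_eqI; ((erule mero_eqD | rule mero_closed)+ | simp add: algebra_simps))
  show "0 + a = a"
    by transfer (rule mero_eqI; ((erule mero_eqD | rule mero_closed)+ | simp add: algebra_simps))
  show "- a + a = 0"
    by transfer (rule mero_eqI; ((erule mero_eqD | rule mero_closed)+ | simp add: algebra_simps))
  show "a - b = a + - b"
    by transfer (rule mero_eqI; ((erule mero_eqD | rule mero_closed)+ | simp add: algebra_simps))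
  show "(a + b) * c = a * c + b * c"
    by transfer (rule mero_eqI; ((erule mero_eqD | rule mero_closed)+ | simp add: algebra_simps))
  show "(0::'a mero) \<noteq> 1"
    by transfer (auto simp: mero_eq_def)
  show "inverse a * a = 1" if "a \<noteq> 0"
    using that
  proof transfer
    fix F :: "complex^'a \<Rightarrow> complex"
    assume F: "mero_eq F F" "\<not> mero_eq F (\<lambda>_. 0)"
    then have "mero_fun F" by (simp add: mero_eq_def)
    with F obtain U where "open U" "closure U = UNIV" "\<forall>x\<in>U. F x \<noteq> 0"
      using mero_fun_dichotomy[of F] unfolding mero_eq_def by auto
    then show "mero_eq (\<lambda>x. inverse (F x) * F x) (\<lambda>_. 1)"
      using \<open>mero_fun F\<close> unfolding mero_eq_def
      by (intro conjI exI[of _ U]) (simp_all add: mero_fun_mult mero_fun_inverse)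
  qed
  show "a div b = a * inverse b" by (simp add: divide_mero_def)
  show "inverse (0::'a mero) = 0" by transfer (rule mero_eqI, simp_all)
qed

end

lemma mero_eq_affine:
  fixes L :: "complex^'n \<Rightarrow> complex^'n"
  assumes k: "\<And>x. k x = L x + b" and L: "linear L" "\<And>a v. L (a *s v) = a *s L v"
    and bij: "bij k" and FG: "mero_eq F G"
  shows "mero_eq (\<lambda>x. F (k x)) (\<lambda>x. G (k x))"
proof -
  have cont: "continuous_on UNIV k"
    unfolding k using L(1) by (intro continuous_intros linear_continuous_on)
      (simp add: linear_conv_bounded_linear)
  have "surj L"
  proof (rule surjI)
    show "L (inv k (y + b)) = y" for y
      using k[of "inv k (y + b)"] bij by (simp add: bij_is_surj surj_f_inv_f)
  qed
  have opn: "open (k ` S)" if "open S" for S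
  proof -
    have "k ` S = (\<lambda>y. b + y) ` L ` S" unfolding k by (force simp: add.commute)
    then show ?thesis
      using open_surjective_linear_image[OF that L(1) \<open>surj L\<close>] open_translation by metis
  qed
  have der: "(k has_derivative L) (at x)" for x
    unfolding k using L(1)
    by (auto intro!: derivative_eq_intros linear_imp_has_derivative)
  have holo: "holo S (\<lambda>x. f (k x))" if "holo U f" "k ` S \<subseteq> U" for f S U
    unfolding holo_def
  proof
    fix x assume "x \<in> S"
    then obtain D where D: "(f has_derivative D) (at (k x))" "\<And>a v. D (a *s v) = a * D v"
      using \<open>holo U f\<close> \<open>k ` S \<subseteq> U\<close> unfolding holo_def by blast
    show "\<exists>D. ((\<lambda>x. f (k x)) has_derivative D) (at x) \<and> (\<forall>a v. D (a *s v) = a * D v)"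
      using has_derivative_compose[OF der D(1)] D(2) L(2) by (intro exI conjI allI) auto
  qed
  have mero: "mero_fun (\<lambda>x. F (k x))" if "mero_fun F" for F
    unfolding mero_fun_def
  proof
    fix p
    obtain r g h where 1: "quot_on F (k p) r g h" using \<open>mero_fun F\<close> unfolding mero_fun_def by blast
    have "open (k -` ball (k p) r)" using cont open_vimage open_ball by blast
    moreover have "p \<in> k -` ball (k p) r" using quot_onD(1)[OF 1] by simp
    ultimately obtain s where s: "0 < s" "ball p s \<subseteq> k -` ball (k p) r" by (rule openE)
    then have sub: "k ` ball p s \<subseteq> ball (k p) r" by blast
    have "quot_on (\<lambda>x. F (k x)) p s (\<lambda>x. g (k x)) (\<lambda>x. h (k x))"
    proof (rule quot_onI[OF s(1)])
      show "holo (ball p s) (\<lambda>x. g (k x))" "holo (ball p s) (\<lambda>x. h (k x))"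
        using holo[OF _ sub] quot_onD(2,3)[OF 1] by blast+
      show "\<exists>y\<in>ball p s. h (k y) \<noteq> 0"
      proof (rule ccontr)
        assume "\<not> ?thesis"
        then have 0: "\<And>x. x \<in> k ` ball p s \<Longrightarrow> h x = 0" by blast
        have ne: "k ` ball p s \<noteq> {}" using s(1) by simp
        have "h x = 0" if "x \<in> ball (k p) r" for x
          using holo_identity[OF quot_onD(3)[OF 1] open_ball convex_ball opn[OF open_ball] ne sub 0 that] .
        then show False using quot_onD(4)[OF 1] by blast
      qed
      show "F (k x) = g (k x) / h (k x)" if "x \<in> ball p s" "h (k x) \<noteq> 0" for x
        using quot_onD(5)[OF 1] that s(2) by blast
    qed
    then show "\<exists>r g h. quot_on (\<lambda>x. F (k x)) p r g h" by blast
  qed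
  obtain U where U: "open U" "closure U = UNIV" "\<forall>x\<in>U. F x = G x"
    using FG unfolding mero_eq_def by blast
  have "open (k -` U)" using cont open_vimage U(1) by blast
  moreover have "p \<in> closure (k -` U)" for p
    unfolding closure_approachable
  proof (intro allI impI)
    fix e :: real assume "0 < e"
    then have "k ` ball p e \<inter> U \<noteq> {}"
      using open_Int_closure_eq_empty[OF opn[OF open_ball], of p e U] U(2) by auto
    then show "\<exists>y\<in>k -` U. dist y p < e" by (auto simp: dist_commute)
  qed
  ultimately show ?thesis
    using FG U(3) mero unfolding mero_eq_def by (intro conjI exI[of _ "k -` U"]) auto
qed

text \<open>The action \<open>f \<mapsto> f \<circ> g\<inverse>\<close> of affine automorphisms \<open>g\<close> of \<open>V\<close>; it is applied only to such
  \<open>g\<close>, where by the lemma below it does not depend on the chosen representative.\<close>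

definition act :: "(complex^'n \<Rightarrow> complex^'n) \<Rightarrow> 'n mero \<Rightarrow> 'n mero" where
  "act g f = mero_of (\<lambda>x. rep_mero f (inv g x))"

lemma act_mero_of:
  assumes "\<And>x. inv g x = L x + b" "linear L" "\<And>a v. L (a *s v) = a *s L v" "bij g" "mero_fun F"
  shows "act g (mero_of F) = mero_of (\<lambda>x. F (inv g x))"
proof -
  have "mero_eq (rep_mero (mero_of F)) F"
    using Quotient_rep_abs[OF Quotient_mero] mero_eq_refl[OF assms(5)] by blast
  then have "mero_eq (\<lambda>x. rep_mero (mero_of F) (inv g x)) (\<lambda>x. F (inv g x))"
    by (rule mero_eq_affine[OF assms(1-3) bij_imp_bij_inv[OF assms(4)]])
  then show ?thesis
    unfolding act_def by (rule Quotient_rel_abs[OF Quotient_mero])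
qed

abbreviation mconst :: "complex \<Rightarrow> ('n::finite) mero" where
  "mconst z \<equiv> mero_of (\<lambda>_. z)"

text \<open>Locally uniform convergence on some open dense subset of \<open>V\<close>; this determines the limit.\<close>

definition mero_tendsto :: "('h \<Rightarrow> ('n::finite) mero) \<Rightarrow> 'n mero \<Rightarrow> 'h filter \<Rightarrow> bool" where
  "mero_tendsto \<phi> \<psi> \<F> \<longleftrightarrow> (\<exists>G g U.
     (\<forall>\<^sub>F h in \<F>. mero_fun (G h) \<and> \<phi> h = mero_of (G h)) \<and> mero_fun g \<and> \<psi> = mero_of g \<and>
     open U \<and> closure U = UNIV \<and>
     (\<forall>K. compact K \<and> K \<subseteq> U \<longrightarrow> uniform_limit K G g \<F>))"

text \<open>Operators on \<open>\<complex>(V)\<close> are functions, with composition as product and pointwise addition.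
  The rank \<open>n\<close> is \<open>CARD('n)\<close>; the linear order on \<open>'n\<close> only serves to number the coordinates
  \<open>1, \<dots>, n\<close> (by \<open>idx\<close> below).\<close>

type_synonym 'n mero_op = "'n mero \<Rightarrow> 'n mero"

definition mult_op :: "('n::finite) mero \<Rightarrow> 'n mero_op" where
  "mult_op f = (\<lambda>g. f * g)"

definition transl :: "complex \<Rightarrow> int^'n \<Rightarrow> ('n::finite) mero_op" where
  "transl c \<mu> = act (\<lambda>x. x - c *s (\<chi> k. of_int (\<mu> $ k)))"

inductive_set Dq :: "complex \<Rightarrow> ('n::finite) mero_op set" for c :: complex where
  "mult_op f \<in> Dq c"
| "transl c \<mu> \<in> Dq c"
| "A \<in> Dq c \<Longrightarrow> B \<in> Dq c \<Longrightarrow> A + B \<in> Dq c"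
| "A \<in> Dq c \<Longrightarrow> B \<in> Dq c \<Longrightarrow> A \<circ> B \<in> Dq c"

definition idx :: "nat \<Rightarrow> 'n::{finite,linorder}" where
  "idx i = sorted_list_of_set UNIV ! (i - 1)"

definition swp :: "nat \<Rightarrow> nat \<Rightarrow> complex^('n::{finite,linorder}) \<Rightarrow> complex^('n::{finite,linorder})" where
  "swp i j = (\<lambda>x. \<chi> k. x $ Transposition.transpose (idx i) (idx j) k)"

definition flp :: "nat \<Rightarrow> complex^('n::{finite,linorder}) \<Rightarrow> complex^('n::{finite,linorder})" where
  "flp i = (\<lambda>x. \<chi> k. if k = idx i then - x $ k else x $ k)"

definition weyl :: "(complex^'n \<Rightarrow> complex^('n::finite)) set" where
  "weyl = {\<lambda>x. \<chi> k. \<delta> k * x $ \<sigma> k |\<sigma> \<delta>. \<sigma> permutes UNIV \<and> (\<forall>k. \<delta> k \<in> {1, -1})}"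

definition weyl_stab :: "(complex^('n::{finite,linorder}) \<Rightarrow> complex^('n::{finite,linorder})) set" where
  "weyl_stab = {w \<in> weyl. w (axis (idx 1) 1) = axis (idx 1) 1}"

definition coset_rep :: "nat \<Rightarrow> complex^('n::{finite,linorder}) \<Rightarrow> complex^('n::{finite,linorder})" where
  "coset_rep j = (if j \<le> CARD('n) then swp 1 j
     else if j = CARD('n) + 1 then flp 1
     else swp 1 (j - CARD('n)) \<circ> flp 1 \<circ> flp (j - CARD('n)))"

text \<open>An element \<open>\<Sum>\<^sub>w A\<^sub>w w\<close> of \<open>D\<^sub>q * W\<close> (with \<open>A\<^sub>w \<in> D\<^sub>q\<close>, \<open>w \<in> W\<close>) is the function \<open>w \<mapsto> A\<^sub>w\<close>, zero off \<open>W\<close>;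
  the product is determined by \<open>w A w\<inverse> = w(A)\<close>. An element \<open>\<Sum>\<^sub>w w \<otimes> f\<^sub>w\<close> of the induced module
  \<open>M \<cong> \<complex>W \<otimes> \<complex>(V)\<close> is the function \<open>w \<mapsto> f\<^sub>w\<close>, and \<open>(A u) (w \<otimes> f) = u w \<otimes> ((u w)\<inverse> A (u w)) f\<close>.\<close>

type_synonym 'n cross = "(complex^'n \<Rightarrow> complex^'n) \<Rightarrow> 'n mero_op"
type_synonym 'n indmod = "(complex^'n \<Rightarrow> complex^'n) \<Rightarrow> 'n mero"

definition cmul :: "'n cross \<Rightarrow> 'n cross \<Rightarrow> ('n::finite) cross" (infixl "\<star>" 70) where
  "A \<star> B = (\<lambda>w. if w \<in> weyl
     then \<Sum>u\<in>weyl. A u \<circ> (act u \<circ> B (inv u \<circ> w) \<circ> act (inv u)) else 0)"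

definition cfun :: "('n::finite) mero \<Rightarrow> 'n cross" where
  "cfun f = (\<lambda>w. if w = id then mult_op f else 0)"

text \<open>An element \<open>g\<close> of the affine Weyl group \<open>\<Lambda> \<rtimes> W\<close> is a translation (by \<open>g 0\<close>) after its
  linear part; this is how \<open>s\<^sub>0 = t(-\<epsilon>\<^sub>1) \<ss>\<^sub>1\<close> lies in \<open>D\<^sub>q * W\<close>.\<close>

definition cgrp :: "(complex^'n \<Rightarrow> complex^'n) \<Rightarrow> ('n::finite) cross" where
  "cgrp g = (\<lambda>w. if w = (\<lambda>x. g x - g 0) then act (\<lambda>x. x + g 0) else 0)"

definition mact :: "'n cross \<Rightarrow> 'n indmod \<Rightarrow> ('n::finite) indmod" where
  "mact A m = (\<lambda>v. if v \<in> weyl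
     then \<Sum>u\<in>weyl. act (inv v) (A u (act v (m (inv u \<circ> v)))) else 0)"

definition tens :: "(complex^'n \<Rightarrow> complex^'n) \<Rightarrow> 'n mero \<Rightarrow> ('n::finite) indmod" where
  "tens w f = (\<lambda>v. if v = w then f else 0)"

definition e' :: "('n::{finite,linorder}) cross" where
  "e' = cfun (mconst (1 / of_nat (card (weyl_stab :: (complex^('n::{finite,linorder}) \<Rightarrow> complex^('n::{finite,linorder})) set))))
          \<star> (\<Sum>w\<in>weyl_stab. cgrp w)"

text \<open>\<open>Z\<close> preserves \<open>M' = e' M = {\<Sum>\<^sub>j e' r\<^sub>j f\<^sub>j}\<close> and acts on it by the matrix \<open>A\<close> over \<open>D\<^sub>q\<close>, with
  indices \<open>1, \<dots>, 2n\<close>; \<open>r\<^sub>j\<close> is \<open>coset_rep j\<close>.\<close>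

definition is_matrix_of ::
  "complex \<Rightarrow> ('n::{finite,linorder}) cross \<Rightarrow> (nat \<Rightarrow> nat \<Rightarrow> 'n mero_op) \<Rightarrow> bool" where
  "is_matrix_of c Z A \<longleftrightarrow>
     (\<forall>k\<in>{1..2 * CARD('n)}. \<forall>j\<in>{1..2 * CARD('n)}. A k j \<in> Dq c) \<and>
     (\<forall>f :: nat \<Rightarrow> 'n mero.
        mact Z (\<Sum>j=1..2 * CARD('n). mact e' (tens (coset_rep j) (f j))) =
        (\<Sum>k=1..2 * CARD('n). \<Sum>j=1..2 * CARD('n). mact e' (tens (coset_rep k) (A k j (f j)))))"

record kvd_params =
  tau :: complex
  tau0 :: complex
  tau0v :: complex
  taun :: complex
  taunv :: complex

definition aff_refl :: "complex \<Rightarrow> nat \<Rightarrow> complex^('n::{finite,linorder}) \<Rightarrow> complex^('n::{finite,linorder})" where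
  "aff_refl c i = (if i = 0 then (\<lambda>x. \<chi> k. if k = idx 1 then c - x $ k else x $ k)
     else if i = CARD('n) then flp i else swp i (i + 1))"

definition aroot :: "complex \<Rightarrow> nat \<Rightarrow> complex^('n::{finite,linorder}) \<Rightarrow> complex" where
  "aroot c i x = (if i = 0 then c - 2 * x $ idx 1
     else if i = CARD('n) then 2 * x $ idx i else x $ idx i - x $ idx (i + 1))"

definition tau_i :: "kvd_params \<Rightarrow> nat \<Rightarrow> nat \<Rightarrow> complex" where
  "tau_i par n i = (if i = 0 then tau0 par else if i = n then taun par else tau par)"

definition cfrac :: "complex \<Rightarrow> complex \<Rightarrow> complex \<Rightarrow> complex" where
  "cfrac t tv a = inverse t * ((1 - t * tv * exp (a / 2)) * (1 + t * inverse tv * exp (a / 2))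
     / (1 - exp a))"

definition c_i :: "kvd_params \<Rightarrow> complex \<Rightarrow> nat \<Rightarrow> ('n::{finite,linorder}) mero" where
  "c_i par c i = mero_of (\<lambda>x.
     if i = 0 then cfrac (tau0 par) (tau0v par) (aroot c i x)
     else if i = CARD('n) then cfrac (taun par) (taunv par) (aroot c i x)
     else (inverse (tau par) - tau par * exp (aroot c i x)) / (1 - exp (aroot c i x)))"

definition T_op :: "kvd_params \<Rightarrow> complex \<Rightarrow> nat \<Rightarrow> ('n::{finite,linorder}) cross" where
  "T_op par c i = cfun (mconst (tau_i par CARD('n) i)) + cfun (c_i par c i) \<star> (cgrp (aff_refl c i) - cfun 1)"

definition Y1 :: "kvd_params \<Rightarrow> complex \<Rightarrow> ('n::{finite,linorder}) cross" where
  "Y1 par c = foldr (\<star>)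
     (map (T_op par c) ([1..<CARD('n)] @ [CARD('n)] @ rev [1..<CARD('n)] @ [0])) (cfun 1)"

definition fn_a :: "kvd_params \<Rightarrow> complex \<Rightarrow> complex" where
  "fn_a par z = (inverse (tau par) - tau par * exp z) / (1 - exp z)"

definition fn_b :: "kvd_params \<Rightarrow> complex \<Rightarrow> complex" where
  "fn_b par z = (tau par - inverse (tau par)) / (1 - exp z)"

definition fn_u :: "kvd_params \<Rightarrow> complex \<Rightarrow> complex" where
  "fn_u par z = inverse (taun par) * ((1 - taun par * taunv par * exp z)
     * (1 + taun par * inverse (taunv par) * exp z) / (1 - exp (2 * z)))"

text \<open>Here \<open>q = e\<^sup>c\<close> and \<open>q\<^sup>1\<^sup>/\<^sup>2 = e\<^sup>c\<^sup>/\<^sup>2\<close>; setting \<open>q = 1\<close> means \<open>c = 0\<close>.\<close>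

definition fn_ut :: "kvd_params \<Rightarrow> complex \<Rightarrow> complex \<Rightarrow> complex" where
  "fn_ut par c z = inverse (tau0 par) * ((1 - tau0 par * tau0v par * exp (c / 2) * exp z)
     * (1 + tau0 par * inverse (tau0v par) * exp (c / 2) * exp z) / (1 - exp c * exp (2 * z)))"

definition fn_vt :: "kvd_params \<Rightarrow> complex \<Rightarrow> complex \<Rightarrow> complex" where
  "fn_vt par c z = tau0 par - fn_ut par c z"

definition xx :: "nat \<Rightarrow> complex^('n::{finite,linorder}) \<Rightarrow> complex" where
  "xx i x = (if i \<le> CARD('n) then x $ idx i else - x $ idx (i - CARD('n)))"

definition eps :: "nat \<Rightarrow> int^('n::{finite,linorder})" where
  "eps i = (if i \<le> CARD('n) then axis (idx i) 1 else - axis (idx (i - CARD('n))) 1)"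

definition opp :: "nat \<Rightarrow> nat \<Rightarrow> nat \<Rightarrow> bool" where
  "opp n i j \<longleftrightarrow> i = j + n \<or> j = i + n"

definition m_a :: "kvd_params \<Rightarrow> nat \<Rightarrow> nat \<Rightarrow> ('n::{finite,linorder}) mero" where
  "m_a par i j = mero_of (\<lambda>x. fn_a par (xx i x - xx j x))"

definition m_b :: "kvd_params \<Rightarrow> nat \<Rightarrow> nat \<Rightarrow> ('n::{finite,linorder}) mero" where
  "m_b par i j = mero_of (\<lambda>x. fn_b par (xx i x - xx j x))"

definition m_a_plus :: "kvd_params \<Rightarrow> nat \<Rightarrow> nat \<Rightarrow> ('n::{finite,linorder}) mero" where
  "m_a_plus par i j = mero_of (\<lambda>x. fn_a par (xx i x + xx j x))"

definition m_u :: "kvd_params \<Rightarrow> nat \<Rightarrow> ('n::{finite,linorder}) mero" where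
  "m_u par i = mero_of (\<lambda>x. fn_u par (xx i x))"

definition m_ut :: "kvd_params \<Rightarrow> complex \<Rightarrow> nat \<Rightarrow> ('n::{finite,linorder}) mero" where
  "m_ut par c i = mero_of (\<lambda>x. fn_ut par c (xx i x))"

definition m_vt :: "kvd_params \<Rightarrow> complex \<Rightarrow> nat \<Rightarrow> ('n::{finite,linorder}) mero" where
  "m_vt par c i = mero_of (\<lambda>x. fn_vt par c (xx i x))"

definition prod_excl :: "kvd_params \<Rightarrow> nat \<Rightarrow> nat \<Rightarrow> ('n::{finite,linorder}) mero" where
  "prod_excl par i j = (\<Prod>l | l \<in> {1..2 * CARD('n)} \<and>
      \<not> (l = i \<or> opp CARD('n) l i) \<and> \<not> (l = j \<or> opp CARD('n) l j). m_a par j l)"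

text \<open>\<open>P_off\<close> gives the entries with \<open>i - j \<noteq> \<plusminus>n\<close>; in row \<open>i\<close> the only remaining entry is the
  one with \<open>j = i \<plusminus> n\<close>, so the sum over \<open>l \<noteq> j\<close> defining it only involves \<open>P_off\<close>.\<close>

definition P_off :: "kvd_params \<Rightarrow> nat \<Rightarrow> nat \<Rightarrow> ('n::{finite,linorder}) mero" where
  "P_off par i j = (if i = j then m_u par i * prod_excl par i i
     else m_u par j * m_b par i j * m_a_plus par i j * prod_excl par i j)"

definition P_mat :: "kvd_params \<Rightarrow> nat \<Rightarrow> nat \<Rightarrow> ('n::{finite,linorder}) mero" where
  "P_mat par i j = (if opp CARD('n) i j
     then mconst (tau par ^ (2 * CARD('n) - 2) * taun par) - (\<Sum>l\<in>{1..2 * CARD('n)} - {j}. P_off par i l)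
     else P_off par i j)"

definition Q_mat :: "kvd_params \<Rightarrow> complex \<Rightarrow> nat \<Rightarrow> nat \<Rightarrow> ('n::{finite,linorder}) mero_op" where
  "Q_mat par c i j = (if i = j then mult_op (m_ut par c i) \<circ> transl c (eps i)
     else if opp CARD('n) i j then mult_op (m_vt par c i) else 0)"

text \<open>Functions on the classical phase space \<open>V \<times> V\<^sup>*\<close>, meromorphic in \<open>x\<close>, are functions of the
  momentum \<open>p\<close> with values in \<open>\<complex>(V)\<close>; \<open>p\<^sub>\<mu> = \<Sum>\<^sub>k \<mu>\<^sub>k p\<^sub>k\<close>, so \<open>p\<^sub>n\<^sub>+\<^sub>i = -p\<^sub>i\<close> for \<open>\<mu> = \<epsilon>\<^sub>n\<^sub>+\<^sub>i\<close>.\<close>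

type_synonym 'n phase_fun = "complex^'n \<Rightarrow> 'n mero"

definition mom :: "int^'n \<Rightarrow> complex^('n::finite) \<Rightarrow> complex" where
  "mom \<mu> p = (\<Sum>k\<in>UNIV. of_int (\<mu> $ k) * p $ k)"

definition Q_cl :: "kvd_params \<Rightarrow> complex \<Rightarrow> nat \<Rightarrow> nat \<Rightarrow> ('n::{finite,linorder}) phase_fun" where
  "Q_cl par \<beta> i j = (\<lambda>p. if i = j then m_ut par 0 i * mconst (exp (\<beta> * mom (eps i) p))
     else if opp CARD('n) i j then m_vt par 0 i else 0)"

text \<open>The family \<open>A \<hbar>\<close> in \<open>D\<^sub>q\<close>, \<open>q = e\<^sup>c\<close> with \<open>c = -\<i>\<hbar>\<beta>\<close>, has classical limit \<open>F\<close> if the coefficients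
  of \<open>A \<hbar> = \<Sum>\<^sub>\<mu> \<phi>(\<hbar>, \<mu>) t(\<mu>)\<close> converge as \<open>\<hbar> \<rightarrow> 0\<close> and \<open>F\<close> arises by \<open>t(\<mu>) \<mapsto> exp(\<beta> p\<^sub>\<mu>)\<close>. For \<open>\<hbar> \<noteq> 0\<close>
  and \<open>\<beta> \<noteq> 0\<close> the \<open>t(\<mu>)\<close> are linearly independent over \<open>\<complex>(V)\<close>, so the coefficients are determined
  by \<open>A \<hbar>\<close>.\<close>

definition classical_limit ::
  "complex \<Rightarrow> (real \<Rightarrow> ('n::finite) mero_op) \<Rightarrow> 'n phase_fun \<Rightarrow> bool" where
  "classical_limit \<beta> A F \<longleftrightarrow> (\<exists>S \<phi> \<psi>. finite S \<and>
     (\<forall>\<^sub>F h in at 0. A h = (\<Sum>\<mu>\<in>S. mult_op (\<phi> h \<mu>) \<circ> transl (- \<i> * of_real h * \<beta>) \<mu>)) \<and>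
     (\<forall>\<mu>\<in>S. mero_tendsto (\<lambda>h. \<phi> h \<mu>) (\<psi> \<mu>) (at 0)) \<and>
     F = (\<lambda>p. \<Sum>\<mu>\<in>S. \<psi> \<mu> * mconst (exp (\<beta> * mom \<mu> p))))"

end

theory Submission
  imports Defs
begin

text \<open>
  An element \<open>m\<close> of \<open>M'\<close> is a function on \<open>W\<close> whose value at \<open>v\<close> depends only on the signed index
  \<open>l\<close> with \<open>v\<inverse>\<epsilon>\<^sub>1 = \<epsilon>\<^sub>l\<close>, and \<open>T\<^sub>i\<close> acts by \<open>(T\<^sub>i m)(v) = b m(v) + a m(s\<^sub>i v)\<close>, where \<open>a\<close>, \<open>b\<close> are evaluated at the
  coordinates permuted by \<open>v\<close>. The operator \<open>T\<^sub>0\<close> acts on \<open>M'\<close> as \<open>\<Q>\<close> followed by \<open>l \<mapsto> -l\<close>, so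
  \<open>\<P>\<^sub>i\<^sub>j\<close> has to be the entry \<open>(i, -j)\<close> of \<open>X = T\<^sub>1 \<cdots> T\<^sub>n \<cdots> T\<^sub>1\<close>. Braid relations show that \<open>X\<close>
  preserves \<open>M'\<close>. Hence an entry can be computed at any \<open>v\<close> with \<open>v\<inverse>\<epsilon>\<^sub>1 = \<epsilon>\<^sub>i\<close>: choosing \<open>v\<inverse>\<epsilon>\<^sub>2 = \<epsilon>\<^sub>j\<close>, a single
  path through \<open>W\<close> contributes to the entry \<open>(i, -j)\<close>, which gives the products. The remaining entries
  \<open>(i, i)\<close> follow from the row sums of \<open>X\<close>, which are constant.

  The classical limit is determined by the Lax matrix because the \<open>t(\<mu>)\<close> are linearly independent over
  \<open>\<complex>(V)\<close> for \<open>c \<noteq> 0\<close> (Dedekind) and because limits of meromorphic functions are unique: representatives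
  agree only off a nowhere dense set depending on \<open>h\<close>, and Baire's theorem handles a sequence \<open>h\<^sub>n \<rightarrow> 0\<close>.
\<close>

section \<open>Hecke operators on functions of signed permutations\<close>

text \<open>For i < n, invariance of m under \<open>s i\<close> is an eigenvalue statement: it is
  equivalent to \<open>T i m = t m\<close> on \<open>V\<close>, because a + b = t and a never
  vanishes. Hence braid relations, which concern operators only, carry the invariance under
  \<open>s 2\<close>, ..., \<open>s (n-1)\<close> over from m to X m. For \<open>s n\<close> the
  quartic relation between the last two operators is replaced by a direct comparison of T_{n-1} T_n
  T_{n-1} m at v and at \<open>s n v\<close>; apart from u + w = tn, the only fact about u that
  enters is \<open>b_u\<close>. Paths are few because T_i, ..., T_n never touch the positions below
  i: an index standing there is frozen, and its opposite cannot occur elsewhere in the same state.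
  Row sums are constant because each T_i multiplies the function 1 by t or by tn. All this takes
  place over an abstract field, where a, b, u are known only through a handful of identities;
  exponentials enter when these identities are verified.\<close>

definition neg_idx :: "nat \<Rightarrow> nat \<Rightarrow> nat" where
  "neg_idx n i = (if i \<le> n then i + n else i - n)"

lemma neg_idx_in [simp]: "i \<in> {1..2 * n} \<Longrightarrow> neg_idx n i \<in> {1..2 * n}"
  by (auto simp: neg_idx_def)

lemma neg_idx_neg_idx [simp]: "i \<in> {1..2 * n} \<Longrightarrow> neg_idx n (neg_idx n i) = i"
  by (auto simp: neg_idx_def)

lemmas neg_idx_simps [simp] =
  neg_idx_in[unfolded One_nat_def] neg_idx_in[unfolded atLeastAtMost_iff One_nat_def]
  neg_idx_neg_idx[unfolded One_nat_def] neg_idx_neg_idx[unfolded atLeastAtMost_iff One_nat_def]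

lemma neg_idx_neq: "1 \<le> n \<Longrightarrow> i \<in> {1..2 * n} \<Longrightarrow> neg_idx n i \<noteq> i"
  by (auto simp: neg_idx_def)

lemma neg_idx_eq_iff:
  "i \<in> {1..2 * n} \<Longrightarrow> j \<in> {1..2 * n} \<Longrightarrow> neg_idx n i = neg_idx n j \<longleftrightarrow> i = j"
  by (metis neg_idx_neg_idx)

lemma bij_betw_neg_idx: "bij_betw (neg_idx n) {1..2 * n} {1..2 * n}"
  by (rule bij_betw_byWitness[where f' = "neg_idx n"]) (use neg_idx_in in \<open>auto simp del: atLeastAtMost_iff\<close>)

text \<open>
  A state \<open>v\<close> stands for an element of \<open>W\<close>, and \<open>k j v\<close> for the index \<open>l\<close> with \<open>v\<inverse>\<epsilon>\<^sub>j = \<epsilon>\<^sub>l\<close>.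
  The operator \<open>X 1\<close> below is \<open>T\<^sub>1 \<cdots> T\<^sub>n \<cdots> T\<^sub>1\<close>.
\<close>

locale hecke_states =
  fixes n :: nat and V :: "'v set" and s :: "nat \<Rightarrow> 'v \<Rightarrow> 'v" and k :: "nat \<Rightarrow> 'v \<Rightarrow> nat"
    and a b :: "nat \<Rightarrow> nat \<Rightarrow> 'K::field" and u w :: "nat \<Rightarrow> 'K" and t tn ka :: 'K
  assumes n_pos: "1 \<le> n"
    and s_in: "v \<in> V \<Longrightarrow> 1 \<le> i \<Longrightarrow> i \<le> n \<Longrightarrow> s i v \<in> V"
    and k_s: "v \<in> V \<Longrightarrow> 1 \<le> i \<Longrightarrow> i < n \<Longrightarrow> 1 \<le> j \<Longrightarrow> j \<le> n \<Longrightarrow>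
        k j (s i v) = k (Transposition.transpose i (Suc i) j) v"
    and k_sn: "v \<in> V \<Longrightarrow> 1 \<le> j \<Longrightarrow> j \<le> n \<Longrightarrow>
        k j (s n v) = (if j = n then neg_idx n (k n v) else k j v)"
    and k_ext: "v \<in> V \<Longrightarrow> v' \<in> V \<Longrightarrow> (\<And>j. 1 \<le> j \<Longrightarrow> j \<le> n \<Longrightarrow> k j v = k j v') \<Longrightarrow> v = v'"
    and k_range: "v \<in> V \<Longrightarrow> 1 \<le> j \<Longrightarrow> j \<le> n \<Longrightarrow> k j v \<in> {1..2 * n}"
    and k_inj: "v \<in> V \<Longrightarrow> i \<noteq> j \<Longrightarrow> 1 \<le> i \<Longrightarrow> i \<le> n \<Longrightarrow> 1 \<le> j \<Longrightarrow> j \<le> n \<Longrightarrow>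
        k i v \<noteq> k j v \<and> k i v \<noteq> neg_idx n (k j v)"
    and k_surj: "v \<in> V \<Longrightarrow> p \<in> {1..2 * n} \<Longrightarrow> \<exists>j. 1 \<le> j \<and> j \<le> n \<and> (p = k j v \<or> p = neg_idx n (k j v))"
    and a_b: "i \<in> {1..2 * n} \<Longrightarrow> j \<in> {1..2 * n} \<Longrightarrow> i \<noteq> j \<Longrightarrow> a i j + b i j = t"
    and b_sum: "i \<in> {1..2 * n} \<Longrightarrow> j \<in> {1..2 * n} \<Longrightarrow> i \<noteq> j \<Longrightarrow> b i j + b j i = ka"
    and b_triple: "i \<in> {1..2 * n} \<Longrightarrow> j \<in> {1..2 * n} \<Longrightarrow> l \<in> {1..2 * n} \<Longrightarrow>
        i \<noteq> j \<Longrightarrow> i \<noteq> l \<Longrightarrow> j \<noteq> l \<Longrightarrow> b i j * b i l = b i j * b j l + b i l * b l j"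
    and a_neg: "i \<in> {1..2 * n} \<Longrightarrow> j \<in> {1..2 * n} \<Longrightarrow> a (neg_idx n j) (neg_idx n i) = a i j"
    and u_w: "i \<in> {1..2 * n} \<Longrightarrow> u i + w i = tn"
    and b_u: "i \<in> {1..2 * n} \<Longrightarrow> j \<in> {1..2 * n} \<Longrightarrow> i \<noteq> j \<Longrightarrow> i \<noteq> neg_idx n j \<Longrightarrow>
        b i j * w j + w i * b j i + u i * b j (neg_idx n i) = b i (neg_idx n j) * u (neg_idx n j)"
    and a_nz: "i \<in> {1..2 * n} \<Longrightarrow> j \<in> {1..2 * n} \<Longrightarrow> i \<noteq> j \<Longrightarrow> a i j \<noteq> 0"
begin

abbreviation ng where "ng \<equiv> neg_idx n"
abbreviation II where "II \<equiv> {1..2 * n}"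

section \<open>The operators T_i and their words X_i\<close>

definition T :: "nat \<Rightarrow> ('v \<Rightarrow> 'K) \<Rightarrow> 'v \<Rightarrow> 'K" where
  "T i m v = (if i = n then w (k n v) * m v + u (k n v) * m (s n v)
     else b (k i v) (k (Suc i) v) * m v + a (k i v) (k (Suc i) v) * m (s i v))"

definition word :: "nat \<Rightarrow> nat list" where "word i = [i..<n] @ [n] @ rev [i..<n]"

definition X :: "nat \<Rightarrow> ('v \<Rightarrow> 'K) \<Rightarrow> 'v \<Rightarrow> 'K" where "X i = foldr T (word i)"

text \<open>Invariance under all of \<open>s 2\<close>, ..., \<open>s n\<close> means that m v
  depends on \<open>k 1 v\<close> only, which is membership in M'.\<close>

definition sinv :: "nat \<Rightarrow> ('v \<Rightarrow> 'K) \<Rightarrow> bool" where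
  "sinv j m \<longleftrightarrow> (\<forall>v\<in>V. m (s j v) = m v)"

lemma set_word: "i \<le> n \<Longrightarrow> set (word i) = {i..n}"
  by (auto simp: word_def)

lemma X_n: "X n = T n"
  by (rule ext) (simp add: X_def word_def)

lemma X_step: "i < n \<Longrightarrow> X i m = T i (X (Suc i) (T i m))"
  by (simp add: X_def word_def upt_conv_Cons)

lemma T_n: "T n m v = w (k n v) * m v + u (k n v) * m (s n v)"
  by (simp add: T_def)

lemma T_less: "i \<noteq> n \<Longrightarrow>
    T i m v = b (k i v) (k (Suc i) v) * m v + a (k i v) (k (Suc i) v) * m (s i v)"
  by (simp add: T_def)

text \<open>The set A is kept general: besides \<open>V\<close> it will be the set of states with
  prescribed entries below position i, which the letters of \<open>word i\<close> preserve.\<close>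

lemma foldr_cong_on:
  assumes "\<And>v. v \<in> A \<Longrightarrow> m v = m' v" "\<And>i v. i \<in> set xs \<Longrightarrow> v \<in> A \<Longrightarrow> s i v \<in> A" "v \<in> A"
  shows "foldr T xs m v = foldr T xs m' v"
  using assms(2,3)
proof (induction xs arbitrary: v)
  case Nil then show ?case using assms(1) by simp
next
  case (Cons i xs)
  have "foldr T xs m z = foldr T xs m' z" if "z \<in> A" for z
    using Cons.IH Cons.prems(1) that by simp
  then show ?case using Cons.prems by (cases "i = n") (auto simp: T_n T_less)
qed

lemma T_cong: "1 \<le> i \<Longrightarrow> i \<le> n \<Longrightarrow> (\<And>v. v \<in> V \<Longrightarrow> m v = m' v) \<Longrightarrow> v \<in> V \<Longrightarrow> T i m v = T i m' v"
  using foldr_cong_on[of V m m' "[i]"] s_in by simp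

lemma X_cong:
  "1 \<le> i \<Longrightarrow> i \<le> n \<Longrightarrow> (\<And>v. v \<in> V \<Longrightarrow> m v = m' v) \<Longrightarrow> v \<in> V \<Longrightarrow> X i m v = X i m' v"
  unfolding X_def using foldr_cong_on[of V m m' "word i"] s_in by (simp add: set_word)

lemma foldr_sum:
  "foldr T xs (\<lambda>v. \<Sum>q\<in>Q. g q * m q v) v = (\<Sum>q\<in>Q. g q * foldr T xs (m q) v)"
proof (induction xs arbitrary: v)
  case (Cons i xs)
  have *: "foldr T xs (\<lambda>v. \<Sum>q\<in>Q. g q * m q v) = (\<lambda>v. \<Sum>q\<in>Q. g q * foldr T xs (m q) v)"
    by (rule ext) (rule Cons.IH)
  show ?case by (cases "i = n") (simp_all add: * T_n T_less sum_distrib_left algebra_simps flip: sum.distrib)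
qed simp

lemma foldr_smult: "foldr T xs (\<lambda>v. c * m v) = (\<lambda>v. c * foldr T xs m v)"
  using foldr_sum[of xs "\<lambda>_. c" "\<lambda>_. m" "{0::nat}"] by (simp add: fun_eq_iff)

lemma T_smult: "T i (\<lambda>v. c * m v) = (\<lambda>v. c * T i m v)"
  using foldr_smult[of "[i]"] by simp

lemma X_smult: "X i (\<lambda>v. c * m v) = (\<lambda>v. c * X i m v)"
  unfolding X_def by (rule foldr_smult)

lemma k_neq:
  "v \<in> V \<Longrightarrow> i \<noteq> j \<Longrightarrow> 1 \<le> i \<Longrightarrow> i \<le> n \<Longrightarrow> 1 \<le> j \<Longrightarrow> j \<le> n \<Longrightarrow> k i v \<noteq> k j v"
  using k_inj by blast

section \<open>Commutation and braid relations\<close>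

lemma T_comm:
  assumes "1 \<le> i" "Suc i < j" "j \<le> n" "v \<in> V"
  shows "T i (T j m) v = T j (T i m) v"
proof -
  have "s i (s j v) = s j (s i v)"
  proof (rule k_ext)
    fix l assume "1 \<le> l" "l \<le> n"
    then show "k l (s i (s j v)) = k l (s j (s i v))"
      using assms by (cases "j = n") (auto simp: k_s k_sn s_in Transposition.transpose_def)
  qed (use assms in \<open>auto intro!: s_in\<close>)
  moreover have "k i (s j v) = k i v" "k (Suc i) (s j v) = k (Suc i) v" "k j (s i v) = k j v"
    "j \<noteq> n \<Longrightarrow> k (Suc j) (s i v) = k (Suc j) v"
    using assms by (cases "j = n"; auto simp: k_s k_sn Transposition.transpose_def)+
  ultimately show ?thesis using assms by (cases "j = n") (simp_all add: T_n T_less algebra_simps)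
qed

lemma T_foldr_comm:
  assumes "1 \<le> i" "\<And>j. j \<in> set xs \<Longrightarrow> Suc i < j \<and> j \<le> n" "v \<in> V"
  shows "T i (foldr T xs m) v = foldr T xs (T i m) v"
  using assms(2,3)
proof (induction xs arbitrary: v)
  case (Cons j xs)
  have "T i (T j (foldr T xs m)) v = T j (T i (foldr T xs m)) v"
    using Cons.prems assms(1) by (intro T_comm) auto
  also have "\<dots> = T j (foldr T xs (T i m)) v"
    using Cons by (intro T_cong) fastforce+
  finally show ?case by simp
qed simp

text \<open>Both sides are expanded over the six elements generated by \<open>s i\<close> and
  \<open>s (Suc i)\<close>. Three coefficients agree at once; those of m at v, at
  \<open>s i v\<close> and at \<open>s (Suc i) v\<close> agree by \<open>C\<close>,
  \<open>B4\<close> and \<open>B1\<close>, all consequences of \<open>b_triple\<close>.\<close>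

lemma T_braid:
  assumes "1 \<le> i" "Suc i < n" "v \<in> V"
  shows "T i (T (Suc i) (T i m)) v = T (Suc i) (T i (T (Suc i) m)) v"
proof -
  let ?j = "Suc i"
  have in1: "s i v \<in> V" "s ?j v \<in> V" using assms s_in by auto
  then have in2: "s i (s ?j v) \<in> V" "s ?j (s i v) \<in> V" "s i (s i v) \<in> V" "s ?j (s ?j v) \<in> V"
    using assms s_in by auto
  then have in3: "s i (s ?j (s i v)) \<in> V" "s ?j (s i (s ?j v)) \<in> V" using assms s_in by auto
  have ii: "s i (s i v) = v" "s ?j (s ?j v) = v"
    using assms in1 in2 by (auto intro!: k_ext simp: k_s Transposition.transpose_def)
  have br: "s i (s ?j (s i v)) = s ?j (s i (s ?j v))"
    using assms in1 in2 in3 by (auto intro!: k_ext simp: k_s Transposition.transpose_def)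
  have ii': "s i (s i (s ?j v)) = s ?j v" "s ?j (s ?j (s i v)) = s i v"
    using assms in1 in2 s_in by (auto intro!: k_ext simp: k_s Transposition.transpose_def)
  define p q r where "p = k i v" and "q = k ?j v" and "r = k (Suc ?j) v"
  have R: "p \<in> II" "q \<in> II" "r \<in> II" unfolding p_def q_def r_def
    by (rule k_range; use assms in simp)+
  have N: "p \<noteq> q" "p \<noteq> r" "q \<noteq> r" unfolding p_def q_def r_def
    by (rule k_neq; use assms in simp)+
  have K: "k i v = p" "k ?j v = q" "k (Suc ?j) v = r"
    "k i (s i v) = q" "k ?j (s i v) = p" "k (Suc ?j) (s i v) = r"
    "k i (s ?j v) = p" "k ?j (s ?j v) = r" "k (Suc ?j) (s ?j v) = q"
    "k i (s ?j (s i v)) = q" "k ?j (s ?j (s i v)) = r" "k (Suc ?j) (s ?j (s i v)) = p"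
    "k i (s i (s ?j v)) = r" "k ?j (s i (s ?j v)) = p" "k (Suc ?j) (s i (s ?j v)) = q"
    using assms in1 by (auto simp: p_def q_def r_def k_s Transposition.transpose_def)
  note A = a_b[OF R(1,2) N(1)] a_b[OF R(2,1) N(1)[symmetric]] a_b[OF R(1,3) N(2)] a_b[OF R(2,3) N(3)]
    a_b[OF R(3,2) N(3)[symmetric]]
  have A': "a p q = t - b p q" "a q p = t - b q p" "a p r = t - b p r" "a q r = t - b q r" "a r q = t - b r q"
    using A by (simp_all add: algebra_simps)
  have B1: "b p q * b p r = b p q * b q r + b p r * b r q"
    using b_triple[OF R N(1,2,3)] .
  have S: "b q p = ka - b p q" "b r q = ka - b q r"
    using b_sum[OF R(1,2) N(1)] b_sum[OF R(2,3) N(3)] by (simp_all add: algebra_simps)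
  have B4: "b p q * b q r + b p r * b q p = b p r * b q r"
    using B1 unfolding S by algebra
  have C: "b p q * b p q * b q r + a p q * a q p * b p r = b p q * b q r * b q r + a q r * a r q * b p r"
    using B1 unfolding A' S by algebra
  have "T i (T ?j (T i m)) v =
     (b p q * b p q * b q r + a p q * a q p * b p r) * m v
     + (a p q * (b p q * b q r + b p r * b q p)) * m (s i v)
     + a q r * (b p q * b p r) * m (s ?j v)
     + a q r * b p q * a p r * m (s i (s ?j v)) + a p q * a p r * b q r * m (s ?j (s i v))
     + a p q * a p r * a q r * m (s i (s ?j (s i v)))"
    using assms by (simp add: T_less K ii ii' algebra_simps)
  also have "\<dots> = (b p q * b q r * b q r + a q r * a r q * b p r) * m v
     + (a p q * (b p r * b q r)) * m (s i v)
     + a q r * (b p q * b q r + b p r * b r q) * m (s ?j v)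
     + a q r * b p q * a p r * m (s i (s ?j v)) + a p q * a p r * b q r * m (s ?j (s i v))
     + a p q * a p r * a q r * m (s ?j (s i (s ?j v)))"
    by (simp only: C B4 B1 br)
  also have "\<dots> = T ?j (T i (T ?j m)) v"
    using assms by (simp add: T_less K ii ii' algebra_simps)
  finally show ?thesis .
qed

section \<open>Invariance of X under the stabiliser of the first basis vector\<close>

lemma T_const: "1 \<le> i \<Longrightarrow> i \<le> n \<Longrightarrow> sinv i m \<Longrightarrow> v \<in> V \<Longrightarrow> i < n \<Longrightarrow> T i m v = t * m v"
  using a_b[of "k i v" "k (Suc i) v"] k_range[of v i] k_range[of v "Suc i"] k_neq[of v i "Suc i"]
  by (simp add: T_less sinv_def flip: distrib_right) (simp add: add.commute)

text \<open>After b = t - a the eigenvalue equation says that a times the difference of m at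
  \<open>s i v\<close> and at v is zero, and a is nonzero.\<close>

lemma sinvI:
  assumes "1 \<le> i" "i < n" "\<And>v. v \<in> V \<Longrightarrow> T i m v = t * m v"
  shows "sinv i m"
  unfolding sinv_def
proof
  fix v assume v: "v \<in> V"
  have R: "k i v \<in> II" "k (Suc i) v \<in> II" "k i v \<noteq> k (Suc i) v"
    using k_range[OF v] k_neq[OF v] assms by auto
  have "b (k i v) (k (Suc i) v) = t - a (k i v) (k (Suc i) v)"
    using a_b[OF R] by (simp add: algebra_simps)
  then have "a (k i v) (k (Suc i) v) * (m (s i v) - m v) = 0"
    using assms(3)[OF v] assms(2) T_less[of i m v] by (simp add: right_diff_distrib left_diff_distrib)
  then show "m (s i v) = m v" using a_nz[OF R] by simp
qed

lemma sinv_T: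
  assumes "1 \<le> i" "Suc i < j" "j \<le> n" "sinv j m"
  shows "sinv j (T i m)"
  unfolding sinv_def
proof
  fix v assume v: "v \<in> V"
  have "s i (s j v) = s j (s i v)"
  proof (rule k_ext)
    fix l assume "1 \<le> l" "l \<le> n"
    then show "k l (s i (s j v)) = k l (s j (s i v))"
      using assms v by (cases "j = n") (auto simp: k_s k_sn s_in Transposition.transpose_def)
  qed (use assms v in \<open>auto intro!: s_in\<close>)
  moreover have "k i (s j v) = k i v" "k (Suc i) (s j v) = k (Suc i) v"
    using assms v by (cases "j = n"; auto simp: k_s k_sn Transposition.transpose_def)+
  moreover have "m (s j (s i v)) = m (s i v)" "m (s j v) = m v"
    using assms v s_in[of v i] by (auto simp: sinv_def)
  ultimately show "T i m (s j v) = T i m v" using assms by (simp add: T_less)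
qed

text \<open>The quartic relation is used in the group only, where it gives equal values of m at
  \<open>D (s n v)\<close> and \<open>D v\<close>. Otherwise passing from v to \<open>s n v\<close>
  replaces q by -q, and the two expressions agree by \<open>b_u\<close> for the pairs (p, q) and (p,
  -q).\<close>

lemma sinv_rank_two:
  assumes i: "1 \<le> i" "Suc i = n" and m: "sinv n m"
  shows "sinv n (T i (T n (T i m)))"
  unfolding sinv_def
proof
  fix v assume v: "v \<in> V"
  have ks: "k j (s i v) = k (Transposition.transpose i n j) v" if "v \<in> V" "1 \<le> j" "j \<le> n" for j v
    using k_s[OF that(1) i(1) _ that(2,3)] i by simp
  have i': "1 \<le> i" "i < n" using i by auto
  define F where "F = T i (T n (T i m))"
  define D where "D v = s i (s n (s i v))" for v
  have F: "F v = b p q * (w q * (b p q * m v + a p q * m (s i v)) + u q * (b p (ng q) * m v + a p (ng q) * m (s i (s n v))))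
      + a p q * (w p * (b q p * m (s i v) + a q p * m v) + u p * (b q (ng p) * m (s i v) + a q (ng p) * m (D v)))"
    if "v \<in> V" "p = k i v" "q = k n v" for v p q
  proof -
    have in1: "s i v \<in> V" "s n v \<in> V" using that i s_in by auto
    then have in2: "s n (s i v) \<in> V" "s i (s i v) \<in> V" using i s_in by auto
    have K: "k i v = p" "k n v = q" "k i (s i v) = q" "k n (s i v) = p"
      "k i (s n v) = p" "k n (s n v) = ng q" "k i (s n (s i v)) = q" "k n (s n (s i v)) = ng p"
      using that i in1 by (auto simp: k_s k_sn Transposition.transpose_def)
    have ii: "s i (s i v) = v"
      using i in1 in2 that by (auto intro!: k_ext simp: k_s Transposition.transpose_def)
    have M: "m (s n v) = m v" "m (s n (s i v)) = m (s i v)"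
      using m that in1 unfolding sinv_def by auto
    show ?thesis
      using i by (simp add: F_def T_n T_less K ii M D_def)
  qed
  let ?v' = "s n v"
  have in1: "s i v \<in> V" "?v' \<in> V" using v i s_in by auto
  then have in2: "s n (s i v) \<in> V" "s i ?v' \<in> V" "s n ?v' \<in> V" using i s_in by auto
  then have in3: "s i (s n (s i v)) \<in> V" "s n (s i ?v') \<in> V" "s i (s n (s i ?v')) \<in> V" 
     using i s_in by auto
  then have in4: "s n (s i (s n (s i v))) \<in> V" using i s_in by auto
  define p q where "p = k i v" and "q = k n v"
  have R: "p \<in> II" "q \<in> II" "p \<noteq> q" "p \<noteq> ng q"
    using k_range[OF v] k_inj[OF v, of i n] i by (auto simp: p_def q_def)
  have R': "ng q \<in> II" "ng p \<in> II" using R(1,2) by (simp_all del: atLeastAtMost_iff)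
  have R'': "q \<noteq> ng p" using R by auto
  have K': "p = k i ?v'" "ng q = k n ?v'" using i v by (auto simp: p_def q_def k_sn)
  have ii: "s n ?v' = v"
    using in1 in2 v k_range[OF v, of n] n_pos by (auto intro!: k_ext simp: k_sn)
  have "s n (D v) = D ?v'"
    unfolding D_def
  proof (rule k_ext)
    fix j assume "1 \<le> j" "j \<le> n"
    then consider "j = i" | "j = n" | "j \<noteq> i" "j \<noteq> n" "1 \<le> j" "j \<le> n" by blast
    then show "k j (s n (s i (s n (s i v)))) = k j (s i (s n (s i (s n v))))"
      using i' in1 in2 in3 in4 v by cases (simp_all add: ks k_sn Transposition.transpose_def)
  qed (use in3 in4 in auto)
  then have MD: "m (D ?v') = m (D v)"
    using m in3 unfolding sinv_def D_def by metis
  have Mv: "m ?v' = m v" using m v by (simp add: sinv_def)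
  have qq: "ng (ng q) = q" using R by simp
  note Fv = F[OF v p_def q_def] and Fv' = F[OF in1(2) K', unfolded ii Mv MD qq]
  have e1: "b p q * w q + w p * b q p + u p * b q (ng p) = b p (ng q) * u (ng q)"
    using b_u[OF R] .
  have e2: "b p (ng q) * w (ng q) + w p * b (ng q) p + u p * b (ng q) (ng p) = b p q * u q"
    using b_u[OF R(1) R'(1)] R qq by simp
  have a1: "a q (ng p) = a p (ng q)" using a_neg[OF R(1) R'(1)] qq by simp
  have a2: "a (ng q) (ng p) = a p q" using a_neg[OF R(1,2)] .
  have w1: "w q = tn - u q" "w (ng q) = tn - u (ng q)" "w p = tn - u p"
    using u_w R R' by (simp_all add: algebra_simps eq_diff_eq)
  have b1: "b p q = t - a p q" "b q p = t - a q p" "b p (ng q) = t - a p (ng q)"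
    "b (ng q) p = t - a (ng q) p" "b q (ng p) = t - a q (ng p)" "b (ng q) (ng p) = t - a (ng q) (ng p)"
    using a_b[of p q] a_b[of q p] a_b[of p "ng q"] a_b[of "ng q" p] a_b[of q "ng p"] a_b[of "ng q" "ng p"]
      R R' R'' neg_idx_eq_iff[of q n p] by (simp_all add: algebra_simps eq_diff_eq del: atLeastAtMost_iff)
  have "F v = F ?v'"
    unfolding Fv Fv' using e1 e2 unfolding b1 w1 a1 a2 by algebra
  then show "T i (T n (T i m)) (s n v) = T i (T n (T i m)) v" by (simp add: F_def)
qed

lemma X_comm:
  assumes "1 \<le> i" "Suc i < j" "j \<le> n" "v \<in> V"
  shows "T i (X j m) v = X j (T i m) v"
  unfolding X_def using assms set_word[of j] by (intro T_foldr_comm) auto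

text \<open>Write X_i = T_i T_j X_{i+2} T_j T_i with j = i + 1 < n. Two braid relations, and the
  commutation of T_i with X_{i+2}, move a T_j from the far left to the far right, where it acts on m
  as t. For j > i + 1 the reflection s_j passes through T_i and induction applies to
  \<open>T i m\<close>; for j = i + 1 = n the rank two case remains.\<close>

lemma sinv_X:
  assumes "1 \<le> i" "i \<le> n" "\<And>j. i < j \<Longrightarrow> j \<le> n \<Longrightarrow> sinv j m" "i < j" "j \<le> n"
  shows "sinv j (X i m)"
  using assms
proof (induction "n - i" arbitrary: i j m)
  case 0 then show ?case by simp
next
  case (Suc d)
  then have i: "i < n" "1 \<le> i" by auto
  consider "Suc i < j" | "j = Suc i" "Suc i < n" | "j = Suc i" "Suc i = n" using Suc by linarith
  then show ?case
  proof cases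
    case 1
    have "sinv j (X (Suc i) (T i m))"
      using 1 Suc.prems Suc.hyps(2) i
      by (intro Suc.hyps(1)) (auto intro!: sinv_T)
    then show ?thesis using 1 Suc.prems i by (auto simp: X_step intro!: sinv_T)
  next
    case 2
    let ?j = "Suc i" and ?X = "X (Suc (Suc i))"
    have "T ?j (X i m) v = t * X i m v" if v: "v \<in> V" for v
    proof -
      have c1: "T i (?X m') v' = ?X (T i m') v'" if "v' \<in> V" for m' v'
        using that 2 i by (intro X_comm) auto
      have c2: "T i (T ?j (T i m)) v' = t * T ?j (T i m) v'" if "v' \<in> V" for v'
      proof -
        have "T ?j (T i (T ?j m)) v' = T ?j (T i (\<lambda>v. t * m v)) v'"
          using that 2 i Suc.prems(3) by (intro T_cong T_const) auto
        then show ?thesis using T_braid[of i v' m] that 2 i by (simp add: T_smult)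
      qed
      have "T ?j (X i m) v = T ?j (T i (T ?j (?X (T ?j (T i m))))) v"
        using i 2 by (simp add: X_step)
      also have "\<dots> = T i (T ?j (T i (?X (T ?j (T i m))))) v"
        using T_braid v i 2 by simp
      also have "\<dots> = T i (T ?j (?X (T i (T ?j (T i m))))) v"
        using i 2 v c1 by (intro T_cong) auto
      also have "\<dots> = T i (T ?j (?X (\<lambda>v. t * T ?j (T i m) v))) v"
        using i 2 v c2 by (intro T_cong X_cong) auto
      also have "\<dots> = t * X i m v"
        using i 2 by (simp add: X_step T_smult X_smult)
      finally show ?thesis .
    qed
    then show ?thesis using 2 i by (auto intro: sinvI)
  next
    case 3
    have "X i m = T i (T n (T i m))" using i 3 by (simp add: X_step X_n)
    moreover have "sinv n (T i (T n (T i m)))" using 3 i Suc.prems(3) by (intro sinv_rank_two) auto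
    moreover have "j = n" using 3 by simp
    ultimately show ?thesis by simp
  qed
qed

lemma X_local:
  assumes "1 \<le> i" "i \<le> n" "v \<in> V"
    and "\<And>v'. v' \<in> V \<Longrightarrow> (\<And>j. 1 \<le> j \<Longrightarrow> j < i \<Longrightarrow> k j v' = k j v) \<Longrightarrow> m v' = m' v'"
  shows "X i m v = X i m' v"
  unfolding X_def
proof (rule foldr_cong_on[where A = "{v' \<in> V. \<forall>j. 1 \<le> j \<and> j < i \<longrightarrow> k j v' = k j v}"])
  fix l v' assume l: "l \<in> set (word i)" and v': "v' \<in> {v' \<in> V. \<forall>j. 1 \<le> j \<and> j < i \<longrightarrow> k j v' = k j v}"
  have "i \<le> l" "l \<le> n" using l assms set_word by auto
  moreover have "k j (s l v') = k j v'" if "1 \<le> j" "j < i" for j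
    using that \<open>i \<le> l\<close> \<open>l \<le> n\<close> v' by (cases "l = n") (auto simp: k_s k_sn Transposition.transpose_def)
  ultimately show "s l v' \<in> {v' \<in> V. \<forall>j. 1 \<le> j \<and> j < i \<longrightarrow> k j v' = k j v}"
    using v' assms(1) by (auto intro!: s_in)
next
  show "\<And>v'. v' \<in> {v' \<in> V. \<forall>j. 1 \<le> j \<and> j < i \<longrightarrow> k j v' = k j v} \<Longrightarrow> m v' = m' v'"
    using assms(4) by blast
  show "v \<in> {v' \<in> V. \<forall>j. 1 \<le> j \<and> j < i \<longrightarrow> k j v' = k j v}" using assms(3) by simp
qed

lemma X_zero:
  assumes "1 \<le> i" "i \<le> n" "v \<in> V"
    and "\<And>v'. v' \<in> V \<Longrightarrow> (\<And>j. 1 \<le> j \<Longrightarrow> j < i \<Longrightarrow> k j v' = k j v) \<Longrightarrow> m v' = 0"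
  shows "X i m v = 0"
  using X_local[of i v m "\<lambda>v'. 0 * m v'"] assms X_smult[of i 0 m] by simp

lemma X_one: "1 \<le> i \<Longrightarrow> i \<le> n \<Longrightarrow> v \<in> V \<Longrightarrow> X i (\<lambda>_. 1) v = t ^ (2 * (n - i)) * tn"
proof (induction "n - i" arbitrary: i v)
  case 0
  then have "i = n" by simp
  then show ?case using u_w[of "k n v"] k_range[of v n] 0 by (simp add: X_n T_n add.commute)
next
  case (Suc d)
  then have i: "i < n" by simp
  have c: "T i (\<lambda>_. c) v' = t * c" if "v' \<in> V" for c v'
    using T_const[of i "\<lambda>_. c" v'] that Suc i by (simp add: sinv_def)
  have "X (Suc i) (T i (\<lambda>_. 1)) v' = t * (t ^ (2 * (n - Suc i)) * tn)" if "v' \<in> V" for v'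
    using X_cong[of "Suc i" "T i (\<lambda>_. 1)" "\<lambda>_. t * 1" v'] c[of _ 1] that i Suc
    by (simp only: X_smult)
  then have "X i (\<lambda>_. 1) v = T i (\<lambda>_. t * (t ^ (2 * (n - Suc i)) * tn)) v"
    unfolding X_step[OF i] using Suc by (intro T_cong) auto
  also have "\<dots> = t ^ (2 * Suc (n - Suc i)) * tn"
    using c Suc.prems(3) by (simp add: mult.assoc)
  also have "Suc (n - Suc i) = n - i" using i by simp
  finally show ?case .
qed

text \<open>Sorting by adjacent moves, through position \<open>n\<close> if a sign change is needed.\<close>

lemma bubble:
  assumes inv: "\<And>l. i \<le> l \<Longrightarrow> l \<le> n \<Longrightarrow> sinv l F" and i: "1 \<le> i" and p: "p \<in> II"
    and v: "v \<in> V" "i \<le> j" "j \<le> n" "p = k j v \<or> p = ng (k j v)"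
  shows "\<exists>v'\<in>V. F v' = F v \<and> (\<forall>l. 1 \<le> l \<and> l < i \<longrightarrow> k l v' = k l v) \<and> k i v' = p"
proof -
  have pos: "\<exists>v'\<in>V. F v' = F v \<and> (\<forall>l. 1 \<le> l \<and> l < i \<longrightarrow> k l v' = k l v) \<and> k i v' = p"
    if "v \<in> V" "i \<le> j" "j \<le> n" "k j v = p" for v j
    using that(2,1,3,4)
  proof (induction j arbitrary: v rule: dec_induct)
    case base then show ?case by blast
  next
    case (step j)
    have "s j v \<in> V" "k j (s j v) = p" "F (s j v) = F v" "\<And>l. 1 \<le> l \<and> l < i \<Longrightarrow> k l (s j v) = k l v"
      using step i inv[of j] by (auto simp: k_s s_in sinv_def Transposition.transpose_def)
    then show ?case using step.IH[of "s j v"] step.prems by auto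
  qed
  have neg: "\<exists>v'\<in>V. F v' = F v \<and> (\<forall>l. 1 \<le> l \<and> l < i \<longrightarrow> k l v' = k l v) \<and> k i v' = p"
    if "v \<in> V" "j \<le> n" "i \<le> j" "k j v = ng p" for v j
    using that(2,1,3,4)
  proof (induction j arbitrary: v rule: inc_induct)
    case base
    have "s n v \<in> V" "k n (s n v) = p" "F (s n v) = F v" "\<And>l. 1 \<le> l \<and> l < i \<Longrightarrow> k l (s n v) = k l v"
      using base i p n_pos inv[of n] by (auto simp: k_sn s_in sinv_def)
    then show ?case using pos[of "s n v" n] base by auto
  next
    case (step j)
    have "s j v \<in> V" "k (Suc j) (s j v) = ng p" "F (s j v) = F v" "\<And>l. 1 \<le> l \<and> l < i \<Longrightarrow> k l (s j v) = k l v"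
      using step i inv[of j] by (auto simp: k_s s_in sinv_def Transposition.transpose_def)
    then show ?case using step.IH[of "s j v"] step.prems by auto
  qed
  show ?thesis using pos[OF v(1,2,3)] neg[OF v(1,3,2)] v(4) k_range[OF v(1), of j] v i by auto
qed

text \<open>
  With \<open>p = k i v\<close>, the only way for \<open>-p\<close> to arrive at position \<open>i\<close> is that every factor of the word moves:
  \<open>p\<close> travels to position \<open>n\<close>, changes its sign there, and travels back.
\<close>

lemma X_delta_opposite:
  assumes "1 \<le> i" "i \<le> n" "v \<in> V" "q \<in> II" "k i v = ng q"
    and "\<And>v'. v' \<in> V \<Longrightarrow> (\<And>j. 1 \<le> j \<Longrightarrow> j < i \<Longrightarrow> k j v' = k j v) \<Longrightarrow>
          m v' = (if k i v' = q then c else 0)"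
  shows "X i m v = c * u (k i v) * (\<Prod>l\<in>{i<..n}. a (k i v) (k l v) * a (k i v) (ng (k l v)))"
  using assms
proof (induction "n - i" arbitrary: i v m c)
  case 0
  then have i: "i = n" by simp
  have "k n v \<noteq> q" using 0 i neg_idx_neq[of n q] n_pos by simp
  moreover have "k n (s n v) = q" using 0 i n_pos by (simp add: k_sn)
  moreover have "m v = 0" "m (s n v) = c"
    using "0.prems"(6)[of v] "0.prems"(6)[of "s n v"] 0 i calculation by (auto simp: s_in k_sn)
  ultimately show ?case using i by (simp add: X_n T_n)
next
  case (Suc d)
  then have i: "i < n" "1 \<le> i" by auto
  define p r where "p = k i v" and "r = k (Suc i) v"
  have R: "p \<in> II" "r \<in> II" "p \<noteq> r" "p \<noteq> ng r" using k_range[OF \<open>v \<in> V\<close>] k_inj[OF \<open>v \<in> V\<close>, of i "Suc i"] i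
    by (auto simp: p_def r_def)
  have q: "q = ng p" using Suc.prems by (simp add: p_def)
  have rq: "r \<noteq> q" using R by (auto simp: q)
  have sv: "s i v \<in> V" using i Suc.prems s_in by simp
  have ks: "k i (s i v) = r" "k (Suc i) (s i v) = p" using i Suc.prems by (auto simp: k_s p_def r_def)
  \<comment> \<open>If the leftmost \<open>T i\<close> does not move, p stays at position i while
    X_{i+1} acts. Then -p stands at no position at all, and the rightmost \<open>T i\<close> cannot
    bring it to position i.\<close>
  have stay: "X (Suc i) (T i m) v = 0"
  proof (rule X_zero)
    fix v' assume v': "v' \<in> V" "\<And>j. 1 \<le> j \<Longrightarrow> j < Suc i \<Longrightarrow> k j v' = k j v"
    have kp: "k i v' = p" using v'(2)[of i] i by (simp add: p_def)
    have "k (Suc i) v' \<noteq> q"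
      using k_inj[OF v'(1), of "Suc i" i] i by (simp add: kp q)
    moreover have "p \<noteq> q" using q neg_idx_neq[of n p] R(1) n_pos by auto
    moreover have "s i v' \<in> V" "\<And>j. 1 \<le> j \<Longrightarrow> j < i \<Longrightarrow> k j (s i v') = k j v" "k i (s i v') = k (Suc i) v'"
      using v' i by (auto simp: s_in k_s Transposition.transpose_def)
    ultimately have "m v' = 0" "m (s i v') = 0"
      using Suc.prems(6)[of v'] Suc.prems(6)[of "s i v'"] v' kp by auto
    then show "T i m v' = 0" using i by (simp add: T_less)
  qed (use i Suc.prems in auto)
  \<comment> \<open>After the move r is frozen at position i and p stands at position i + 1. The
    rightmost \<open>T i\<close> has to fetch -p from there; its weight \<open>a r q\<close> is
    absorbed into the constant c of the induction hypothesis.\<close>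
  have "X (Suc i) (T i m) (s i v) = a r q * c * u (k (Suc i) (s i v)) *
     (\<Prod>l\<in>{Suc i<..n}. a (k (Suc i) (s i v)) (k l (s i v)) * a (k (Suc i) (s i v)) (ng (k l (s i v))))"
  proof (rule Suc.hyps(1))
    fix v' assume v': "v' \<in> V" "\<And>j. 1 \<le> j \<Longrightarrow> j < Suc i \<Longrightarrow> k j v' = k j (s i v)"
    have kr: "k i v' = r" using v'(2)[of i] i ks by simp
    have "\<And>j. 1 \<le> j \<Longrightarrow> j < i \<Longrightarrow> k j v' = k j v"
      using v'(2) i Suc.prems by (auto simp: k_s Transposition.transpose_def)
    moreover from this have "\<And>j. 1 \<le> j \<Longrightarrow> j < i \<Longrightarrow> k j (s i v') = k j v"
      using v'(1) i by (auto simp: k_s Transposition.transpose_def)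
    moreover have "s i v' \<in> V" "k i (s i v') = k (Suc i) v'"
      using v' i by (auto simp: s_in k_s)
    ultimately have "m v' = 0" "m (s i v') = (if k (Suc i) v' = q then c else 0)"
      using Suc.prems(6)[of v'] Suc.prems(6)[of "s i v'"] v' kr rq by auto
    then show "T i m v' = (if k (Suc i) v' = q then a r q * c else 0)"
      using i by (simp add: T_less kr)
  qed (use i Suc sv ks q R in auto)
  also have "(\<Prod>l\<in>{Suc i<..n}. a (k (Suc i) (s i v)) (k l (s i v)) * a (k (Suc i) (s i v)) (ng (k l (s i v))))
     = (\<Prod>l\<in>{Suc i<..n}. a p (k l v) * a p (ng (k l v)))"
    using i Suc.prems by (intro prod.cong) (auto simp: ks k_s Transposition.transpose_def)
  finally have move: "X (Suc i) (T i m) (s i v) =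
     a r q * c * u p * (\<Prod>l\<in>{Suc i<..n}. a p (k l v) * a p (ng (k l v)))" by (simp add: ks)
  \<comment> \<open>Since q = -p, \<open>a_neg\<close> lets the return of -p past r count as p
    passing -r; this is the second factor of the product for the position i + 1.\<close>
  have "a r q = a p (ng r)" using a_neg[of p "ng r"] R by (simp add: q del: atLeastAtMost_iff)
  moreover have "{i<..n} = insert (Suc i) {Suc i<..n}" using i by auto
  ultimately show ?case
    using i by (simp add: X_step T_less stay move flip: p_def r_def)
qed

text \<open>With -q at position 2 the leftmost \<open>T 1\<close> must stay, with factor b:
  otherwise -q would be frozen at position 1 and q could never arrive. Next X_2 turns -q into q at
  position 2, as in \<open>X_delta_opposite\<close>, and the rightmost \<open>T 1\<close> must move
  q to position 1, with factor a.\<close>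

lemma X_delta_second:
  assumes n: "2 \<le> n" and v: "v \<in> V" and q: "q \<in> II" "k 2 v = ng q"
  shows "X 1 (\<lambda>v. if k 1 v = q then 1 else 0) v =
    b (k 1 v) (k 2 v) * a (k 1 v) (ng (k 2 v)) * u (k 2 v)
     * (\<Prod>l\<in>{2<..n}. a (k 2 v) (k l v) * a (k 2 v) (ng (k l v)))" (is "X 1 ?m v = _")
proof -
  have K: "k 1 v \<noteq> q" using k_inj[OF v, of 1 2] n q by auto
  have sv: "s 1 v \<in> V" using n v s_in by simp
  have stay: "X 2 (T 1 ?m) v =
      a (k 1 v) q * u (k 2 v) * (\<Prod>l\<in>{2<..n}. a (k 2 v) (k l v) * a (k 2 v) (ng (k l v)))"
  proof (rule X_delta_opposite)
    fix v' assume v': "v' \<in> V" "\<And>j. 1 \<le> j \<Longrightarrow> j < 2 \<Longrightarrow> k j v' = k j v"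
    then have "k 1 v' = k 1 v" by simp
    moreover have "k 1 (s 1 v') = k 2 v'" using v' n by (simp add: k_s numeral_2_eq_2)
    ultimately show "T 1 ?m v' = (if k 2 v' = q then a (k 1 v) q else 0)"
      using n K by (simp add: T_less numeral_2_eq_2)
  qed (use n v q in auto)
  have "X 2 (T 1 ?m) (s 1 v) = 0"
  proof (rule X_zero)
    fix v' assume v': "v' \<in> V" "\<And>j. 1 \<le> j \<Longrightarrow> j < 2 \<Longrightarrow> k j v' = k j (s 1 v)"
    have k1: "k 1 v' = ng q" using v'(2)[of 1] n v q by (simp add: k_s numeral_2_eq_2)
    have "k 1 (s 1 v') = k 2 v'" using v' n by (simp add: k_s numeral_2_eq_2)
    moreover have "k 2 v' \<noteq> q" using k_inj[OF v'(1), of 2 1] n q k1 by simp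
    moreover have "ng q \<noteq> q" using neg_idx_neq q n by simp
    ultimately show "T 1 ?m v' = 0" using n k1 by (simp add: T_less)
  qed (use n sv in auto)
  with stay show ?thesis
    using n q X_step[of 1 ?m] T_less[of 1] by (simp add: numeral_2_eq_2 ac_simps)
qed

text \<open>The entries of a state, taken with both signs, run through all indices exactly once. The
  positions beyond i thus leave out precisely the indices excluded in the primed products of P, with
  i = 1 on the diagonal and i = 2 off it.\<close>

lemma prod_tail:
  assumes "v \<in> V" "1 \<le> i" "i \<le> n"
  shows "(\<Prod>l\<in>{i<..n}. g (k l v) * g (ng (k l v))) =
    (\<Prod>l\<in>II - (\<Union>j\<in>{1..i}. {k j v, ng (k j v)}). g l :: 'K)"
proof -
  let ?A = "(\<lambda>l. k l v) ` {i<..n}" and ?B = "(\<lambda>l. ng (k l v)) ` {i<..n}"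
  have i1: "inj_on (\<lambda>l. k l v) {i<..n}" using k_inj[OF assms(1)] assms unfolding inj_on_def by force
  have i2: "inj_on (\<lambda>l. ng (k l v)) {i<..n}"
  proof (rule inj_onI)
    fix x y assume "x \<in> {i<..n}" "y \<in> {i<..n}" "ng (k x v) = ng (k y v)"
    moreover from this have "k x v = k y v"
      using neg_idx_eq_iff[of "k x v" n "k y v"] k_range[OF assms(1)] assms by simp
    ultimately show "x = y" using i1 unfolding inj_on_def by blast
  qed
  have dis: "?A \<inter> ?B = {}"
  proof -
    have "k j v \<noteq> ng (k l v)" if "j \<in> {i<..n}" "l \<in> {i<..n}" for j l
      using that assms k_inj[OF assms(1), of j l] neg_idx_neq[of n "k j v"] k_range[OF assms(1), of j] n_pos
      by (cases "j = l") auto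
    then show ?thesis by blast
  qed
  have "II - (\<Union>j\<in>{1..i}. {k j v, ng (k j v)}) = ?A \<union> ?B" (is "?L = _")
  proof
    show "?L \<subseteq> ?A \<union> ?B"
    proof
      fix p assume p: "p \<in> ?L"
      then obtain j where j: "1 \<le> j" "j \<le> n" "p = k j v \<or> p = ng (k j v)"
        using k_surj[OF assms(1)] by blast
      then have "i < j" using p by force
      then show "p \<in> ?A \<union> ?B" using j by auto
    qed
    have "k l v \<in> ?L" "ng (k l v) \<in> ?L" if l: "i < l" "l \<le> n" for l
    proof -
      have R: "k l v \<in> II" "ng (k l v) \<in> II" using k_range[OF assms(1), of l] l assms
        by (simp_all del: atLeastAtMost_iff)
      have "k l v \<noteq> k j v" "k l v \<noteq> ng (k j v)" "ng (k l v) \<noteq> k j v" "ng (k l v) \<noteq> ng (k j v)"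
        if "j \<in> {1..i}" for j
        using k_inj[OF assms(1), of l j] k_inj[OF assms(1), of j l] that l assms R
          k_range[OF assms(1), of j] neg_idx_eq_iff by auto
      then show "k l v \<in> ?L" "ng (k l v) \<in> ?L" using R by blast+
    qed
    then show "?A \<union> ?B \<subseteq> ?L" by auto
  qed
  then show ?thesis
    by (simp add: prod.union_disjoint[OF _ _ dis] prod.reindex[OF i1] prod.reindex[OF i2] prod.distrib)
qed

text \<open>The factor \<open>a i (ng j)\<close> is a^+_ij, since the coordinate with index -j is
  the negative of the one with index j.\<close>

definition Poff :: "nat \<Rightarrow> nat \<Rightarrow> 'K" where
  "Poff i j = (if i = j then u i * (\<Prod>l\<in>II - {i, ng i}. a i l)
     else u j * b i j * a i (ng j) * (\<Prod>l\<in>II - {i, ng i, j, ng j}. a j l))"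

definition PP :: "nat \<Rightarrow> nat \<Rightarrow> 'K" where
  "PP i j = (if j = ng i then t ^ (2 * n - 2) * tn - (\<Sum>l\<in>II - {j}. Poff i l) else Poff i j)"

theorem X_first:
  assumes v: "v \<in> V"
  shows "X 1 (\<lambda>v. f (k 1 v)) v = (\<Sum>l\<in>II. PP (k 1 v) l * f (ng l))"
proof -
  define m where "m q v = (if k 1 v = q then 1 else 0 :: 'K)" for q v
  define p where "p = k 1 v"
  have p: "p \<in> II" using k_range[OF v, of 1] n_pos by (simp add: p_def)
  \<comment> \<open>Expansion in the indicator functions \<open>m q\<close> of
    \<open>k 1 v = q\<close>; the value \<open>X 1 (m q) v\<close> is the entry (p, q) of X.\<close>
  have lin: "X 1 (\<lambda>v. g (k 1 v)) v = (\<Sum>q\<in>II. g q * X 1 (m q) v)" for g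
  proof -
    have "X 1 (\<lambda>v. g (k 1 v)) v = X 1 (\<lambda>v. \<Sum>q\<in>II. g q * m q v) v"
    proof (rule X_cong)
      fix v' assume "v' \<in> V"
      then have "k 1 v' \<in> II" using k_range n_pos by blast
      then show "g (k 1 v') = (\<Sum>q\<in>II. g q * m q v')"
        by (simp add: m_def if_distrib del: atLeastAtMost_iff cong: if_cong)
    qed (use v n_pos in auto)
    then show ?thesis unfolding X_def foldr_sum .
  qed
  have off: "X 1 (m (ng l)) v = Poff p l" if l: "l \<in> II" "l \<noteq> ng p" for l
  proof (cases "l = p")
    case True
    have "X 1 (m (ng l)) v = 1 * u (k 1 v) * (\<Prod>l\<in>{1<..n}. a (k 1 v) (k l v) * a (k 1 v) (ng (k l v)))"
      using l p n_pos v True by (intro X_delta_opposite[where q = "ng l"]) (auto simp: m_def p_def)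
    also have "\<dots> = u p * (\<Prod>l\<in>II - {p, ng p}. a p l)"
      using prod_tail[OF v, of 1 "a p"] n_pos by (simp add: p_def)
    finally show ?thesis by (simp add: Poff_def True)
  next
    case False
    obtain j where j: "1 \<le> j" "j \<le> n" "l = k j v \<or> l = ng (k j v)" using k_surj[OF v l(1)] by blast
    then have "j \<noteq> 1" using False l(2) by (auto simp: p_def)
    then have j2: "2 \<le> j" and n: "2 \<le> n" using j by auto
    let ?F = "X 1 (m (ng l))"
    \<comment> \<open>An indicator of the first position is invariant under the later reflections,
      hence so is \<open>?F\<close>. This allows v to be replaced by a state with the same first
      entry and with l at position 2.\<close>
    have "sinv i (m (ng l))" if "2 \<le> i" "i \<le> n" for i
      unfolding sinv_def m_def
      using that by (cases "i = n") (auto simp: k_s k_sn Transposition.transpose_def)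
    then have "\<And>i. 2 \<le> i \<Longrightarrow> i \<le> n \<Longrightarrow> sinv i ?F" using n by (intro sinv_X) auto
    from bubble[of 2, OF this _ l(1) v j2 j(2,3)] obtain v' where
      v': "v' \<in> V" "?F v' = ?F v" "k 1 v' = p" "k 2 v' = l" unfolding p_def by auto
    have "(\<Union>j\<in>{1..2}. {k j v', ng (k j v')}) = {p, ng p, l, ng l}"
    proof -
      have "{1..2} = {1, 2::nat}" by auto
      then show ?thesis using v' by auto
    qed
    then have "?F v' = b p l * a p (ng l) * u l * (\<Prod>r\<in>II - {p, ng p, l, ng l}. a l r)"
      using X_delta_second[OF n v'(1), of "ng l"] v' l n prod_tail[OF v'(1), of 2 "a l"]
      by (simp add: m_def[abs_def] del: atLeastAtMost_iff)
    then show ?thesis using v' False by (simp add: Poff_def ac_simps)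
  qed
  have bij: "(\<Sum>q\<in>II. g q) = (\<Sum>l\<in>II. g (ng l))" for g :: "nat \<Rightarrow> 'K"
    using sum.reindex_bij_betw[OF bij_betw_neg_idx, of g n] by simp
  have "(\<Sum>l\<in>II. X 1 (m (ng l)) v) = t ^ (2 * n - 2) * tn"
    using lin[of "\<lambda>_. 1"] bij[of "\<lambda>q. X 1 (m q) v"] X_one[of 1 v] n_pos v by (simp add: diff_mult_distrib2)
  moreover have "(\<Sum>l\<in>II. X 1 (m (ng l)) v) =
      X 1 (m (ng (ng p))) v + (\<Sum>l\<in>II - {ng p}. X 1 (m (ng l)) v)"
    using p by (intro sum.remove) (simp_all del: atLeastAtMost_iff)
  moreover have "(\<Sum>l\<in>II - {ng p}. X 1 (m (ng l)) v) = (\<Sum>l\<in>II - {ng p}. Poff p l)"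
    using off by (intro sum.cong) auto
  ultimately have "X 1 (m (ng (ng p))) v = PP p (ng p)"
    by (simp add: PP_def algebra_simps eq_diff_eq)
  then have "X 1 (m (ng l)) v = PP p l" if "l \<in> II" for l
    using off[OF that] by (cases "l = ng p") (auto simp: PP_def)
  then show ?thesis unfolding lin bij[of "\<lambda>q. f q * X 1 (m q) v"] p_def[symmetric]
    by (intro sum.cong) (auto simp: mult.commute)
qed

end

section \<open>The field of meromorphic functions and the Weyl group\<close>

lemma mero_cases:
  obtains F where "mero_fun F" "f = mero_of F"
  using that[of "rep_mero f"] Quotient_abs_rep[OF Quotient_mero, of f]
    Quotient_rep_reflp[OF Quotient_mero, of f] by (auto dest: mero_eqD)

lemma mero_of_eq_iff:
  "mero_fun F \<Longrightarrow> mero_fun G \<Longrightarrow> mero_of F = mero_of G \<longleftrightarrow> mero_eq F G"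
  using Quotient_rel[OF Quotient_mero, of F G] mero_eq_refl by auto

lemma mero_of_add: "mero_fun F \<Longrightarrow> mero_fun G \<Longrightarrow> mero_of F + mero_of G = mero_of (\<lambda>x. F x + G x)"
  by (rule plus_mero.abs_eq; rule mero_eq_refl)

lemma mero_of_diff: "mero_fun F \<Longrightarrow> mero_fun G \<Longrightarrow> mero_of F - mero_of G = mero_of (\<lambda>x. F x - G x)"
  by (rule minus_mero.abs_eq; rule mero_eq_refl)

lemma mero_of_mult: "mero_fun F \<Longrightarrow> mero_fun G \<Longrightarrow> mero_of F * mero_of G = mero_of (\<lambda>x. F x * G x)"
  by (rule times_mero.abs_eq; rule mero_eq_refl)

lemma mero_of_inverse: "mero_fun F \<Longrightarrow> inverse (mero_of F) = mero_of (\<lambda>x. inverse (F x))"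
  by (rule inverse_mero.abs_eq; rule mero_eq_refl)

lemma mero_fun_divide: "mero_fun F \<Longrightarrow> mero_fun G \<Longrightarrow> mero_fun (\<lambda>x. F x / G x)"
  using mero_fun_mult[OF _ mero_fun_inverse] by (simp add: divide_inverse)

lemma mero_of_divide: "mero_fun F \<Longrightarrow> mero_fun G \<Longrightarrow> mero_of F / mero_of G = mero_of (\<lambda>x. F x / G x)"
  by (simp add: divide_inverse mero_of_inverse mero_of_mult mero_fun_inverse)

lemma mconst_0: "mconst 0 = 0" and mconst_1: "mconst 1 = 1"
  by (simp_all add: zero_mero_def one_mero_def)

lemma holo_mero_fun: "holo UNIV F \<Longrightarrow> mero_fun F"
  unfolding mero_fun_def
proof
  fix p assume "holo UNIV F"
  then have "quot_on F p 1 F (\<lambda>_. 1)"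
    by (intro quot_onI) (auto intro: holo_subset exI[of _ p])
  then show "\<exists>r g h. quot_on F p r g h" by blast
qed

lemma holo_nth: "holo U (\<lambda>x. x $ k)"
  unfolding holo_def
  by (intro ballI exI[of _ "\<lambda>x. x $ k"] conjI bounded_linear_imp_has_derivative bounded_linear_vec_nth) simp

lemma holo_exp:
  assumes "holo U f" shows "holo U (\<lambda>x. exp (f x))"
  unfolding holo_def
proof
  fix x assume "x \<in> U"
  then obtain D where D: "(f has_derivative D) (at x)" "\<And>a v. D (a *s v) = a * D v"
    using assms unfolding holo_def by blast
  have "((\<lambda>x. exp (f x)) has_derivative (\<lambda>v. exp (f x) * D v)) (at x)"
    using has_derivative_compose[OF D(1), of exp "\<lambda>v. exp (f x) * v"] DERIV_exp[of "f x"]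
    by (simp add: has_field_derivative_def)
  then show "\<exists>D. ((\<lambda>x. exp (f x)) has_derivative D) (at x) \<and> (\<forall>a v. D (a *s v) = a * D v)"
    by (intro exI conjI allI, assumption) (simp add: D(2))
qed

lemma holo_uminus: "holo U f \<Longrightarrow> holo U (\<lambda>x. - f x)"
  using holo_mult[OF holo_const[of U "-1"]] by simp

lemma holo_diff: "holo U f \<Longrightarrow> holo U g \<Longrightarrow> holo U (\<lambda>x. f x - g x)"
  using holo_add[OF _ holo_uminus] by simp

text \<open>Agreement on an open dense set extends to all points by the identity theorem.
  Inequalities in the field \<open>mero\<close> can therefore be shown by evaluating holomorphic
  representatives at one point.\<close>

lemma mero_of_holo_eqD:
  assumes "mero_of F = mero_of G" "holo UNIV F" "holo UNIV G"
  shows "F x = G x"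
proof -
  have "mero_eq F G" using assms holo_mero_fun mero_of_eq_iff by blast
  then obtain U where U: "open U" "closure U = UNIV" "\<forall>x\<in>U. F x = G x"
    unfolding mero_eq_def by blast
  have "F x - G x = 0"
    by (rule holo_dense_identity[OF holo_diff[OF assms(2,3)] open_UNIV convex_UNIV open_UNIV _ _ U(2)])
      (use U(3) in auto)
  then show ?thesis by simp
qed

section \<open>Affine automorphisms acting on meromorphic functions\<close>

text \<open>The affine form is asked of \<open>inv g\<close> because \<open>act g\<close> composes
  with \<open>inv g\<close>.\<close>

definition aff :: "(complex^'n \<Rightarrow> complex^'n) \<Rightarrow> bool" where
  "aff g \<longleftrightarrow> bij g \<and> (\<exists>L b. linear L \<and> (\<forall>a v. L (a *s v) = a *s L v) \<and> (\<forall>x. inv g x = L x + b))"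

lemma aff_bij: "aff g \<Longrightarrow> bij g" by (simp add: aff_def)

lemma act_mero:
  assumes "aff g" "mero_fun F"
  shows "act g (mero_of F) = mero_of (\<lambda>x. F (inv g x))" "mero_fun (\<lambda>x. F (inv g x))"
proof -
  obtain L b where *: "bij g" "linear L" "\<And>a v. L (a *s v) = a *s L v" "\<And>x. inv g x = L x + b"
    using assms(1) unfolding aff_def by blast
  show "act g (mero_of F) = mero_of (\<lambda>x. F (inv g x))"
    by (rule act_mero_of[OF *(4,2,3,1) assms(2)])
  show "mero_fun (\<lambda>x. F (inv g x))"
    using mero_eq_affine[OF *(4,2,3) bij_imp_bij_inv[OF *(1)] mero_eq_refl[OF assms(2)]] mero_eqD by blast
qed

lemma act_add: "aff g \<Longrightarrow> act g (f1 + f2) = act g f1 + act g f2"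
  by (cases f1 rule: mero_cases; cases f2 rule: mero_cases)
    (simp add: mero_of_add mero_fun_add act_mero)

lemma act_diff: "aff g \<Longrightarrow> act g (f1 - f2) = act g f1 - act g f2"
  by (cases f1 rule: mero_cases; cases f2 rule: mero_cases)
    (simp add: mero_of_diff mero_fun_diff act_mero)

lemma act_mult: "aff g \<Longrightarrow> act g (f1 * f2) = act g f1 * act g f2"
  by (cases f1 rule: mero_cases; cases f2 rule: mero_cases)
    (simp add: mero_of_mult mero_fun_mult act_mero)

lemma act_const: "aff g \<Longrightarrow> act g (mconst c) = mconst c"
  by (simp add: act_mero)

lemma act_0: "aff g \<Longrightarrow> act g 0 = 0"
  using act_const[of g 0] by (simp add: mconst_0)

lemma act_1: "aff g \<Longrightarrow> act g 1 = 1"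
  using act_const[of g 1] by (simp add: mconst_1)

lemma act_sum: "aff g \<Longrightarrow> act g (sum f A) = (\<Sum>x\<in>A. act g (f x))"
  by (induction A rule: infinite_finite_induct) (auto simp: act_0 act_add)

lemma aff_comp:
  assumes "aff g" "aff h" shows "aff (g \<circ> h)"
proof -
  obtain L b L' b' where *: "bij g" "linear L" "\<forall>a v. L (a *s v) = a *s L v" "\<forall>x. inv g x = L x + b"
    "bij h" "linear L'" "\<forall>a v. L' (a *s v) = a *s L' v" "\<forall>x. inv h x = L' x + b'"
    using assms unfolding aff_def by blast
  have "\<forall>x. inv (g \<circ> h) x = (L' \<circ> L) x + (L' b + b')"
    using * by (simp add: o_inv_distrib linear_add)
  then show ?thesis
    unfolding aff_def using * bij_comp linear_compose[of L L']
    by (intro conjI exI[of _ "L' \<circ> L"] exI[of _ "L' b + b'"]) auto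
qed

lemma act_act: "aff g \<Longrightarrow> aff h \<Longrightarrow> act g (act h f) = act (g \<circ> h) f"
  by (cases f rule: mero_cases) (simp add: act_mero aff_comp aff_bij o_inv_distrib)

lemma aff_id: "aff id"
  unfolding aff_def by (intro conjI exI[of _ "\<lambda>x. x"] exI[of _ 0]) (auto intro: linearI)

lemma act_id [simp]: "act id f = f"
  by (cases f rule: mero_cases) (simp add: act_mero aff_id)

lemma aff_translation: "aff (\<lambda>x::complex^'n. x + d)"
proof -
  have inv: "inv (\<lambda>x::complex^'n. x + d) = (\<lambda>x. x - d)"
    by (rule inv_unique_comp) auto
  show ?thesis
    unfolding aff_def inv
    by (intro conjI exI[of _ "\<lambda>x. x"] exI[of _ "- d"] bijI injI surjI[of _ "\<lambda>x. x - d"])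
       (auto intro!: linearI)
qed

section \<open>The group of signed permutations and signed coordinates\<close>

lemma weylE:
  assumes "v \<in> weyl"
  obtains \<sigma> \<delta> where "\<sigma> permutes UNIV" "\<And>k. \<delta> k \<in> {1, -1}" "v = (\<lambda>x. \<chi> k. \<delta> k * x $ \<sigma> k)"
  using assms unfolding weyl_def by blast

lemma weylI:
  "\<sigma> permutes UNIV \<Longrightarrow> (\<And>k. \<delta> k \<in> {1, -1}) \<Longrightarrow> (\<lambda>x. \<chi> k. \<delta> k * x $ \<sigma> k) \<in> weyl"
  unfolding weyl_def by blast

lemma weyl_id: "id \<in> weyl"
proof -
  have "(id :: complex^'n \<Rightarrow> complex^'n) = (\<lambda>x. \<chi> k. (\<lambda>_. 1) k * x $ id k)"
    by (auto simp: fun_eq_iff vec_eq_iff)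
  also have "\<dots> \<in> weyl" by (rule weylI[OF permutes_id]) simp
  finally show ?thesis .
qed

lemma weyl_comp:
  assumes "v \<in> weyl" "w \<in> weyl" shows "v \<circ> w \<in> weyl"
proof -
  obtain \<sigma> \<delta> where v: "\<sigma> permutes UNIV" "\<And>k. \<delta> k \<in> {1, -1}" "v = (\<lambda>x. \<chi> k. \<delta> k * x $ \<sigma> k)"
    using assms(1) weylE by blast
  obtain \<sigma>' \<delta>' where w: "\<sigma>' permutes UNIV" "\<And>k. \<delta>' k \<in> {1, -1}" "w = (\<lambda>x. \<chi> k. \<delta>' k * x $ \<sigma>' k)"
    using assms(2) weylE by blast
  have "v \<circ> w = (\<lambda>x. \<chi> k. (\<delta> k * \<delta>' (\<sigma> k)) * x $ (\<sigma>' \<circ> \<sigma>) k)"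
    by (simp add: v w fun_eq_iff vec_eq_iff)
  moreover have "\<delta> k * \<delta>' (\<sigma> k) \<in> {1, -1}" for k
    using v(2)[of k] w(2)[of "\<sigma> k"] by auto
  ultimately show ?thesis using weylI[OF permutes_compose[OF v(1) w(1)]] by presburger
qed

lemma weyl_inverse:
  assumes "v \<in> weyl"
  shows "bij v" "inv v \<in> weyl"
proof -
  obtain \<sigma> \<delta> where v: "\<sigma> permutes UNIV" "\<And>k. \<delta> k \<in> {1, -1}" "v = (\<lambda>x. \<chi> k. \<delta> k * x $ \<sigma> k)"
    using assms weylE by blast
  define w where "w = (\<lambda>x. \<chi> k. \<delta> (inv \<sigma> k) * x $ inv \<sigma> k)"
  have sq: "\<delta> k * (\<delta> k * c) = c" for k c
    using v(2)[of k] by auto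
  have s: "\<sigma> (inv \<sigma> k) = k" "inv \<sigma> (\<sigma> k) = k" for k
    using permutes_inverses[OF v(1)] by auto
  have vw: "v \<circ> w = id" "w \<circ> v = id"
    by (simp_all add: v w_def fun_eq_iff vec_eq_iff s sq)
  then show "bij v" using o_bij by blast
  have "inv v = w" by (rule inv_unique_comp[OF vw])
  moreover have "w \<in> weyl" unfolding w_def using weylI[OF permutes_inv[OF v(1)]] v(2) by simp
  ultimately show "inv v \<in> weyl" by simp
qed

lemma weyl_linear:
  assumes "v \<in> weyl" shows "linear v" "v (c *s x) = c *s v x"
proof -
  obtain \<sigma> \<delta> where v: "v = (\<lambda>x. \<chi> k. \<delta> k * x $ \<sigma> k)"
    using assms weylE by blast
  show "linear v" "v (c *s x) = c *s v x"
    by (auto intro!: linearI simp: v vec_eq_iff algebra_simps)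
qed

lemma weyl_aff: "v \<in> weyl \<Longrightarrow> aff v"
  unfolding aff_def using weyl_inverse[of v] weyl_linear[of "inv v"]
  by (intro conjI exI[of _ "inv v"] exI[of _ 0]) auto

lemma weyl_inv_inv: "v \<in> weyl \<Longrightarrow> inv (inv v) = v"
  using weyl_inverse(1) inv_inv_eq by blast

lemma finite_weyl: "finite (weyl :: (complex^'n \<Rightarrow> complex^'n) set)"
proof -
  have 1: "(weyl :: (complex^'n \<Rightarrow> complex^'n) set) = (\<lambda>(\<sigma>, \<delta>). (\<lambda>x. \<chi> k. \<delta> k * x $ \<sigma> k)) `
      ({\<sigma>. \<sigma> permutes UNIV} \<times> {\<delta>. \<forall>k. \<delta> k \<in> {1, -1 :: complex}})"
    unfolding weyl_def by fast
  have 2: "finite {\<delta> :: 'n \<Rightarrow> complex. \<forall>k. \<delta> k \<in> {1, -1}}"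
    using finite_set_of_finite_funs[of "UNIV::'n set" "{1, -1::complex}" undefined] by simp
  show ?thesis
    unfolding 1 by (intro finite_imageI finite_cartesian_product 2 finite_permutations finite)
qed

lemma bij_betw_idx: "bij_betw idx {1..CARD('n::{finite,linorder})} (UNIV :: 'n set)"
proof -
  have 1: "bij_betw (\<lambda>i. i - 1) {1..CARD('n)} {..<CARD('n)}"
    by (rule bij_betw_byWitness[where f' = Suc]) auto
  have 2: "bij_betw (\<lambda>i. sorted_list_of_set (UNIV::'n set) ! i) {..<CARD('n)} UNIV"
    by (rule bij_betw_nth) auto
  have "idx = (\<lambda>i. sorted_list_of_set (UNIV::'n set) ! i) \<circ> (\<lambda>i. i - 1)"
    by (simp add: fun_eq_iff idx_def)
  then show ?thesis using bij_betw_trans[OF 1 2] by (simp only:)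
qed

lemma idx_eq_iff:
  "1 \<le> i \<Longrightarrow> i \<le> CARD('n) \<Longrightarrow> 1 \<le> j \<Longrightarrow> j \<le> CARD('n) \<Longrightarrow>
    (idx i :: 'n::{finite,linorder}) = idx j \<longleftrightarrow> i = j"
  by (rule inj_on_eq_iff[OF bij_betw_imp_inj_on[OF bij_betw_idx]]) simp_all

lemma idx_surj:
  obtains i where "1 \<le> i" "i \<le> CARD('n)" "k = (idx i :: 'n::{finite,linorder})"
proof -
  have "k \<in> idx ` {1..CARD('n)}" using bij_betw_idx[where 'n = 'n] unfolding bij_betw_def by simp
  then show thesis using that by auto
qed

lemma xx_neg: "i \<in> {1..2 * CARD('n)} \<Longrightarrow> xx (neg_idx CARD('n) i) x = - xx i (x :: complex^('n::{finite,linorder}))"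
  by (auto simp: xx_def neg_idx_def)

lemma xx_idx: "i \<le> CARD('n) \<Longrightarrow> xx i x = (x :: complex^('n::{finite,linorder})) $ idx i"
  by (simp add: xx_def)

text \<open>The difference 1 is convenient because exp 1 is not 1: the same point also separates the
  exponentials of the two coordinates.\<close>

lemma xx_separate:
  assumes "i \<in> {1..2 * CARD('n)}" "j \<in> {1..2 * CARD('n)}" "i \<noteq> j"
  obtains x :: "complex^('n::{finite,linorder})" where "xx i x - xx j x = 1"
proof -
  define p where "p l = (if l \<le> CARD('n) then l else l - CARD('n))" for l
  define e :: "nat \<Rightarrow> complex" where "e l = (if l \<le> CARD('n) then 1 else -1)" for l
  have xx: "xx l x = e l * x $ idx (p l)" for l and x :: "complex^('n::{finite,linorder})"
    by (simp add: xx_def p_def e_def)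
  have p: "1 \<le> p i" "p i \<le> CARD('n)" "1 \<le> p j" "p j \<le> CARD('n)" using assms by (auto simp: p_def)
  show thesis
  proof (cases "p i = p j")
    case True
    then have "e i = - e j" "e i * e i = 1" using assms by (auto simp: p_def e_def split: if_splits)
    \<comment> \<open>Here j is the opposite of i, so the difference is twice \<open>xx i x\<close>;
      hence the half.\<close>
    then have "xx i x - xx j x = 1" if "x = axis (idx (p i)) (e i / 2)" for x :: "complex^('n::{finite,linorder})"
      using True that by (simp add: xx axis_def)
    then show ?thesis using that by blast
  next
    case False
    then have "(idx (p i) :: 'n) \<noteq> idx (p j)" using idx_eq_iff p by blast
    moreover have "e i * e i = 1" by (simp add: e_def)
    ultimately have "xx i x - xx j x = 1" if "x = axis (idx (p i)) (e i)" for x :: "complex^('n::{finite,linorder})"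
      using that by (simp add: xx axis_def)
    then show ?thesis using that by blast
  qed
qed

lemma xx_zero: "xx i 0 = 0"
  by (simp add: xx_def)

lemma holo_xx: "holo U (xx i)"
  unfolding xx_def[abs_def] by (cases "i \<le> CARD('a)") (auto intro: holo_nth holo_uminus)

text \<open>The function \<open>k\<close> of the locale for the Weyl group. The condition v^-1
  \<epsilon>_j = \<epsilon>_l is put in terms of coordinates, which avoids inverses;
  \<open>xx_separate\<close> makes l unique.\<close>

definition kix :: "nat \<Rightarrow> (complex^('n::{finite,linorder}) \<Rightarrow> complex^('n::{finite,linorder})) \<Rightarrow> nat" where
  "kix j v = (THE l. l \<in> {1..2 * CARD('n)} \<and> (\<forall>x. v x $ idx j = xx l x))"

lemma kix_eqI:
  fixes v :: "complex^('n::{finite,linorder}) \<Rightarrow> complex^('n::{finite,linorder})"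
  assumes "l \<in> {1..2 * CARD('n)}" "\<And>x. v x $ idx j = xx l x"
  shows "kix j v = l"
  unfolding kix_def
proof (rule the_equality)
  fix l' assume l': "l' \<in> {1..2 * CARD('n)} \<and> (\<forall>x. v x $ idx j = xx l' x)"
  show "l' = l"
  proof (rule ccontr)
    assume "l' \<noteq> l"
    then obtain x :: "complex^('n::{finite,linorder})" where "xx l' x - xx l x = 1"
      using xx_separate l' assms(1) by blast
    then show False using l' assms(2)[of x] by simp
  qed
qed (use assms in auto)

lemma kix:
  fixes v :: "complex^('n::{finite,linorder}) \<Rightarrow> complex^('n::{finite,linorder})"
  assumes "v \<in> weyl"
  shows "kix j v \<in> {1..2 * CARD('n)}" "v x $ idx j = xx (kix j v) x"
proof -
  obtain \<sigma> \<delta> where v: "\<sigma> permutes UNIV" "\<And>k. \<delta> k \<in> {1, -1}" "v = (\<lambda>x. \<chi> k. \<delta> k * x $ \<sigma> k)"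
    using assms weylE by blast
  obtain i where i: "1 \<le> i" "i \<le> CARD('n)" "\<sigma> (idx j) = idx i" using idx_surj .
  define l where "l = (if \<delta> (idx j) = 1 then i else i + CARD('n))"
  have l: "l \<in> {1..2 * CARD('n)}" "v x $ idx j = xx l x" for x
    using i v(2)[of "idx j"] by (auto simp: l_def v(3) xx_def)
  with kix_eqI[OF this] show "kix j v \<in> {1..2 * CARD('n)}" "v x $ idx j = xx (kix j v) x" by auto
qed

lemma swp_weyl: "swp i j \<in> weyl"
  unfolding swp_def using weylI[OF permutes_swap_id[OF UNIV_I UNIV_I], where \<delta> = "\<lambda>_. 1"] by simp

lemma flp_weyl: "(flp i :: complex^('n::{finite,linorder}) \<Rightarrow> _) \<in> weyl"
proof -
  have "(flp i :: complex^('n::{finite,linorder}) \<Rightarrow> _) = (\<lambda>x. \<chi> k. (if k = idx i then -1 else 1) * x $ id k)"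
    by (auto simp: flp_def fun_eq_iff vec_eq_iff)
  also have "\<dots> \<in> weyl" by (rule weylI[OF permutes_id]) auto
  finally show ?thesis .
qed

lemma coset_rep_weyl: "coset_rep j \<in> weyl"
  by (simp add: coset_rep_def swp_weyl flp_weyl weyl_comp)

lemma kix_coset_rep:
  assumes "j \<in> {1..2 * CARD('n)}"
  shows "kix 1 (coset_rep j :: complex^('n::{finite,linorder}) \<Rightarrow> complex^('n::{finite,linorder})) = j"
proof (rule kix_eqI[OF assms])
  fix x :: "complex^('n::{finite,linorder})"
  have "(idx (j - CARD('n)) :: 'n) \<noteq> idx 1" if "j > CARD('n) + 1"
    using that assms by (subst idx_eq_iff) auto
  then show "coset_rep j x $ idx 1 = xx j x"
    by (auto simp: coset_rep_def swp_def flp_def xx_def)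
qed

lemma xx_inj:
  assumes "i \<in> {1..2 * CARD('n)}" "j \<in> {1..2 * CARD('n)}"
    "\<And>x :: complex^('n::{finite,linorder}). xx i x = xx j x"
  shows "i = j"
proof (rule ccontr)
  assume "i \<noteq> j"
  then obtain x :: "complex^('n::{finite,linorder})" where "xx i x - xx j x = 1"
    using xx_separate assms(1,2) by blast
  then show False using assms(3)[of x] by simp
qed

section \<open>The coefficient functions as rational functions of exponentials\<close>

lemmas mero_fun_intros = mero_fun_divide mero_fun_inverse mero_fun_mult mero_fun_add mero_fun_diff
  mero_fun_uminus mero_fun_const
lemmas mero_of_simps = mero_of_divide mero_of_inverse mero_of_mult mero_of_add mero_of_diff

definition exp_xx :: "nat \<Rightarrow> ('n::{finite,linorder}) mero" where "exp_xx i = mero_of (\<lambda>x. exp (xx i x))"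

lemma mero_fun_exp_xx: "mero_fun (\<lambda>x. exp (xx i x))"
  by (intro holo_mero_fun holo_exp holo_xx)

lemma exp_xx_neg:
  "i \<in> {1..2 * CARD('n)} \<Longrightarrow> (exp_xx (neg_idx CARD('n) i) :: ('n::{finite,linorder}) mero) = inverse (exp_xx i)"
  by (simp add: exp_xx_def mero_of_inverse mero_fun_exp_xx xx_neg exp_minus del: atLeastAtMost_iff)

lemma exp_1_neq_1: "exp 1 \<noteq> (1 :: complex)"
proof
  assume "exp 1 = (1 :: complex)"
  then have "exp (of_real 1) = (1 :: complex)" by simp
  then have "exp 1 = (1 :: real)" by (metis exp_of_real of_real_eq_1_iff)
  then show False by simp
qed

text \<open>The constant c is allowed because a_ij = 0 would mean that e^(x_i - x_j) equals tau^-2.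
  Evaluation at the origin forces c = 1, and a point with x_i - x_j = 1 then gives the
  contradiction.\<close>

lemma exp_xx_separate:
  assumes "i \<in> {1..2 * CARD('n)}" "j \<in> {1..2 * CARD('n)}" "i \<noteq> j"
  shows "exp_xx i \<noteq> mconst c * (exp_xx j :: ('n::{finite,linorder}) mero)"
proof
  assume eq: "exp_xx i = mconst c * (exp_xx j :: 'n mero)"
  have *: "exp (xx i x) = c * exp (xx j x)" for x :: "complex^('n::{finite,linorder})"
    using eq unfolding exp_xx_def
    by (intro mero_of_holo_eqD[of "\<lambda>x. exp (xx i x)"])
       (auto simp: mero_of_simps mero_fun_exp_xx intro!: holo_exp holo_xx holo_mult)
  then have "c = 1" using *[of 0] by (simp add: xx_zero)
  obtain x :: "complex^('n::{finite,linorder})" where "xx i x - xx j x = 1" using xx_separate[OF assms] .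
  then have "xx i x = xx j x + 1" by (simp add: algebra_simps)
  then have "exp 1 = (1::complex)" using *[of x] \<open>c = 1\<close> by (simp add: exp_add)
  then show False using exp_1_neq_1 by simp
qed

lemma exp_xx_nz: "(exp_xx i :: ('n::{finite,linorder}) mero) \<noteq> 0"
proof
  assume "(exp_xx i :: 'n mero) = 0"
  then have "exp (xx i (0 :: complex^('n::{finite,linorder}))) = 0"
    unfolding exp_xx_def mconst_0[symmetric]
    by (rule mero_of_holo_eqD) (auto intro!: holo_exp holo_xx)
  then show False by simp
qed

lemma exp_xx_eq_iff:
  "i \<in> {1..2 * CARD('n)} \<Longrightarrow> j \<in> {1..2 * CARD('n)} \<Longrightarrow> (exp_xx i :: ('n::{finite,linorder}) mero) = exp_xx j \<longleftrightarrow> i = j"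
  using exp_xx_separate[of i j 1] by (auto simp: mconst_1)

lemma mconst_nz: "c \<noteq> 0 \<Longrightarrow> mconst c \<noteq> 0"
  unfolding mconst_0[symmetric] by (metis holo_const mero_of_holo_eqD)

lemma mconst_mult: "mconst (c * d) = mconst c * mconst d"
  and mconst_inverse: "mconst (inverse c) = inverse (mconst c)"
  by (simp_all add: mero_of_simps)

lemma mconst_power: "mconst (c ^ k) = mconst c ^ k"
  by (induction k) (simp_all add: mconst_1 mconst_mult)

text \<open>In terms of the elements \<open>exp_xx i\<close>, the identities required of a, b and u
  become identities of rational functions, valid in any field.\<close>

lemma m_a_eq: "m_a par i j = (inverse (mconst (tau par)) - mconst (tau par) * (exp_xx i / exp_xx j)) / (1 - exp_xx i / exp_xx j)"
  by (simp only: m_a_def fn_a_def exp_xx_def exp_diff mero_of_simps mero_fun_intros mero_fun_exp_xx mconst_1[symmetric])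

lemma m_b_eq: "m_b par i j = (mconst (tau par) - inverse (mconst (tau par))) / (1 - exp_xx i / exp_xx j)"
  by (simp only: m_b_def fn_b_def exp_xx_def exp_diff mero_of_simps mero_fun_intros mero_fun_exp_xx mconst_1[symmetric])

lemma m_u_eq: "m_u par i = inverse (mconst (taun par)) *
    ((1 - mconst (taun par) * mconst (taunv par) * exp_xx i) * (1 + mconst (taun par) * inverse (mconst (taunv par)) * exp_xx i)
     / (1 - exp_xx i * exp_xx i))"
proof -
  have 2: "exp (2 * z) = exp z * exp z" for z :: complex by (simp only: mult_2 exp_add)
  show ?thesis
    by (simp only: m_u_def fn_u_def exp_xx_def 2 mero_of_simps mero_fun_intros mero_fun_exp_xx mconst_1[symmetric])
qed

lemma divide_one_minus_ratio:
  fixes x y :: "'a::field"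
  assumes "y \<noteq> 0"
  shows "z / (1 - x / y) = z * (y / (y - x))"
proof -
  have "1 - x / y = (y - x) / y" using assms by (simp add: diff_divide_distrib)
  then show ?thesis by simp
qed

text \<open>For x / y = e^(x_i - x_j) and z = tau - tau^-1 this is b_ij + b_ji = tau -
  tau^-1.\<close>

lemma inverse_one_minus_ratio:
  fixes x y :: "'a::field"
  assumes "x \<noteq> 0" "y \<noteq> 0" "x \<noteq> y"
  shows "z / (1 - x / y) + z / (1 - y / x) = z"
proof -
  have "y / (y - x) + x / (x - y) = y / (y - x) + (- x) / (y - x)"
    using minus_divide_divide[of x "x - y"] by simp
  also have "\<dots> = (y + - x) / (y - x)" by (simp only: add_divide_distrib)
  also have "\<dots> = 1" using assms by simp
  finally have "z * (y / (y - x)) + z * (x / (x - y)) = z" by (simp only: distrib_left[symmetric] mult_1_right)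
  then show ?thesis unfolding divide_one_minus_ratio[OF assms(1)] divide_one_minus_ratio[OF assms(2)] .
qed

lemma ratio_eqI:
  fixes x y :: "'a::field"
  assumes "y \<noteq> 0" "z \<noteq> 0" "1 - x / y \<noteq> 0" "(inverse z - z * (x / y)) / (1 - x / y) = 0"
  shows "x = inverse z * inverse z * y"
proof -
  have "inverse z = z * (x / y)" using assms(3,4) unfolding divide_eq_0_iff right_minus_eq by blast
  then have "inverse z * (inverse z * y) = inverse z * (z * (x / y) * y)" by simp
  then show ?thesis using assms(1,2) by (simp add: mult.assoc)
qed

text \<open>This is u(z) + u(-z) = tau_n + tau_n^-1, written with X = e^z, r = \<open>taun\<close>
  and s = \<open>taunv\<close>.\<close>

lemma u_inverse:
  fixes X :: "'a::field"
  assumes "X \<noteq> 0" "X * X \<noteq> 1" "r \<noteq> 0" "s \<noteq> 0"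
  shows "inverse r * ((1 - r * s * X) * (1 + r * inverse s * X) / (1 - X * X))
    + inverse r * ((1 - r * s * inverse X) * (1 + r * inverse s * inverse X) / (1 - inverse X * inverse X)) = r + inverse r"
proof -
  have D: "1 - X * X \<noteq> 0" using assms by auto
  have 1: "1 - inverse X * inverse X = - (1 - X * X) / (X * X)" using assms by (simp add: field_simps)
  have 2: "(1 - r * s * inverse X) * (1 + r * inverse s * inverse X) = (X - r * s) * (X + r * inverse s) / (X * X)"
    using assms by (simp add: field_simps)
  have 3: "(1 - r * s * inverse X) * (1 + r * inverse s * inverse X) / (1 - inverse X * inverse X)
     = - ((X - r * s) * (X + r * inverse s)) / (1 - X * X)"
    unfolding 1 2 using assms D by (simp add: field_simps)
  have i: "s * inverse s = 1" "r * inverse r = 1" using assms by auto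
  have N: "(1 - r * s * X) * (1 + r * inverse s * X) - (X - r * s) * (X + r * inverse s) = (1 + r * r) * (1 - X * X)"
    using i(1) by algebra
  have "(1 - r * s * X) * (1 + r * inverse s * X) / (1 - X * X) + - ((X - r * s) * (X + r * inverse s)) / (1 - X * X) = 1 + r * r" (is "?l = _")
  proof -
    have "?l = ((1 - r * s * X) * (1 + r * inverse s * X) - (X - r * s) * (X + r * inverse s)) / (1 - X * X)"
      by (simp add: diff_divide_distrib)
    then show ?thesis unfolding N using D by simp
  qed
  then have "inverse r * ((1 - r * s * X) * (1 + r * inverse s * X) / (1 - X * X) + - ((X - r * s) * (X + r * inverse s)) / (1 - X * X)) = r + inverse r"
    using i(2) by algebra
  then show ?thesis unfolding 3 by (simp add: distrib_left)
qed

text \<open>This is \<open>b_u\<close> with X, Y the exponentials of x_i, x_j. The factor \<kappa>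
  is common to all terms and \<open>u_inverse\<close> eliminates \<open>U (inverse Y)\<close>;
  clearing the remaining denominators leaves \<open>M\<close>, which is linear in U X and U
  Y.\<close>

lemma b_u_identity:
  fixes X Y :: "'a::field"
  assumes nz: "X \<noteq> 0" "Y \<noteq> 0" "X \<noteq> Y" "X * Y \<noteq> 1" "X * X \<noteq> 1" "Y * Y \<noteq> 1" "r \<noteq> 0" "s \<noteq> 0"
    and U: "\<And>Z. U Z = inverse r * ((1 - r * s * Z) * (1 + r * inverse s * Z) / (1 - Z * Z))"
  shows "\<kappa> / (1 - X / Y) * (r - U Y) + (r - U X) * (\<kappa> / (1 - Y / X)) + U X * (\<kappa> / (1 - Y * X))
    = \<kappa> / (1 - X * Y) * U (inverse Y)"
proof -
  define D where "D = 1 - r * r" define d where "d = r * inverse s - r * s"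
  have i: "s * inverse s = 1" "r * inverse r = 1" using nz by auto
  \<comment> \<open>The left side is the numerator 1 + d Z - r * r * Z * Z, from which r * r * (1 -
    Z * Z) is split off. The parameter s survives only in d.\<close>
  have Ur: "r * U Z * (1 - Z * Z) = r * r * (1 - Z * Z) + D + d * Z" if "Z * Z \<noteq> 1" for Z
  proof -
    have "r * U Z * (1 - Z * Z) = (1 - r * s * Z) * (1 + r * inverse s * Z)"
      unfolding U using that i(2) by (simp add: field_simps nz)
    also have "\<dots> = r * r * (1 - Z * Z) + D + d * Z"
      unfolding D_def d_def using i(1) by algebra
    finally show ?thesis .
  qed
  have Uinv: "U (inverse Y) = r + inverse r - U Y"
    using u_inverse[of Y r s] nz unfolding U by (simp add: algebra_simps)
  have e: "\<kappa> / (1 - X / Y) = \<kappa> * Y / (Y - X)" "\<kappa> / (1 - Y / X) = \<kappa> * X / (X - Y)"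
    using nz by (simp_all add: field_simps)
  have ne: "Y - X \<noteq> 0" "1 - X * Y \<noteq> 0" "1 - X * X \<noteq> 0" "1 - Y * Y \<noteq> 0" using nz by auto
  have XY: "\<kappa> * X / (X - Y) = - (\<kappa> * X) / (Y - X)" using nz by (simp add: field_simps)
  have M: "(Y * (r - U Y) - (r - U X) * X) * (1 - X * Y) + U X * (Y - X) = (Y - X) * (r + inverse r - U Y)" (is "?l = ?r")
  proof -
    have "r * (1 - X * X) * (1 - Y * Y) * (?l - ?r) = 0"
      using Ur[of X] Ur[of Y] nz(5,6) i(2) unfolding D_def by algebra
    then show ?thesis using ne nz(7) by simp
  qed
  have "(Y * (r - U Y) - (r - U X) * X) / (Y - X) + U X / (1 - X * Y)
      = ((Y - X) * (r + inverse r - U Y)) / ((Y - X) * (1 - X * Y))"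
    unfolding add_frac_eq[OF ne(1,2)] M ..
  also have "\<dots> = (r + inverse r - U Y) / (1 - X * Y)"
    using ne(1) by (rule mult_divide_mult_cancel_left)
  finally show ?thesis
    unfolding Uinv e XY unfolding mult.commute[of Y X] divide_inverse by algebra
qed

section \<open>The Weyl group as an instance of the abstract setting\<close>

definition simple_refl :: "nat \<Rightarrow> complex^('n::{finite,linorder}) \<Rightarrow> complex^('n::{finite,linorder})" where
  "simple_refl i = (if i = CARD('n) then flp i else swp i (i + 1))"

lemma simple_refl_weyl: "simple_refl i \<in> weyl"
  by (simp add: simple_refl_def swp_weyl flp_weyl)

lemma transpose_idx:
  assumes "1 \<le> i" "i < CARD('n)" "1 \<le> j" "j \<le> CARD('n)"
  shows "Transposition.transpose (idx i) (idx (Suc i)) (idx j :: 'n::{finite,linorder}) = idx (Transposition.transpose i (Suc i) j)"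
  using assms by (simp add: Transposition.transpose_def idx_eq_iff)

text \<open>Left multiplication by a simple reflection acts on the coordinates of v x, that is on
  positions, as \<open>k_s\<close> and \<open>k_sn\<close> demand. The denominators are nonzero
  because the \<open>exp_xx i\<close> are pairwise distinct; applied to i and -i, this also excludes
  a square equal to 1.\<close>

lemma hecke_weyl:
  assumes par: "tau par \<noteq> 0" "taun par \<noteq> 0" "taunv par \<noteq> 0"
  shows "hecke_states CARD('n) (weyl :: (complex^('n::{finite,linorder}) \<Rightarrow> complex^('n::{finite,linorder})) set) (\<lambda>i v. simple_refl i \<circ> v) kix (m_a par) (m_b par)
     (m_u par) (\<lambda>i. mconst (taun par) - m_u par i) (mconst (tau par)) (mconst (taun par))
     (mconst (tau par) - inverse (mconst (tau par)) :: ('n::{finite,linorder}) mero)"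
proof -
  have t: "mconst (tau par) \<noteq> (0 :: 'n mero)" "mconst (taun par) \<noteq> (0 :: 'n mero)" "mconst (taunv par) \<noteq> (0 :: 'n mero)"
    using par by (simp_all add: mconst_nz)
  have Ed: "1 - exp_xx i / (exp_xx j :: 'n mero) \<noteq> 0" if "i \<in> {1..2 * CARD('n)}" "j \<in> {1..2 * CARD('n)}" "i \<noteq> j" for i j
    using exp_xx_eq_iff[OF that(1,2)] that(3) exp_xx_nz[of j] by (simp add: field_simps)
  have E2: "exp_xx i * exp_xx i \<noteq> (1 :: 'n mero)" if "i \<in> {1..2 * CARD('n)}" for i
  proof
    assume "exp_xx i * exp_xx i = (1 :: 'n mero)"
    then have "exp_xx i = inverse (exp_xx i :: 'n mero)" by (metis inverse_unique)
    then have "neg_idx CARD('n) i = i" using exp_xx_neg[OF that] exp_xx_eq_iff[OF neg_idx_in[OF that] that] by simp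
    then show False using neg_idx_neq[OF _ that] by simp
  qed
  show ?thesis
  proof
    show "1 \<le> CARD('n)" by simp
    show "simple_refl i \<circ> v \<in> weyl" if "v \<in> weyl" for v :: "complex^('n::{finite,linorder}) \<Rightarrow> complex^('n::{finite,linorder})" and i
      using that simple_refl_weyl weyl_comp by blast
    show "kix j (simple_refl i \<circ> v) = kix (Transposition.transpose i (Suc i) j) v"
      if "v \<in> weyl" "1 \<le> i" "i < CARD('n)" "1 \<le> j" "j \<le> CARD('n)" for v :: "complex^('n::{finite,linorder}) \<Rightarrow> complex^('n::{finite,linorder})" and i j
      using that kix[OF that(1)] transpose_idx[OF that(2-)]
      by (intro kix_eqI) (simp_all add: simple_refl_def swp_def)
    show "kix j (simple_refl CARD('n) \<circ> v) = (if j = CARD('n) then neg_idx CARD('n) (kix CARD('n) v) else kix j v)"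
      if "v \<in> weyl" "1 \<le> j" "j \<le> CARD('n)" for v :: "complex^('n::{finite,linorder}) \<Rightarrow> complex^('n::{finite,linorder})" and j
      using that kix[OF that(1)]
      by (intro kix_eqI) (auto simp: simple_refl_def flp_def idx_eq_iff xx_neg[OF kix(1)])
    show "v = v'" if "v \<in> weyl" "v' \<in> weyl" "\<And>j. 1 \<le> j \<Longrightarrow> j \<le> CARD('n) \<Longrightarrow> kix j v = kix j v'"
      for v v' :: "complex^('n::{finite,linorder}) \<Rightarrow> complex^('n::{finite,linorder})"
    proof
      fix x
      have "v x $ k = v' x $ k" for k
      proof -
        obtain j where "1 \<le> j" "j \<le> CARD('n)" "k = idx j" using idx_surj .
        then show ?thesis using kix(2)[OF that(1)] kix(2)[OF that(2)] that(3) by simp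
      qed
      then show "v x = v' x" by (simp add: vec_eq_iff)
    qed
    show "kix j v \<in> {1..2 * CARD('n)}" if "v \<in> weyl" for v :: "complex^('n::{finite,linorder}) \<Rightarrow> complex^('n::{finite,linorder})" and j
      using kix(1)[OF that] .
    show "kix i v \<noteq> kix j v \<and> kix i v \<noteq> neg_idx CARD('n) (kix j v)"
      if "v \<in> weyl" "i \<noteq> j" "1 \<le> i" "i \<le> CARD('n)" "1 \<le> j" "j \<le> CARD('n)"
      for v :: "complex^('n::{finite,linorder}) \<Rightarrow> complex^('n::{finite,linorder})" and i j
    proof -
      \<comment> \<open>A preimage of a unit vector separates the two indices up to sign: one signed
        coordinate takes the value 1 there, the other 0.\<close>
      have "surj v" using weyl_inverse(1)[OF that(1)] bij_is_surj by blast
      then obtain x where "v x = axis (idx i) 1" by (metis surjD)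
      moreover have "(idx i :: 'n) \<noteq> idx j" using idx_eq_iff[where 'n = 'n] that by blast
      ultimately have "xx (kix i v) x = 1" "xx (kix j v) x = 0"
        using kix(2)[OF that(1), of x i] kix(2)[OF that(1), of x j] by (auto simp: axis_def)
      then show ?thesis using xx_neg[OF kix(1)[OF that(1), of j], of x] by auto
    qed
    show "\<exists>j. 1 \<le> j \<and> j \<le> CARD('n) \<and> (p = kix j v \<or> p = neg_idx CARD('n) (kix j v))"
      if "v \<in> weyl" "p \<in> {1..2 * CARD('n)}" for v :: "complex^('n::{finite,linorder}) \<Rightarrow> complex^('n::{finite,linorder})" and p
    proof -
      define pos where "pos l = (if l \<le> CARD('n) then l else l - CARD('n))" for l
      have pos: "1 \<le> pos l" "pos l \<le> CARD('n)" "l = pos l \<or> l = neg_idx CARD('n) (pos l)" if "l \<in> {1..2 * CARD('n)}" for l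
        using that by (auto simp: pos_def neg_idx_def)
      \<comment> \<open>The inverse locates p: coordinate \<open>pos p\<close> of x is the signed
        coordinate l of v x, so l is plus or minus the position j that carries p or -p.\<close>
      define l where "l = kix (pos p) (inv v)"
      have w: "inv v \<in> weyl" using weyl_inverse(2)[OF that(1)] .
      have l: "l \<in> {1..2 * CARD('n)}" unfolding l_def by (rule kix(1)[OF w])
      have "x $ idx (pos p) = xx l (v x)" for x
        using kix(2)[OF w, of "v x" "pos p"] weyl_inverse(1)[OF that(1)] by (simp add: l_def bij_is_inj)
      then have e: "xx (pos p) x = xx l (v x)" for x using pos(2)[OF that(2)] by (simp add: xx_idx)
      have l3: "(\<forall>y :: complex^('n::{finite,linorder}). xx l y = xx (pos l) y) \<or> (\<forall>y :: complex^('n::{finite,linorder}). xx l y = xx (neg_idx CARD('n) (pos l)) y)"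
        using pos(3)[OF l] by auto
      define j where "j = pos l"
      have j: "1 \<le> j" "j \<le> CARD('n)" using pos[OF l] by (auto simp: j_def)
      have jj: "j \<in> {1..2 * CARD('n)}" using j by auto
      have k: "xx j (v x) = xx (kix j v) x" for x
        using kix(2)[OF that(1), of x j] j by (simp add: xx_idx)
      have R: "kix j v \<in> {1..2 * CARD('n)}" by (rule kix(1)[OF that(1)])
      have R': "neg_idx CARD('n) (kix j v) \<in> {1..2 * CARD('n)}" using R by (rule neg_idx_in)
      have pp: "pos p \<in> {1..2 * CARD('n)}" using pos(1,2)[OF that(2)] by auto
      have "pos p = kix j v \<or> pos p = neg_idx CARD('n) (kix j v)"
        using l3
      proof
        assume "\<forall>y :: complex^('n::{finite,linorder}). xx l y = xx (pos l) y"
        then have "xx (pos p) x = xx (kix j v) x" for x :: "complex^('n::{finite,linorder})" using e k by (simp add: j_def)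
        then show ?thesis using xx_inj[OF pp R] by blast
      next
        assume "\<forall>y :: complex^('n::{finite,linorder}). xx l y = xx (neg_idx CARD('n) (pos l)) y"
        then have "xx (pos p) x = xx (neg_idx CARD('n) (kix j v)) x" for x :: "complex^('n::{finite,linorder})"
          using e k xx_neg[OF jj] xx_neg[OF R] by (simp add: j_def)
        then show ?thesis using xx_inj[OF pp R'] by blast
      qed
      then have "p = kix j v \<or> p = neg_idx CARD('n) (kix j v)"
        using pos(3)[OF that(2)] neg_idx_neg_idx[OF R] by metis
      then show ?thesis using j by blast
    qed
  next
    fix i j assume ij: "i \<in> {1..2 * CARD('n)}" "j \<in> {1..2 * CARD('n)}" "i \<noteq> j"
    note d = Ed[OF ij] Ed[OF ij(2,1) ij(3)[symmetric]]
    show "m_a par i j + m_b par i j = (mconst (tau par) :: 'n mero)"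
    proof -
      have "(x - y * r) / (1 - r) + (y - x) / (1 - r) = y" if "1 - r \<noteq> 0" for x y r :: "'n mero"
      proof -
        have "(x - y * r) / (1 - r) + (y - x) / (1 - r) = y * (1 - r) / (1 - r)"
          unfolding add_divide_distrib[symmetric] by (simp add: right_diff_distrib)
        then show ?thesis using that by simp
      qed
      then show ?thesis unfolding m_a_eq m_b_eq using d(1) by blast
    qed
    show "m_b par i j + m_b par j i = (mconst (tau par) - inverse (mconst (tau par)) :: 'n mero)"
    proof -
      have nE: "(exp_xx i :: 'n mero) \<noteq> exp_xx j" using exp_xx_eq_iff[OF ij(1,2)] ij(3) by blast
      have "z / (1 - exp_xx i / exp_xx j) + z / (1 - exp_xx j / exp_xx i) = z" for z :: "'n mero"
        using inverse_one_minus_ratio[OF exp_xx_nz exp_xx_nz nE] .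
      then show ?thesis unfolding m_b_eq .
    qed
    show "m_a par i j \<noteq> (0 :: 'n mero)"
    proof
      assume "m_a par i j = (0 :: 'n mero)"
      then have "exp_xx i = inverse (mconst (tau par)) * inverse (mconst (tau par)) * (exp_xx j :: 'n mero)"
        unfolding m_a_eq using ratio_eqI[OF exp_xx_nz t(1) d(1)] by blast
      then show False using exp_xx_separate[OF ij, of "inverse (tau par) * inverse (tau par)"]
        by (simp add: mconst_mult mconst_inverse)
    qed
  next
    fix i j l assume "i \<in> {1..2 * CARD('n)}" "j \<in> {1..2 * CARD('n)}" "l \<in> {1..2 * CARD('n)}" "i \<noteq> j" "i \<noteq> l" "j \<noteq> l"
    then have d: "(exp_xx i :: 'n mero) \<noteq> exp_xx j" "(exp_xx i :: 'n mero) \<noteq> exp_xx l" "(exp_xx j :: 'n mero) \<noteq> exp_xx l"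
      by (simp_all add: exp_xx_eq_iff del: atLeastAtMost_iff)
    have b: "m_b par p q = (mconst (tau par) - inverse (mconst (tau par))) * (exp_xx q / (exp_xx q - exp_xx p) :: 'n mero)" for p q
      unfolding m_b_eq using divide_one_minus_ratio[OF exp_xx_nz] by blast
    \<comment> \<open>The partial fraction identity behind \<open>b_triple\<close>, with x, y, z the
      exponentials for i, j, l and the common factor of b removed.\<close>
    have id: "y / (y - x) * (z / (z - x)) = y / (y - x) * (z / (z - y)) + z / (z - x) * (y / (y - z))"
      if "x \<noteq> y" "x \<noteq> z" "y \<noteq> z" for x y z :: "'n mero"
    proof -
      have "(y - x) * inverse (y - x) = 1" "(z - x) * inverse (z - x) = 1" "(z - y) * inverse (z - y) = 1"
        using that by auto
      moreover have "inverse (y - z) = - inverse (z - y)" by (metis inverse_minus_eq minus_diff_eq)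
      ultimately show ?thesis unfolding divide_inverse by algebra
    qed
    show "m_b par i j * m_b par i l = m_b par i j * m_b par j l + m_b par i l * (m_b par l j :: 'n mero)"
      unfolding b using id[OF d] by algebra
  next
    fix i j assume ij: "i \<in> {1..2 * CARD('n)}" "j \<in> {1..2 * CARD('n)}"
    show "m_a par (neg_idx CARD('n) j) (neg_idx CARD('n) i) = (m_a par i j :: 'n mero)"
      unfolding m_a_def xx_neg[OF ij(1)] xx_neg[OF ij(2)] by (simp add: add.commute flip: diff_conv_add_uminus)
    assume n: "i \<noteq> j" "i \<noteq> neg_idx CARD('n) j"
    have "exp_xx i \<noteq> inverse (exp_xx j :: 'n mero)"
      using n(2) ij exp_xx_eq_iff[of i "neg_idx CARD('n) j", where 'n = 'n] by (simp add: exp_xx_neg del: atLeastAtMost_iff)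
    then have ne: "exp_xx i * exp_xx j \<noteq> (1 :: 'n mero)" by (metis inverse_unique mult.commute)
    have nij: "(exp_xx i :: 'n mero) \<noteq> exp_xx j" using exp_xx_eq_iff ij n by blast
    have dd: "x / inverse y = x * y" for x y :: "'n mero" by (simp add: divide_inverse)
    show "m_b par i j * (mconst (taun par) - m_u par j) + (mconst (taun par) - m_u par i) * m_b par j i
      + m_u par i * m_b par j (neg_idx CARD('n) i) = m_b par i (neg_idx CARD('n) j) * (m_u par (neg_idx CARD('n) j) :: 'n mero)"
      unfolding m_b_eq m_u_eq exp_xx_neg[OF ij(1)] exp_xx_neg[OF ij(2)] dd
      by (rule b_u_identity[OF exp_xx_nz exp_xx_nz nij ne E2[OF ij(1)] E2[OF ij(2)] t(2,3)]) (rule HOL.refl)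
  qed simp
qed

section \<open>The induced module\<close>

lemma sum_fun: "(\<Sum>i\<in>I. F i) x = (\<Sum>i\<in>I. F i x)"
  by (induction I rule: infinite_finite_induct) auto

text \<open>Operators are arbitrary functions on the field, so composition distributes over sums in
  the right factor only if the left factor is additive. Elements of \<open>Dq c\<close> are.\<close>

definition add_op :: "('n::finite) mero_op \<Rightarrow> bool" where
  "add_op A \<longleftrightarrow> (\<forall>f g. A (f + g) = A f + A g)"

lemma add_op_zero: "add_op A \<Longrightarrow> A 0 = 0"
  unfolding add_op_def by (metis add.right_neutral add_left_cancel)

lemma add_op_sum: "add_op A \<Longrightarrow> A (sum f I) = (\<Sum>i\<in>I. A (f i))"
  by (induction I rule: infinite_finite_induct) (simp_all add: add_op_zero add_op_def[THEN iffD1, rule_format])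

lemma add_op_intros:
  "add_op 0" "add_op (mult_op f)" "aff g \<Longrightarrow> add_op (act g)"
  "add_op A \<Longrightarrow> add_op B \<Longrightarrow> add_op (A + B)" "add_op A \<Longrightarrow> add_op B \<Longrightarrow> add_op (A - B)"
  "add_op A \<Longrightarrow> add_op B \<Longrightarrow> add_op (A \<circ> B)"
  by (auto simp: add_op_def mult_op_def distrib_left act_add)

lemma add_op_sum': "(\<And>i. i \<in> I \<Longrightarrow> add_op (A i)) \<Longrightarrow> add_op (\<Sum>i\<in>I. A i)"
  by (induction I rule: infinite_finite_induct) (auto intro: add_op_intros)

lemma aff_transl: "aff (\<lambda>x. x - c *s d)"
  using aff_translation[of "- (c *s d)"] by simp

lemma add_op_transl: "add_op (transl c \<mu>)"
  unfolding transl_def by (intro add_op_intros aff_transl)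

lemma add_op_Dq: "A \<in> Dq c \<Longrightarrow> add_op A"
  by (induction rule: Dq.induct) (assumption | rule add_op_intros add_op_transl)+

lemma zero_Dq: "(0 :: ('n::finite) mero_op) \<in> Dq c"
proof -
  have "mult_op 0 = (0 :: ('n::finite) mero_op)" by (simp add: mult_op_def fun_eq_iff)
  then show ?thesis using Dq.intros(1)[of 0] by metis
qed

lemma sum_Dq: "(\<And>i. i \<in> I \<Longrightarrow> A i \<in> Dq c) \<Longrightarrow> (\<Sum>i\<in>I. A i) \<in> Dq c"
  by (induction I rule: infinite_finite_induct) (auto intro: zero_Dq Dq.intros)

lemma act_inv_act: "v \<in> weyl \<Longrightarrow> act (inv v) (act v f) = f" "v \<in> weyl \<Longrightarrow> act v (act (inv v) f) = f"
  using weyl_inverse[of v] inv_o_cancel[of v] surj_iff[of v]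
  by (simp_all add: act_act weyl_aff bij_is_inj bij_is_surj)

lemma cross_add_op:
  assumes "\<And>u. add_op (A u)" "\<And>u. add_op (B u)"
  shows "add_op ((A \<star> B) w)"
proof (cases "w \<in> weyl")
  case True
  have "add_op (\<Sum>u\<in>weyl. A u \<circ> (act u \<circ> B (inv u \<circ> w) \<circ> act (inv u)))"
    using assms by (intro add_op_sum' add_op_intros weyl_aff weyl_inverse) auto
  then show ?thesis using True by (simp add: cmul_def)
qed (simp add: cmul_def add_op_intros)

lemma cfun_add_op: "add_op (cfun f u)"
  by (simp add: cfun_def add_op_intros)

lemma cgrp_add_op: "add_op (cgrp g u)"
  by (simp add: cgrp_def add_op_intros aff_translation)

lemma T_op_add_op: "add_op (T_op par c i u)"
  by (simp add: T_op_def) (intro add_op_intros cross_add_op cfun_add_op; simp add: add_op_intros cfun_add_op cgrp_add_op)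

lemma mact_out: "v \<notin> weyl \<Longrightarrow> mact A m v = 0"
  by (simp add: mact_def)

lemma mact_add: "mact (A + B) m = mact A m + mact B m"
  by (rule ext) (simp add: mact_def act_add weyl_aff weyl_inverse sum.distrib)

lemma mact_diff: "mact (A - B) m = mact A m - mact B m"
  by (rule ext) (simp add: mact_def act_diff weyl_aff weyl_inverse sum_subtractf)

lemma mact_sum: "mact (\<Sum>i\<in>I. A i) m v = (\<Sum>i\<in>I. mact (A i) m v)"
proof -
  have 0: "mact 0 m = 0"
    by (rule ext) (simp add: mact_def act_0 weyl_aff weyl_inverse)
  show ?thesis
  proof (induction I rule: infinite_finite_induct)
    case (insert x F)
    have "(mact (A x) m + mact (sum A F) m) v = mact (A x) m v + (\<Sum>i\<in>F. mact (A i) m v)"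
      by (simp add: insert.IH)
    then show ?case unfolding sum.insert[OF insert.hyps] mact_add .
  next
    case (infinite F)
    then show ?case unfolding sum.infinite[OF infinite] 0 by simp
  next
    case empty
    show ?case unfolding sum.empty 0 by simp
  qed
qed

lemma mact_single:
  assumes "w \<in> weyl" "v \<in> weyl" "\<And>u. u \<in> weyl \<Longrightarrow> u \<noteq> w \<Longrightarrow> A u = 0"
  shows "mact A m v = act (inv v) (A w (act v (m (inv w \<circ> v))))"
proof -
  have "(\<Sum>u\<in>weyl. act (inv v) (A u (act v (m (inv u \<circ> v))))) =
      (\<Sum>u\<in>weyl. if u = w then act (inv v) (A w (act v (m (inv w \<circ> v)))) else 0)"
    using assms by (intro sum.cong refl) (auto simp: act_0 weyl_aff weyl_inverse)
  then show ?thesis using assms(1,2) by (simp add: mact_def finite_weyl)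
qed

lemma mact_cfun: "v \<in> weyl \<Longrightarrow> mact (cfun f) m v = act (inv v) f * m v"
  by (subst mact_single[OF weyl_id])
    (auto simp: cfun_def mult_op_def act_mult weyl_aff weyl_inverse act_inv_act inv_id)

lemma mact_cgrp:
  assumes "(\<lambda>x. g x - g 0) = w" "w \<in> weyl" "v \<in> weyl"
  shows "mact (cgrp g) m v = act (inv v) (act (\<lambda>x. x + g 0) (act v (m (inv w \<circ> v))))"
  by (subst mact_single[OF assms(2,3)]) (auto simp: cgrp_def assms(1))

text \<open>The term of A at u and the term of B at u' contribute to the product at w = u u'.
  Collecting by w or by the pair (u, u') gives the same sum; additivity of \<open>A u\<close> lets
  the sum over u' be taken outside.\<close>

lemma mact_cmul:
  assumes A: "\<And>u. add_op (A u)"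
  shows "mact (A \<star> B) m = mact A (mact B (m :: ('n::finite) indmod))"
proof
  fix v :: "complex^'n \<Rightarrow> complex^'n"
  show "mact (A \<star> B) m v = mact A (mact B m) v"
  proof (cases "v \<in> weyl")
    case v: True
    define G where "G u u' = act (inv v) (A u (act u (B u' (act (inv u) (act v (m (inv u' \<circ> (inv u \<circ> v))))))))" for u u'
    have L: "mact (A \<star> B) m v = (\<Sum>w\<in>weyl. \<Sum>u\<in>weyl. G u (inv u \<circ> w))"
    proof -
      have "act (inv v) ((A \<star> B) w (act v (m (inv w \<circ> v)))) = (\<Sum>u\<in>weyl. G u (inv u \<circ> w))" if w: "w \<in> weyl" for w
      proof -
        have "inv (inv u \<circ> w) \<circ> (inv u \<circ> v) = inv w \<circ> v" if u: "u \<in> weyl" for u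
        proof -
          have "inv (inv u \<circ> w) = inv w \<circ> u"
            using weyl_inverse[OF u] weyl_inverse[OF w] weyl_inverse(1)[of "inv u"] weyl_inv_inv[OF u]
            by (simp add: o_inv_distrib)
          moreover have "u (inv u x) = x" for x
            using weyl_inverse(1)[OF u] by (simp add: bij_is_surj surj_f_inv_f)
          ultimately show ?thesis by (simp add: fun_eq_iff)
        qed
        then show ?thesis using w v
          by (simp add: cmul_def sum_fun act_sum weyl_aff weyl_inverse G_def)
      qed
      then show ?thesis using v by (simp add: mact_def)
    qed
    have R: "mact A (mact B m) v = (\<Sum>u\<in>weyl. \<Sum>u'\<in>weyl. G u u')"
    proof -
      have "act (inv v) (A u (act v (mact B m (inv u \<circ> v)))) = (\<Sum>u'\<in>weyl. G u u')" if u: "u \<in> weyl" for u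
      proof -
        note W = weyl_inverse[OF u] weyl_inverse[OF v] weyl_inv_inv[OF u]
        have uv: "inv u \<circ> v \<in> weyl" using W v weyl_comp by blast
        have 1: "v \<circ> inv (inv u \<circ> v) = u"
        proof -
          have "inv (inv u \<circ> v) = inv v \<circ> u"
            using W weyl_inverse(1)[of "inv u"] by (simp add: o_inv_distrib)
          moreover have "v (inv v x) = x" for x
            using W by (simp add: bij_is_surj surj_f_inv_f)
          ultimately show ?thesis by (simp add: fun_eq_iff)
        qed
        have 2: "act v (act (inv (inv u \<circ> v)) f) = act u f" for f
          using act_act[of v "inv (inv u \<circ> v)" f] weyl_aff v weyl_inverse(2)[OF uv] 1 by metis
        have 3: "act (inv u \<circ> v) f = act (inv u) (act v f)" for f
          using act_act[of "inv u" v f] weyl_aff v W by metis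
        show ?thesis
          using uv v W by (simp add: mact_def act_sum weyl_aff 2 3 add_op_sum[OF A] G_def)
      qed
      then show ?thesis using v by (simp add: mact_def)
    qed
    have "(\<Sum>w\<in>weyl. G u (inv u \<circ> w)) = (\<Sum>u'\<in>weyl. G u u')" if u: "u \<in> weyl" for u
    proof (rule sum.reindex_bij_betw)
      show "bij_betw (\<lambda>w. inv u \<circ> w) weyl weyl"
        using weyl_inverse[OF u] u
        by (intro bij_betw_byWitness[where f' = "\<lambda>w. u \<circ> w"])
          (auto simp: o_assoc[symmetric] fun_eq_iff bij_is_inj bij_is_surj surj_f_inv_f intro!: weyl_comp)
    qed
    then show ?thesis unfolding L R by (subst sum.swap) simp
  qed (simp add: mact_out)
qed

section \<open>The action of the generators T_i on the module\<close>

lemma swp_swp: "swp i j (swp i j x) = x"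
  by (simp add: swp_def vec_eq_iff)

lemma flp_flp: "flp i (flp i x) = x"
  by (simp add: flp_def vec_eq_iff)

lemma simple_refl_refl: "simple_refl i (simple_refl i x) = x"
  by (simp add: simple_refl_def swp_swp flp_flp)

lemma mact_simple_refl:
  assumes "v \<in> weyl" shows "mact (cgrp (simple_refl i)) m v = m (simple_refl i \<circ> v)"
proof -
  have 0: "simple_refl i 0 = 0" using weyl_linear(1)[OF simple_refl_weyl[of i]] linear_0 by blast
  have 1: "(\<lambda>x. simple_refl i x - simple_refl i 0) = simple_refl i" and 2: "(\<lambda>x. x + simple_refl i 0) = id" by (auto simp: 0)
  have 3: "inv (simple_refl i) = simple_refl i" by (rule inv_unique_comp) (auto simp: simple_refl_refl)
  show ?thesis
    unfolding mact_cgrp[OF 1 simple_refl_weyl assms] 2 3 act_id act_inv_act[OF assms] ..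
qed

lemma mact_T_op_gen:
  assumes "v \<in> weyl"
  shows "mact (T_op par c i) m v = mconst (tau_i par CARD('n) i) * m v
    + act (inv v) (c_i par c i) * (mact (cgrp (aff_refl c i)) m v - (m v :: ('n::{finite,linorder}) mero))"
  using assms
  by (simp add: T_op_def mact_add mact_cmul cfun_add_op mact_cfun mact_diff act_const act_1 weyl_aff weyl_inverse)

lemma act_inv_weyl:
  "v \<in> weyl \<Longrightarrow> mero_fun F \<Longrightarrow> act (inv v) (mero_of F) = mero_of (\<lambda>x. F (v x))"
  by (simp add: act_mero weyl_aff weyl_inverse weyl_inv_inv)

lemma mero_fun_fn:
  assumes "holo UNIV f"
  shows "mero_fun (\<lambda>x. fn_a par (f x))" "mero_fun (\<lambda>x. fn_u par (f x))" "mero_fun (\<lambda>x. fn_ut par c (f x))"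
  unfolding fn_a_def fn_u_def fn_ut_def
  using assms by (intro mero_fun_intros holo_mero_fun[OF holo_exp] holo_mult holo_const assms)+

lemma mero_fun_xx_diff:
  "mero_fun (\<lambda>x. fn_a par (xx i x - xx j x))" "mero_fun (\<lambda>x. fn_u par (xx i x))" "mero_fun (\<lambda>x. fn_ut par c (xx i x))"
  by (intro mero_fun_fn holo_diff holo_xx)+

lemma xx_kix:
  fixes v :: "complex^('n::{finite,linorder}) \<Rightarrow> complex^('n::{finite,linorder})"
  shows "v \<in> weyl \<Longrightarrow> i \<le> CARD('n) \<Longrightarrow> xx i (v x) = xx (kix i v) x"
  using kix(2)[of v x i] by (simp add: xx_idx)

lemma act_c_i_less:
  fixes v :: "complex^('n::{finite,linorder}) \<Rightarrow> complex^('n::{finite,linorder})"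
  assumes "v \<in> weyl" "1 \<le> i" "i < CARD('n)"
  shows "act (inv v) (c_i par c i) = m_a par (kix i v) (kix (Suc i) v)"
proof -
  have "c_i par c i = mero_of (\<lambda>x :: complex^('n::{finite,linorder}). fn_a par (xx i x - xx (Suc i) x))"
    using assms by (simp add: c_i_def fn_a_def aroot_def xx_idx)
  then show ?thesis
    using assms by (simp add: act_inv_weyl mero_fun_xx_diff m_a_def xx_kix)
qed

lemma act_c_i_n:
  fixes v :: "complex^('n::{finite,linorder}) \<Rightarrow> complex^('n::{finite,linorder})"
  assumes "v \<in> weyl"
  shows "act (inv v) (c_i par c CARD('n)) = m_u par (kix CARD('n) v)"
proof -
  have "c_i par c CARD('n) = mero_of (\<lambda>x :: complex^('n::{finite,linorder}). fn_u par (xx CARD('n) x))"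
    by (simp add: c_i_def fn_u_def aroot_def xx_idx cfrac_def)
  then show ?thesis
    using assms by (simp add: act_inv_weyl mero_fun_xx_diff m_u_def xx_kix)
qed

text \<open>Since a_0 / 2 = c / 2 - x_1, the exponential of a_0 / 2 is q^(1/2) e^(-x_1), and the
  coefficient is \<open>fn_ut\<close> at -x_1. Hence the negated index.\<close>

lemma act_c_i_0:
  fixes v :: "complex^('n::{finite,linorder}) \<Rightarrow> complex^('n::{finite,linorder})"
  assumes "v \<in> weyl"
  shows "act (inv v) (c_i par c 0) = m_ut par c (neg_idx CARD('n) (kix 1 v))"
proof -
  have "cfrac (tau0 par) (tau0v par) (c - 2 * z) = fn_ut par c (- z)" for z
  proof -
    have "exp ((c - 2 * z) / 2) = exp (c / 2) * exp (- z)" "exp (c - 2 * z) = exp c * exp (2 * - z)"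
      by (simp_all add: diff_divide_distrib flip: exp_add)
    then show ?thesis by (simp only: cfrac_def fn_ut_def mult.assoc)
  qed
  then have "c_i par c 0 = mero_of (\<lambda>x :: complex^('n::{finite,linorder}). fn_ut par c (- xx 1 x))"
    by (simp add: c_i_def aroot_def xx_idx)
  moreover have "mero_fun (\<lambda>x :: complex^('n::{finite,linorder}). fn_ut par c (- xx 1 x))"
    by (intro mero_fun_fn holo_uminus holo_xx)
  moreover have "xx 1 (v x) = xx (kix 1 v) x" for x
    using kix(2)[OF assms, of x 1] by (simp add: xx_idx)
  ultimately show ?thesis
    using assms
    by (simp add: act_inv_weyl m_ut_def xx_neg[OF kix(1)[OF assms]])
qed

lemma m_vt_eq: "m_vt par c i = mconst (tau0 par) - m_ut par c i"
  by (simp add: m_vt_def m_ut_def fn_vt_def mero_of_diff mero_fun_xx_diff)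

definition eps_vec :: "nat \<Rightarrow> complex^('n::{finite,linorder})" where
  "eps_vec i = (\<chi> k. of_int (eps i $ k))"

lemma eps_neg: "i \<in> {1..2 * CARD('n)} \<Longrightarrow> eps (neg_idx CARD('n) i) = - (eps i :: int^('n::{finite,linorder}))"
  by (auto simp: eps_def neg_idx_def)

lemma xx_eps_vec:
  assumes "i \<in> {1..2 * CARD('n)}" "j \<in> {1..2 * CARD('n)}"
  shows "xx i (eps_vec j :: complex^('n::{finite,linorder})) =
    (if i = j then 1 else if i = neg_idx CARD('n) j then -1 else 0)"
proof -
  have inj: "(idx p :: 'n) = idx q \<longleftrightarrow> p = q" if "p \<in> {1..CARD('n)}" "q \<in> {1..CARD('n)}" for p q
    using that idx_eq_iff by auto
  show ?thesis
    using assms by (cases "i \<le> CARD('n)"; cases "j \<le> CARD('n)")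
      (auto simp: xx_def eps_vec_def eps_def axis_def neg_idx_def dest!: inj[THEN iffD1, rotated -1])
qed

lemma weyl_eps_vec:
  fixes v :: "complex^('n::{finite,linorder}) \<Rightarrow> complex^('n::{finite,linorder})"
  assumes v: "v \<in> weyl"
  shows "v (eps_vec (kix 1 v)) = axis (idx 1) 1"
proof -
  have "v (eps_vec (kix 1 v)) $ k = axis (idx 1) 1 $ k" for k
  proof -
    obtain j where j: "1 \<le> j" "j \<le> CARD('n)" "k = idx j" using idx_surj .
    have "kix j v \<noteq> kix 1 v \<and> kix j v \<noteq> neg_idx CARD('n) (kix 1 v)" if "j \<noteq> 1"
    proof -
      obtain x where x: "v x = axis (idx j) 1"
        using weyl_inverse(1)[OF v] by (metis bij_is_surj surjD)
      have "(idx j :: 'n) \<noteq> idx 1" using that j idx_eq_iff[where 'n = 'n] by simp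
      then have "xx (kix j v) x = 1" "xx (kix 1 v) x = 0"
        using kix(2)[OF v, of x j] kix(2)[OF v, of x 1] x by (auto simp: axis_def)
      then show ?thesis using xx_neg[OF kix(1)[OF v, of 1], of x] by auto
    qed
    then show ?thesis
      using kix(2)[OF v, of "eps_vec (kix 1 v)" j] xx_eps_vec[OF kix(1)[OF v, of j] kix(1)[OF v, of 1]] j idx_eq_iff[where 'n = 'n, of j 1]
      by (auto simp: axis_def)
  qed
  then show ?thesis by (simp add: vec_eq_iff)
qed

text \<open>The map s_0 is the sign change of x_1 followed by translation by c \<epsilon>_1.
  Conjugation by v turns the latter into translation by c v^-1 \<epsilon>_1; as
  \<open>transl\<close> subtracts its vector, the index is negated.\<close>

lemma mact_s0:
  fixes v :: "complex^('n::{finite,linorder}) \<Rightarrow> complex^('n::{finite,linorder})"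
  assumes v: "v \<in> weyl"
  shows "mact (cgrp (aff_refl c 0)) m v = transl c (eps (neg_idx CARD('n) (kix 1 v))) (m (flp 1 \<circ> v))"
proof -
  let ?g = "aff_refl c 0 :: complex^('n::{finite,linorder}) \<Rightarrow> complex^('n::{finite,linorder})"
  have g0: "?g 0 = c *s axis (idx 1) 1"
    by (auto simp: aff_refl_def vec_eq_iff axis_def)
  have lin: "(\<lambda>x. ?g x - ?g 0) = flp 1"
    by (auto simp: aff_refl_def vec_eq_iff flp_def fun_eq_iff)
  have inv: "inv (flp 1 :: complex^('n::{finite,linorder}) \<Rightarrow> complex^('n::{finite,linorder})) = flp 1"
    by (rule inv_unique_comp) (auto simp: flp_flp)
  have iv: "inv v (axis (idx 1) 1) = eps_vec (kix 1 v)"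
    using weyl_eps_vec[OF v] weyl_inverse(1)[OF v] by (metis bij_inv_eq_iff)
  have "inv v \<circ> ((\<lambda>x. x + ?g 0) \<circ> v) = (\<lambda>x. x + c *s eps_vec (kix 1 v))"
  proof
    fix x
    have "inv v (v x + c *s axis (idx 1) 1) = x + c *s eps_vec (kix 1 v)"
      unfolding linear_add[OF weyl_linear(1)[OF weyl_inverse(2)[OF v]]] weyl_linear(2)[OF weyl_inverse(2)[OF v]] iv
      using weyl_inverse(1)[OF v] by (simp add: bij_is_inj)
    then show "(inv v \<circ> ((\<lambda>x. x + ?g 0) \<circ> v)) x = x + c *s eps_vec (kix 1 v)" by (simp add: g0)
  qed
  also have "\<dots> = (\<lambda>x. x - c *s (\<chi> k. of_int (eps (neg_idx CARD('n) (kix 1 v)) $ k)))"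
    unfolding eps_neg[OF kix(1)[OF v]] by (simp add: eps_vec_def fun_eq_iff vec_eq_iff)
  finally have *: "inv v \<circ> ((\<lambda>x. x + ?g 0) \<circ> v) = (\<lambda>x. x - c *s (\<chi> k. of_int (eps (neg_idx CARD('n) (kix 1 v)) $ k)))" .
  have "mact (cgrp ?g) m v = act (inv v) (act (\<lambda>x. x + ?g 0) (act v (m (flp 1 \<circ> v))))"
    unfolding mact_cgrp[OF lin flp_weyl v] inv ..
  also have "\<dots> = act (inv v \<circ> ((\<lambda>x. x + ?g 0) \<circ> v)) (m (flp 1 \<circ> v))"
    unfolding act_act[OF aff_translation weyl_aff[OF v]]
      act_act[OF weyl_aff[OF weyl_inverse(2)[OF v]] aff_comp[OF aff_translation weyl_aff[OF v]]] ..
  finally show ?thesis unfolding * transl_def .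
qed

lemma mact_T_op_0:
  fixes v :: "complex^('n::{finite,linorder}) \<Rightarrow> complex^('n::{finite,linorder})"
  assumes v: "v \<in> weyl"
  defines "k \<equiv> neg_idx CARD('n) (kix 1 v)"
  shows "mact (T_op par c 0) m v = m_vt par c k * m v + m_ut par c k * transl c (eps k) (m (flp 1 \<circ> v))"
  unfolding mact_T_op_gen[OF v] mact_s0[OF v] act_c_i_0[OF v] m_vt_eq k_def
  by (simp add: tau_i_def algebra_simps)

section \<open>Elements of M' as functions on the Weyl group\<close>

lemma finite_weyl_stab: "finite (weyl_stab :: (complex^('n::{finite,linorder}) \<Rightarrow> _) set)"
  by (rule finite_subset[OF _ finite_weyl]) (auto simp: weyl_stab_def)

lemma card_weyl_stab: "card (weyl_stab :: (complex^('n::{finite,linorder}) \<Rightarrow> _) set) \<noteq> 0"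
proof -
  have "id \<in> (weyl_stab :: (complex^('n::{finite,linorder}) \<Rightarrow> _) set)"
    using weyl_id unfolding weyl_stab_def by auto
  then show ?thesis by (auto simp: card_eq_0_iff finite_weyl_stab)
qed

lemma weyl_stab_iff:
  fixes w :: "complex^('n::{finite,linorder}) \<Rightarrow> complex^('n::{finite,linorder})"
  assumes w: "w \<in> weyl"
  shows "w \<in> weyl_stab \<longleftrightarrow> kix 1 w = 1"
proof
  assume "kix 1 w = 1"
  then have "w (eps_vec 1) = axis (idx 1) 1" using weyl_eps_vec[OF w] by simp
  moreover have "eps_vec 1 = (axis (idx 1) 1 :: complex^('n::{finite,linorder}))"
    by (simp add: eps_vec_def eps_def axis_def vec_eq_iff)
  ultimately show "w \<in> weyl_stab" using w by (simp add: weyl_stab_def)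
next
  assume "w \<in> weyl_stab"
  then have "w (axis (idx 1) 1) $ idx 1 = 1" by (simp add: weyl_stab_def axis_def)
  moreover have "eps_vec 1 = (axis (idx 1) 1 :: complex^('n::{finite,linorder}))"
    by (simp add: eps_vec_def eps_def axis_def vec_eq_iff)
  ultimately have "xx (kix 1 w) (eps_vec 1 :: complex^('n::{finite,linorder})) = 1" using kix(2)[OF w] by metis
  then show "kix 1 w = 1"
    using xx_eps_vec[OF kix(1)[OF w, of 1], of 1] by (auto split: if_splits)
qed

definition stab_weight :: "('n::{finite,linorder}) mero" where
  "stab_weight = mconst (1 / of_nat (card (weyl_stab :: (complex^('n::{finite,linorder}) \<Rightarrow> complex^('n::{finite,linorder})) set)))"

lemma stab_weight_nz: "stab_weight \<noteq> 0"
  unfolding stab_weight_def using card_weyl_stab by (intro mconst_nz) simp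

text \<open>The element r_j f lives at a single point of the group; averaging over W' spreads it
  evenly over the coset W' r_j, which consists of the v with \<open>kix 1 v = j\<close>. The nonzero
  constant \<open>stab_weight\<close> remains as a common factor of everything in M'.\<close>

lemma mact_e':
  fixes v :: "complex^('n::{finite,linorder}) \<Rightarrow> complex^('n::{finite,linorder})"
  assumes v: "v \<in> weyl" and j: "j \<in> {1..2 * CARD('n)}"
  shows "mact e' (tens (coset_rep j) f) v = stab_weight * (if kix 1 v = j then f else 0)"
proof -
  let ?r = "coset_rep j :: complex^('n::{finite,linorder}) \<Rightarrow> complex^('n::{finite,linorder})"
  have r: "?r \<in> weyl" by (rule coset_rep_weyl)
  have g: "mact (cgrp w) (tens ?r f) v = (if w = v \<circ> inv ?r then f else 0)" if "w \<in> weyl_stab" for w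
  proof -
    have w: "w \<in> weyl" using that by (simp add: weyl_stab_def)
    have w0: "w 0 = 0" using weyl_linear(1)[OF w] linear_0 by blast
    then have lin: "(\<lambda>x. w x - w 0) = w" and t: "(\<lambda>x. x + w 0) = id" by auto
    have "mact (cgrp w) (tens ?r f) v = tens ?r f (inv w \<circ> v)"
      unfolding mact_cgrp[OF lin w v] t by (simp only: act_id act_inv_act[OF v])
    moreover have "inv w \<circ> v = ?r \<longleftrightarrow> w = v \<circ> inv ?r"
    proof
      assume "inv w \<circ> v = ?r"
      then have "w \<circ> (inv w \<circ> v) \<circ> inv ?r = w \<circ> ?r \<circ> inv ?r" by simp
      then show "w = v \<circ> inv ?r"
        using weyl_inverse(1)[OF w] weyl_inverse(1)[OF r]
        by (simp add: fun_eq_iff bij_is_surj surj_f_inv_f)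
    next
      assume "w = v \<circ> inv ?r"
      then have "inv w \<circ> (w \<circ> ?r) = inv w \<circ> ((v \<circ> inv ?r) \<circ> ?r)" by simp
      then show "inv w \<circ> v = ?r"
        using weyl_inverse(1)[OF w] weyl_inverse(1)[OF r]
        by (simp add: fun_eq_iff bij_is_inj)
    qed
    ultimately show ?thesis by (simp add: tens_def)
  qed
  have stab: "v \<circ> inv ?r \<in> weyl_stab \<longleftrightarrow> kix 1 v = j"
  proof -
    have vr: "v \<circ> inv ?r \<in> weyl" using v weyl_inverse(2)[OF r] weyl_comp by blast
    have k1: "(v \<circ> inv ?r) (?r x) = v x" for x using weyl_inverse(1)[OF r] by (simp add: bij_is_inj)
    have k2: "?r x $ idx 1 = xx j x" for x using kix(2)[OF r, of x 1] kix_coset_rep[OF j] by simp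
    have one: "1 \<in> {1..2 * CARD('n)}" using zero_less_card_finite[where 'a = 'n] by simp
    show ?thesis unfolding weyl_stab_iff[OF vr]
    proof
      assume "kix 1 (v \<circ> inv ?r) = 1"
      then have "v x $ idx 1 = xx j x" for x
        using kix(2)[OF vr, of "?r x" 1] k1 k2 by (simp add: xx_def)
      then show "kix 1 v = j" by (rule kix_eqI[OF j])
    next
      assume kv: "kix 1 v = j"
      show "kix 1 (v \<circ> inv ?r) = 1"
      proof (rule kix_eqI[OF one])
        fix x
        have "(v \<circ> inv ?r) x $ idx 1 = xx j (inv ?r x)" using kix(2)[OF v, of "inv ?r x" 1] kv by simp
        also have "\<dots> = ?r (inv ?r x) $ idx 1" by (simp only: k2)
        also have "\<dots> = xx 1 x" using weyl_inverse(1)[OF r] by (simp add: bij_is_surj surj_f_inv_f xx_def)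
        finally show "(v \<circ> inv ?r) x $ idx 1 = xx 1 x" .
      qed
    qed
  qed
  have "mact e' (tens ?r f) v = stab_weight * (\<Sum>w\<in>weyl_stab. mact (cgrp w) (tens ?r f) v)"
    unfolding e'_def mact_cmul[OF cfun_add_op] mact_cfun[OF v] mact_sum stab_weight_def
    using act_const[OF weyl_aff[OF weyl_inverse(2)[OF v]]] by simp
  also have "(\<Sum>w\<in>weyl_stab. mact (cgrp w) (tens ?r f) v) = (\<Sum>w\<in>weyl_stab. if w = v \<circ> inv ?r then f else 0)"
    by (intro sum.cong HOL.refl g)
  also have "\<dots> = (if kix 1 v = j then f else 0)"
    by (subst sum.delta[OF finite_weyl_stab]) (simp only: stab)
  finally show ?thesis .
qed

lemma module_sum:
  fixes v :: "complex^('n::{finite,linorder}) \<Rightarrow> complex^('n::{finite,linorder})" and f :: "nat \<Rightarrow> ('n::{finite,linorder}) mero"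
  assumes v: "v \<in> weyl"
  shows "(\<Sum>j=1..2 * CARD('n). mact e' (tens (coset_rep j) (f j))) v = stab_weight * f (kix 1 v)"
proof -
  have "(\<Sum>j=1..2 * CARD('n). mact e' (tens (coset_rep j) (f j))) v =
      (\<Sum>j=1..2 * CARD('n). if j = kix 1 v then stab_weight * f j else 0)"
    unfolding sum_fun using mact_e'[OF v] by (intro sum.cong HOL.refl) auto
  then show ?thesis using kix(1)[OF v, of 1] by (simp add: sum.delta del: atLeastAtMost_iff)
qed

lemma module_sum2:
  fixes v :: "complex^('n::{finite,linorder}) \<Rightarrow> complex^('n::{finite,linorder})" and g :: "nat \<Rightarrow> nat \<Rightarrow> ('n::{finite,linorder}) mero"
  assumes v: "v \<in> weyl"
  shows "(\<Sum>k=1..2 * CARD('n). \<Sum>j=1..2 * CARD('n). mact e' (tens (coset_rep k) (g k j))) v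
    = stab_weight * (\<Sum>j=1..2 * CARD('n). g (kix 1 v) j)"
proof -
  have "(\<Sum>k=1..2 * CARD('n). \<Sum>j=1..2 * CARD('n). mact e' (tens (coset_rep k) (g k j))) v
    = (\<Sum>j=1..2 * CARD('n). (\<Sum>k=1..2 * CARD('n). mact e' (tens (coset_rep k) (g k j))) v)"
    unfolding sum_fun by (rule sum.swap)
  also have "\<dots> = (\<Sum>j=1..2 * CARD('n). stab_weight * g (kix 1 v) j)"
    using module_sum[OF v, of "\<lambda>k. g k j" for j] by simp
  finally show ?thesis by (simp add: sum_distrib_left)
qed

lemma module_sum_out:
  fixes v :: "complex^('n::{finite,linorder}) \<Rightarrow> complex^('n::{finite,linorder})" and g :: "nat \<Rightarrow> nat \<Rightarrow> ('n::{finite,linorder}) mero"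
  assumes v: "v \<notin> weyl"
  shows "(\<Sum>k=1..2 * CARD('n). \<Sum>j=1..2 * CARD('n). mact e' (tens (coset_rep k) (g k j))) v = 0"
  unfolding sum_fun using mact_out[OF v] by simp

section \<open>The matrix of Y_1\<close>

lemma opp_iff: "i \<in> {1..2 * n} \<Longrightarrow> j \<in> {1..2 * n} \<Longrightarrow> opp n i j \<longleftrightarrow> j = neg_idx n i"
  by (auto simp: opp_def neg_idx_def)

lemma opp_iff': "i \<in> {1..2 * n} \<Longrightarrow> l \<in> {1..2 * n} \<Longrightarrow> opp n l i \<longleftrightarrow> l = neg_idx n i"
  by (auto simp: opp_def neg_idx_def)

definition lax_entry :: "kvd_params \<Rightarrow> complex \<Rightarrow> nat \<Rightarrow> nat \<Rightarrow> ('n::{finite,linorder}) mero_op" where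
  "lax_entry par c i j = (\<Sum>k=1..2 * CARD('n). mult_op (P_mat par i k) \<circ> Q_mat par c k j)"

lemma Q_mat_sum:
  fixes f :: "nat \<Rightarrow> ('n::{finite,linorder}) mero"
  assumes i: "i \<in> {1..2 * CARD('n)}"
  shows "(\<Sum>j=1..2 * CARD('n). Q_mat par c i j (f j)) =
    m_ut par c i * transl c (eps i) (f i) + m_vt par c i * f (neg_idx CARD('n) i)"
proof -
  let ?n = "neg_idx CARD('n) i"
  have n: "?n \<noteq> i" using neg_idx_neq[OF _ i] zero_less_card_finite[where 'a = 'n] by simp
  have "Q_mat par c i j (f j) = (if j = i then m_ut par c i * transl c (eps i) (f i) else 0)
      + (if j = ?n then m_vt par c i * f ?n else 0)" if "j \<in> {1..2 * CARD('n)}" for j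
    using n opp_iff[OF i that] by (auto simp: Q_mat_def mult_op_def)
  then have "(\<Sum>j=1..2 * CARD('n). Q_mat par c i j (f j)) =
     (\<Sum>j=1..2 * CARD('n). (if j = i then m_ut par c i * transl c (eps i) (f i) else 0)
      + (if j = ?n then m_vt par c i * f ?n else 0))" by (intro sum.cong) auto
  then show ?thesis using i neg_idx_in[OF i] by (simp add: sum.distrib del: atLeastAtMost_iff)
qed

lemma lax_entry_sum:
  fixes f :: "nat \<Rightarrow> ('n::{finite,linorder}) mero"
  shows "(\<Sum>j=1..2 * CARD('n). lax_entry par c i j (f j)) = (\<Sum>l=1..2 * CARD('n). P_mat par i l *
    (m_ut par c l * transl c (eps l) (f l) + m_vt par c l * f (neg_idx CARD('n) l)))"
proof -
  have "(\<Sum>j=1..2 * CARD('n). lax_entry par c i j (f j)) =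
    (\<Sum>j=1..2 * CARD('n). \<Sum>l=1..2 * CARD('n). P_mat par i l * Q_mat par c l j (f j))"
    unfolding lax_entry_def sum_fun by (simp add: mult_op_def)
  also have "\<dots> = (\<Sum>l=1..2 * CARD('n). P_mat par i l * (\<Sum>j=1..2 * CARD('n). Q_mat par c l j (f j)))"
    by (subst sum.swap) (simp add: sum_distrib_left)
  also have "\<dots> = (\<Sum>l=1..2 * CARD('n). P_mat par i l *
    (m_ut par c l * transl c (eps l) (f l) + m_vt par c l * f (neg_idx CARD('n) l)))"
    by (intro sum.cong HOL.refl) (simp only: Q_mat_sum)
  finally show ?thesis .
qed

lemma lax_entry_Dq: "lax_entry par c i j \<in> Dq c"
  unfolding lax_entry_def Q_mat_def by (intro sum_Dq Dq.intros) (auto intro: Dq.intros zero_Dq)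

lemma foldr_mact_cmul:
  "mact (foldr (\<star>) (map (T_op par c) xs) B) m = foldr (\<lambda>i. mact (T_op par c i)) xs (mact B m)"
  by (induction xs) (simp_all add: mact_cmul T_op_add_op)

lemma Y1_mact:
  fixes f :: "nat \<Rightarrow> ('n::{finite,linorder}) mero" and v :: "complex^('n::{finite,linorder}) \<Rightarrow> complex^('n::{finite,linorder})"
  assumes par: "tau par \<noteq> 0" "taun par \<noteq> 0" "taunv par \<noteq> 0" and v: "v \<in> weyl"
    and m: "\<And>v. v \<in> weyl \<Longrightarrow> m v = stab_weight * f (kix 1 v)"
  shows "mact (Y1 par c) m v = stab_weight * (\<Sum>j=1..2 * CARD('n). lax_entry par c (kix 1 v) j (f j))"
proof -
  interpret H: hecke_states "CARD('n)" "weyl :: (complex^('n::{finite,linorder}) \<Rightarrow> complex^('n::{finite,linorder})) set"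
    "\<lambda>i v. simple_refl i \<circ> v" kix "m_a par" "m_b par" "m_u par" "\<lambda>i. mconst (taun par) - m_u par i"
    "mconst (tau par)" "mconst (taun par)" "mconst (tau par) - inverse (mconst (tau par)) :: ('n::{finite,linorder}) mero"
    by (rule hecke_weyl[OF par])
  define S where "S = mact (T_op par c 0) (mact (cfun 1) m)"
  have T: "mact (T_op par c i) m' v = H.T i m' v" if "1 \<le> i" "i \<le> CARD('n)" "v \<in> weyl" for i v and m' :: "'n indmod"
  proof (cases "i = CARD('n)")
    case True
    then have "aff_refl c i = (simple_refl CARD('n) :: complex^('n::{finite,linorder}) \<Rightarrow> _)"
      using that by (simp add: aff_refl_def simple_refl_def)
    then show ?thesis
      unfolding mact_T_op_gen[OF that(3)] using that True
      by (simp add: mact_simple_refl act_c_i_n H.T_n tau_i_def algebra_simps)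
  next
    case False
    then have i: "i < CARD('n)" using that by simp
    have "aff_refl c i = (simple_refl i :: complex^('n::{finite,linorder}) \<Rightarrow> _)"
      using that False by (simp add: aff_refl_def simple_refl_def)
    \<comment> \<open>Replacing tau by a + b brings tau + a (s - 1) into the form b + a s of the
      abstract operator.\<close>
    moreover have "m_a par (kix i v) (kix (Suc i) v) + m_b par (kix i v) (kix (Suc i) v) = (mconst (tau par) :: 'n mero)"
      using i that by (intro H.a_b H.k_range H.k_neq) auto
    then have "mconst (tau par) * m' v = m_a par (kix i v) (kix (Suc i) v) * m' v + m_b par (kix i v) (kix (Suc i) v) * m' v"
      by (metis distrib_right)
    ultimately show ?thesis
      unfolding mact_T_op_gen[OF that(3)] H.T_less[OF False] act_c_i_less[OF that(3,1) i]
      using that i by (simp add: mact_simple_refl tau_i_def algebra_simps)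
  qed
  have F: "foldr (\<lambda>i. mact (T_op par c i)) xs m' v = foldr H.T xs m' v"
    if "set xs \<subseteq> {1..CARD('n)}" "v \<in> weyl" for xs v and m' :: "'n indmod"
    using that
  proof (induction xs arbitrary: v)
    case (Cons i xs)
    then have "mact (T_op par c i) (foldr (\<lambda>i. mact (T_op par c i)) xs m') v
      = H.T i (foldr (\<lambda>i. mact (T_op par c i)) xs m') v" by (intro T) auto
    also have "\<dots> = H.T i (foldr H.T xs m') v"
    proof (rule H.T_cong)
      show "foldr (\<lambda>i. mact (T_op par c i)) xs m' v = foldr H.T xs m' v" if "v \<in> weyl" for v
        by (rule Cons.IH[OF _ that]) (use Cons.prems in auto)
    qed (use Cons.prems in auto)
    finally show ?case
      unfolding foldr.simps comp_apply[of "mact (T_op par c i)"] comp_apply[of "H.T i"] .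
  qed simp
  \<comment> \<open>Up to the weight, \<open>h (neg_idx CARD('n) l)\<close> is row l of Q applied to
    f. The sign change contained in h cancels against the one in \<open>X_first\<close>, which
    leaves the product P Q.\<close>
  define h where "h k = stab_weight * (m_vt par c (neg_idx CARD('n) k) * f k
     + m_ut par c (neg_idx CARD('n) k) * transl c (eps (neg_idx CARD('n) k)) (f (neg_idx CARD('n) k)))" for k
  have tw: "transl c \<mu> (stab_weight * g) = stab_weight * transl c \<mu> g" for \<mu> and g :: "'n mero"
    unfolding transl_def stab_weight_def by (simp add: act_mult act_const aff_transl)
  have S: "S v = h (kix 1 v)" if "v \<in> weyl" for v
  proof -
    have fv: "flp 1 \<circ> v \<in> weyl" using that flp_weyl weyl_comp by blast
    have "kix 1 (flp 1 \<circ> v) = neg_idx CARD('n) (kix 1 v)"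
      by (rule kix_eqI[OF neg_idx_in[OF kix(1)[OF that]]])
        (simp add: flp_def kix(2)[OF that] xx_neg[OF kix(1)[OF that]])
    moreover have "mact (cfun 1) m v' = m v'" if "v' \<in> weyl" for v'
      using that by (simp add: mact_cfun act_1 weyl_aff weyl_inverse)
    ultimately show ?thesis
      unfolding S_def mact_T_op_0[OF that] h_def using that fv by (simp add: m tw algebra_simps)
  qed
  have PP: "H.PP i j = P_mat par i j" if i: "i \<in> {1..2 * CARD('n)}" and j: "j \<in> {1..2 * CARD('n)}" for i j
  proof -
    have ex: "prod_excl par i j = (\<Prod>l\<in>{1..2 * CARD('n)} - {i, neg_idx CARD('n) i, j, neg_idx CARD('n) j}. m_a par j l :: 'n mero)"
      if j: "j \<in> {1..2 * CARD('n)}" for j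
      unfolding prod_excl_def using opp_iff'[OF i] opp_iff'[OF j] by (intro prod.cong HOL.refl) blast
    have ap: "m_a_plus par i j = (m_a par i (neg_idx CARD('n) j) :: 'n mero)" if j: "j \<in> {1..2 * CARD('n)}" for j
      unfolding m_a_plus_def m_a_def xx_neg[OF j] by simp
    have off: "H.Poff i j = P_off par i j" if j: "j \<in> {1..2 * CARD('n)}" for j
    proof (cases "i = j")
      case True
      then show ?thesis
        unfolding H.Poff_def P_off_def using ex[OF j] by (simp add: insert_commute)
    next
      case False
      then show ?thesis unfolding H.Poff_def P_off_def ex[OF j] ap[OF j] by simp
    qed
    show ?thesis
      unfolding H.PP_def P_mat_def opp_iff[OF i j] mconst_mult mconst_power
      using off j by (auto intro!: sum.cong)
  qed
  have k: "kix 1 v \<in> {1..2 * CARD('n)}" using kix(1)[OF v] .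
  have "mact (Y1 par c) m v = foldr (\<lambda>i. mact (T_op par c i)) (H.word 1) S v"
    unfolding Y1_def foldr_mact_cmul S_def H.word_def by simp
  also have "\<dots> = H.X 1 S v"
    unfolding H.X_def using zero_less_card_finite[where 'a = 'n]
    by (intro F) (auto simp: H.set_word v)
  also have "\<dots> = H.X 1 (\<lambda>v. h (kix 1 v)) v"
    using S v zero_less_card_finite[where 'a = 'n] by (intro H.X_cong) auto
  also have "\<dots> = (\<Sum>l=1..2 * CARD('n). H.PP (kix 1 v) l * h (neg_idx CARD('n) l))"
    by (rule H.X_first[OF v])
  also have "\<dots> = (\<Sum>l=1..2 * CARD('n). stab_weight * (P_mat par (kix 1 v) l *
    (m_ut par c l * transl c (eps l) (f l) + m_vt par c l * f (neg_idx CARD('n) l))))"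
  proof (intro sum.cong HOL.refl)
    fix l assume l: "l \<in> {1..2 * CARD('n)}"
    show "H.PP (kix 1 v) l * h (neg_idx CARD('n) l) = stab_weight * (P_mat par (kix 1 v) l *
      (m_ut par c l * transl c (eps l) (f l) + m_vt par c l * f (neg_idx CARD('n) l)))"
      unfolding PP[OF k l] h_def neg_idx_neg_idx[OF l] by (simp add: ac_simps)
  qed
  finally show ?thesis unfolding lax_entry_sum by (simp add: sum_distrib_left)
qed

text \<open>Uniqueness: testing with f supported at j and evaluating at \<open>coset_rep i\<close>,
  where \<open>kix 1\<close> is i, isolates the entry (i, j). The vanishing components of f
  contribute nothing because entries in \<open>Dq c\<close> are additive.\<close>

theorem is_matrix_of_Y1:
  assumes par: "tau par \<noteq> 0" "taun par \<noteq> 0" "taunv par \<noteq> 0"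
  shows "is_matrix_of c (Y1 par c :: ('n::{finite,linorder}) cross) LL \<longleftrightarrow>
    (\<forall>i\<in>{1..2 * CARD('n)}. \<forall>j\<in>{1..2 * CARD('n)}. LL i j = lax_entry par c i j)" (is "_ \<longleftrightarrow> ?R")
proof
  have act: "mact (Y1 par c) (\<Sum>j=1..2 * CARD('n). mact e' (tens (coset_rep j) (f j))) v =
     stab_weight * (\<Sum>j=1..2 * CARD('n). lax_entry par c (kix 1 v) j (f j))" if "v \<in> weyl"
    for f :: "nat \<Rightarrow> 'n mero" and v
    by (rule Y1_mact[OF par that]) (rule module_sum)
  {
    assume R: ?R
    show "is_matrix_of c (Y1 par c :: 'n cross) LL"
      unfolding is_matrix_of_def
    proof (intro conjI ballI allI)
      show "LL k j \<in> Dq c" if "k \<in> {1..2 * CARD('n)}" "j \<in> {1..2 * CARD('n)}" for k j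
        using R that lax_entry_Dq by metis
      fix f :: "nat \<Rightarrow> 'n mero"
      show "mact (Y1 par c) (\<Sum>j=1..2 * CARD('n). mact e' (tens (coset_rep j) (f j))) =
        (\<Sum>k=1..2 * CARD('n). \<Sum>j=1..2 * CARD('n). mact e' (tens (coset_rep k) (LL k j (f j))))" (is "?A = ?B")
      proof
        fix v :: "complex^('n::{finite,linorder}) \<Rightarrow> complex^('n::{finite,linorder})"
        show "?A v = ?B v"
        proof (cases "v \<in> weyl")
          case True
          have "LL (kix 1 v) j = lax_entry par c (kix 1 v) j" if "j \<in> {1..2 * CARD('n)}" for j
            using R kix(1)[OF True, of 1] that by blast
          then show ?thesis
            unfolding act[OF True] module_sum2[OF True, of "\<lambda>k j. LL k j (f j)"]
            by (simp del: atLeastAtMost_iff cong: sum.cong)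
        next
          case False
          show ?thesis by (rule trans[OF mact_out[OF False] module_sum_out[OF False, symmetric]])
        qed
      qed
    qed
  next
    assume L: "is_matrix_of c (Y1 par c :: 'n cross) LL"
    show ?R
    proof (intro ballI ext)
      fix i j and g :: "'n mero" assume i: "i \<in> {1..2 * CARD('n)}" and j: "j \<in> {1..2 * CARD('n)}"
      define f where "f l = (if l = j then g else 0)" for l
      let ?v = "coset_rep i :: complex^('n::{finite,linorder}) \<Rightarrow> complex^('n::{finite,linorder})"
      have v: "?v \<in> weyl" by (rule coset_rep_weyl)
      have k: "kix 1 ?v = i" by (rule kix_coset_rep[OF i])
      have one: "(\<Sum>l=1..2 * CARD('n). A l (f l)) = A j g" if "\<And>l. l \<in> {1..2 * CARD('n)} \<Longrightarrow> add_op (A l)"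
        for A :: "nat \<Rightarrow> 'n mero_op"
      proof -
        have "(\<Sum>l=1..2 * CARD('n). A l (f l)) = (\<Sum>l=1..2 * CARD('n). if l = j then A j g else 0)"
          using that by (intro sum.cong HOL.refl) (auto simp: f_def add_op_zero)
        then show ?thesis using j by (simp del: atLeastAtMost_iff)
      qed
      have "mact (Y1 par c) (\<Sum>j=1..2 * CARD('n). mact e' (tens (coset_rep j) (f j))) ?v =
        (\<Sum>k=1..2 * CARD('n). \<Sum>j=1..2 * CARD('n). mact e' (tens (coset_rep k) (LL k j (f j)))) ?v"
        using L unfolding is_matrix_of_def by metis
      then have "stab_weight * (\<Sum>l=1..2 * CARD('n). lax_entry par c i l (f l)) =
          stab_weight * (\<Sum>l=1..2 * CARD('n). LL i l (f l))"
        unfolding act[OF v] module_sum2[OF v, of "\<lambda>k j. LL k j (f j)"] k .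
      then have "(\<Sum>l=1..2 * CARD('n). lax_entry par c i l (f l)) = (\<Sum>l=1..2 * CARD('n). LL i l (f l))"
        by (simp add: stab_weight_nz)
      moreover have "add_op (LL i l)" if "l \<in> {1..2 * CARD('n)}" for l
        using L i that unfolding is_matrix_of_def by (blast intro: add_op_Dq)
      moreover have "add_op (lax_entry par c i l :: 'n mero_op)" for l
        using lax_entry_Dq add_op_Dq by blast
      ultimately show "LL i j g = lax_entry par c i j g"
        using one[of "LL i"] one[of "lax_entry par c i"] by simp
    qed
  }
qed

section \<open>The classical limit\<close>

lemma mero_tendsto_unique:
  fixes \<phi> \<phi>' :: "real \<Rightarrow> ('n::finite) mero"
  assumes "mero_tendsto \<phi> \<psi> (at 0)" "mero_tendsto \<phi>' \<psi>' (at 0)" "\<forall>\<^sub>F h in at 0. \<phi> h = \<phi>' h"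
  shows "\<psi> = \<psi>'"
proof -
  obtain G g U where *: "(\<forall>\<^sub>F h in at 0. mero_fun (G h) \<and> \<phi> h = mero_of (G h)) \<and> mero_fun g \<and> \<psi> = mero_of g \<and>
     open U \<and> closure U = UNIV \<and> (\<forall>K. compact K \<and> K \<subseteq> U \<longrightarrow> uniform_limit K G g (at 0))"
    using assms(1) unfolding mero_tendsto_def by (elim exE)
  then have 1: "\<forall>\<^sub>F h in at 0. mero_fun (G h) \<and> \<phi> h = mero_of (G h)" "mero_fun g" "\<psi> = mero_of g"
    "open U" "closure U = UNIV" "\<And>K. compact K \<Longrightarrow> K \<subseteq> U \<Longrightarrow> uniform_limit K G g (at 0)"
    by blast+
  obtain G' g' U' where **: "(\<forall>\<^sub>F h in at 0. mero_fun (G' h) \<and> \<phi>' h = mero_of (G' h)) \<and> mero_fun g' \<and> \<psi>' = mero_of g' \<and>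
     open U' \<and> closure U' = UNIV \<and> (\<forall>K. compact K \<and> K \<subseteq> U' \<longrightarrow> uniform_limit K G' g' (at 0))"
    using assms(2) unfolding mero_tendsto_def by (elim exE)
  then have 2: "\<forall>\<^sub>F h in at 0. mero_fun (G' h) \<and> \<phi>' h = mero_of (G' h)" "mero_fun g'" "\<psi>' = mero_of g'"
    "open U'" "closure U' = UNIV" "\<And>K. compact K \<Longrightarrow> K \<subseteq> U' \<Longrightarrow> uniform_limit K G' g' (at 0)"
    by blast+
  have "\<forall>\<^sub>F h in at 0. mero_eq (G h) (G' h)"
    using 1(1) 2(1) assms(3)
  proof eventually_elim
    case (elim h) then show ?case using mero_of_eq_iff[of "G h" "G' h"] by simp
  qed
  then obtain d where d: "d > 0" "\<And>h. h \<noteq> 0 \<Longrightarrow> dist h 0 < d \<Longrightarrow> mero_eq (G h) (G' h)"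
    unfolding eventually_at by blast
  \<comment> \<open>Baire's theorem admits only countably many dense open sets, so the parameter is
    restricted to a sequence of nonzero values below d that tends to 0.\<close>
  define r where "r n = d / 2 * inverse (real (Suc n))" for n
  have rb: "0 < r n \<and> r n < d" for n
  proof -
    have "inverse (real (Suc n)) \<le> 1" by (simp add: inverse_le_1_iff)
    then have "r n \<le> d / 2 * 1" unfolding r_def using d(1) by (intro mult_left_mono) auto
    then show ?thesis using d(1) by (auto simp: r_def)
  qed
  have r: "r n \<noteq> 0" "dist (r n) 0 < d" for n
    using rb[of n] by auto
  have "r \<longlonglongrightarrow> 0"
    unfolding r_def by (rule tendsto_mult_right_zero[OF LIMSEQ_inverse_real_of_nat])
  then have lim: "filterlim r (at 0) sequentially"
    unfolding filterlim_at using r(1) by simp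
  have "\<forall>n. \<exists>V. open V \<and> closure V = UNIV \<and> (\<forall>x\<in>V. G (r n) x = G' (r n) x)"
    using d(2)[OF r] unfolding mero_eq_def by blast
  then obtain V where V: "\<And>n. open (V n)" "\<And>n. closure (V n) = UNIV" "\<And>n x. x \<in> V n \<Longrightarrow> G (r n) x = G' (r n) x"
    using choice[of "\<lambda>n V. open V \<and> closure V = UNIV \<and> (\<forall>x\<in>V. G (r n) x = G' (r n) x)"] by blast
  define D where "D = \<Inter>({U, U'} \<union> range V)"
  have "UNIV \<subseteq> closure D"
    unfolding D_def
  proof (rule Baire)
    fix T assume "T \<in> {U, U'} \<union> range V"
    then have "open T \<and> closure T = UNIV" using V(1,2) 1(4,5) 2(4,5) by blast
    then show "openin (top_of_set UNIV) T \<and> UNIV \<subseteq> closure T" by simp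
  qed simp_all
  then have D: "closure D = UNIV" by blast
  have eq: "g x = g' x" if "x \<in> D" for x
  proof -
    have "uniform_limit {x} G g (at 0)" "uniform_limit {x} G' g' (at 0)"
      by (rule 1(6) 2(6); use that in \<open>simp add: D_def\<close>)+
    then have lims: "((\<lambda>h. G h x) \<longlongrightarrow> g x) (at 0)" "((\<lambda>h. G' h x) \<longlongrightarrow> g' x) (at 0)"
      by simp_all
    have "(\<lambda>n. G (r n) x) \<longlonglongrightarrow> g x" "(\<lambda>n. G' (r n) x) \<longlonglongrightarrow> g' x"
      by (rule filterlim_compose[OF lims(1) lim] filterlim_compose[OF lims(2) lim])+
    moreover have "G (r n) x = G' (r n) x" for n
      using that by (intro V) (auto simp: D_def)
    ultimately show ?thesis using LIMSEQ_unique by simp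
  qed
  \<comment> \<open>The set \<open>D\<close> is dense but need not be open, so \<open>eq\<close>
    alone is not \<open>mero_eq g g'\<close>. By the dichotomy, the alternative is that g - g' is
    nonzero on an open dense set, which would have to miss the dense set \<open>D\<close>.\<close>
  have m: "mero_fun (\<lambda>x. g x - g' x)" by (rule mero_fun_diff[OF 1(2) 2(2)])
  from mero_fun_dichotomy[OF m] have "mero_eq g g'"
  proof (elim disjE exE conjE)
    fix W assume "open W" "closure W = UNIV" "\<forall>x\<in>W. g x - g' x = 0"
    then show ?thesis using 1(2) 2(2) unfolding mero_eq_def right_minus_eq by blast
  next
    fix W assume W: "open W" "closure W = UNIV" "\<forall>x\<in>W. g x - g' x \<noteq> 0"
    then have "W \<inter> D = {}" using eq by auto
    then have "W \<inter> closure D = {}" using open_Int_closure_eq_empty[OF W(1)] by blast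
    then have "W = {}" using D by simp
    then show ?thesis using W(2) by simp
  qed
  then show ?thesis using 1(2,3) 2(2,3) mero_of_eq_iff[of g g'] by simp
qed

section \<open>Convergence of the coefficients\<close>

lemma mero_tendsto_zero: "mero_tendsto (\<lambda>_. 0) (0 :: ('n::finite) mero) F"
  unfolding mero_tendsto_def
  by (intro exI[of _ "\<lambda>_ _. 0"] exI[of _ "\<lambda>_. 0"] exI[of _ UNIV])
    (auto simp: mconst_0 uniform_limit_const)

text \<open>Continuity bounds a fixed coefficient such as P_ij on compact sets, so that multiplying
  by it preserves uniform convergence.\<close>

lemma mero_fun_continuous:
  assumes "mero_fun F"
  obtains U where "open U" "closure U = UNIV" "continuous_on U F"
proof -
  define U where "U = \<Union>{V. open V \<and> continuous_on V F}"
  have "p \<in> closure U" for p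
    unfolding closure_approachable
  proof (intro allI impI)
    fix e :: real assume e: "0 < e"
    obtain r g h where p: "quot_on F p r g h" using assms unfolding mero_fun_def by blast
    have m: "0 < min r e" "ball p (min r e) \<subseteq> ball p r"
      using quot_onD(1)[OF p] e by auto
    note p' = quot_on_shrink[OF p m]
    let ?V = "{x \<in> ball p (min r e). h x \<noteq> 0}"
    obtain y where y: "y \<in> ?V" using quot_onD(4)[OF p'] by blast
    have "continuous_on ?V (\<lambda>x. g x / h x)"
      using quot_onD(2,3)[OF p'] by (intro continuous_on_divide holo_continuous_on) (auto intro: holo_subset)
    then have "continuous_on ?V F"
      using quot_onD(5)[OF p'] by (subst continuous_on_cong[OF HOL.refl, of _ _ "\<lambda>x. g x / h x"]) auto
    moreover have "open ?V" by (rule holo_open_nonzero[OF quot_onD(3)[OF p'] open_ball])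
    ultimately have "y \<in> U" using y unfolding U_def by blast
    then show "\<exists>y\<in>U. dist y p < e" using y by (auto simp: dist_commute)
  qed
  then have "closure U = UNIV" by blast
  moreover have "open U" unfolding U_def by blast
  moreover have "continuous_on U F" unfolding U_def by (rule continuous_on_open_Union) auto
  ultimately show thesis using that by blast
qed

lemma uniform_limit_const_param:
  "(a \<longlongrightarrow> l) F \<Longrightarrow> uniform_limit K (\<lambda>h _. a h) (\<lambda>_. l) F"
  by (auto simp: uniform_limit_iff tendsto_iff elim: eventually_mono)

lemma uniform_limit_divide_compact:
  fixes f g :: "'h \<Rightarrow> 'a::topological_space \<Rightarrow> complex"
  assumes "compact K" "uniform_limit K f l F" "uniform_limit K g m F" "continuous_on K l" "continuous_on K m"
    "\<And>x. x \<in> K \<Longrightarrow> m x \<noteq> 0"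
  shows "uniform_limit K (\<lambda>h x. f h x / g h x) (\<lambda>x. l x / m x) F"
proof (cases "K = {}")
  case False
  have "continuous_on K (\<lambda>x. norm (m x))" using assms(5) by (intro continuous_intros)
  then obtain z where "z \<in> K" "\<And>x. x \<in> K \<Longrightarrow> norm (m z) \<le> norm (m x)"
    using continuous_attains_inf[OF assms(1) False] by blast
  then show ?thesis
    using assms by (intro uniform_lim_divide[where b = "norm (m z)"])
      (auto intro: compact_imp_bounded compact_continuous_image)
qed simp

lemma uniform_limit_mult_compact:
  fixes f g :: "'h \<Rightarrow> 'a::topological_space \<Rightarrow> complex"
  assumes "compact K" "uniform_limit K f l F" "uniform_limit K g m F" "continuous_on K l" "continuous_on K m"
  shows "uniform_limit K (\<lambda>h x. f h x * g h x) (\<lambda>x. l x * m x) F"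
  using assms by (intro uniform_lim_mult) (auto intro: compact_imp_bounded compact_continuous_image)

text \<open>At c = 0 the denominator is 1 - exp (2 z). Compactness of K bounds it away from 0, and
  uniform convergence passes this on to the denominators for c close to 0.\<close>

lemma fn_ut_uniform_limit:
  fixes z :: "'a::topological_space \<Rightarrow> complex" and c :: "'h \<Rightarrow> complex"
  assumes K: "compact K" and z: "continuous_on K z" and c: "(c \<longlongrightarrow> 0) F"
    and nz: "\<And>x. x \<in> K \<Longrightarrow> exp (2 * z x) \<noteq> 1"
  shows "uniform_limit K (\<lambda>h x. fn_ut par (c h) (z x)) (\<lambda>x. fn_ut par 0 (z x)) F"
    "continuous_on K (\<lambda>x. fn_ut par 0 (z x))"
proof -
  have e2: "((\<lambda>h. exp (c h / 2)) \<longlongrightarrow> exp (0 / 2)) F" and e1: "((\<lambda>h. exp (c h)) \<longlongrightarrow> exp 0) F"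
    by (intro tendsto_exp tendsto_divide c tendsto_const; simp)+
  have A: "uniform_limit K (\<lambda>h x. \<alpha> * exp (c h / 2) * exp (z x)) (\<lambda>x. \<alpha> * exp (0 / 2) * exp (z x)) F" for \<alpha>
    using e2 z by (intro uniform_limit_mult_compact[OF K] uniform_limit_const_param uniform_limit_const
        continuous_intros tendsto_mult tendsto_const)
  have B: "uniform_limit K (\<lambda>h x. exp (c h) * exp (2 * z x)) (\<lambda>x. exp 0 * exp (2 * z x)) F"
    using e1 z by (intro uniform_limit_mult_compact[OF K] uniform_limit_const_param uniform_limit_const
        continuous_intros)
  note N1 = uniform_limit_minus[OF uniform_limit_const A] and N2 = uniform_limit_add[OF uniform_limit_const A]
    and D = uniform_limit_minus[OF uniform_limit_const B]
  have cN: "continuous_on K (\<lambda>x. 1 - \<alpha> * exp (0 / 2) * exp (z x))" "continuous_on K (\<lambda>x. 1 + \<alpha> * exp (0 / 2) * exp (z x))"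
    "continuous_on K (\<lambda>x. 1 - exp 0 * exp (2 * z x))" for \<alpha>
    by (intro continuous_on_diff continuous_on_add continuous_on_mult continuous_on_exp continuous_on_const z)+
  have nz': "1 - exp 0 * exp (2 * z x) \<noteq> 0" if "x \<in> K" for x using nz[OF that] by simp
  note NN = uniform_limit_mult_compact[OF K N1 N2 cN(1,2)] and cNN = continuous_on_mult[OF cN(1,2)]
  note Q = uniform_limit_divide_compact[OF K NN D cNN cN(3) nz']
  show cont: "continuous_on K (\<lambda>x. fn_ut par 0 (z x))"
    unfolding fn_ut_def
    by (rule continuous_on_mult[OF continuous_on_const continuous_on_divide[OF cNN cN(3)]]) (use nz' in blast)
  show "uniform_limit K (\<lambda>h x. fn_ut par (c h) (z x)) (\<lambda>x. fn_ut par 0 (z x)) F"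
    unfolding fn_ut_def
    by (rule uniform_limit_mult_compact[OF K uniform_limit_const Q continuous_on_const
          continuous_on_divide[OF cNN cN(3)]]) (use nz' in blast)+
qed

text \<open>By the dichotomy a single point with exp (2 x_i) different from 1 is enough; separating
  i from -i provides one with 2 x_i = 1.\<close>

lemma dense_exp_xx:
  assumes i: "i \<in> {1..2 * CARD('n)}"
  obtains U :: "(complex^('n::{finite,linorder})) set"
  where "open U" "closure U = UNIV" "\<And>x. x \<in> U \<Longrightarrow> exp (2 * xx i x) \<noteq> 1"
proof -
  let ?F = "\<lambda>x :: complex^('n::{finite,linorder}). exp (2 * xx i x) - 1"
  have h: "holo UNIV ?F" by (intro holo_diff holo_exp holo_mult holo_const holo_xx)
  have *: "?F x = 0" if "closure W = UNIV" "\<forall>x\<in>W. ?F x = 0" for W x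
    by (rule holo_dense_identity[OF h open_UNIV convex_UNIV open_UNIV _ _ that(1)]) (use that(2) in simp_all)
  have ne: "i \<noteq> neg_idx CARD('n) i" using neg_idx_neq[OF _ i] zero_less_card_finite[where 'a = 'n] by fastforce
  obtain x :: "complex^('n::{finite,linorder})" where "xx i x - xx (neg_idx CARD('n) i) x = 1"
    by (rule xx_separate[OF i neg_idx_in[OF i] ne])
  then have "2 * xx i x = 1" by (simp add: xx_neg[OF i])
  then have x: "?F x \<noteq> 0" using exp_1_neq_1 by simp
  from mero_fun_dichotomy[OF holo_mero_fun[OF h]] show thesis
  proof (elim disjE exE conjE)
    fix W assume "closure W = UNIV" "\<forall>x\<in>W. ?F x = 0"
    then show thesis using *[of W x] x by blast
  next
    fix U assume "open U" "closure U = UNIV" "\<forall>x\<in>U. ?F x \<noteq> 0"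
    then show thesis using that[of U] by simp
  qed
qed

lemma mero_tendsto_mult_left:
  fixes P :: "('n::finite) mero"
  assumes "\<And>h. mero_fun (f h)" "mero_fun l" "open U" "closure U = UNIV" "continuous_on U l"
    "\<And>K. compact K \<Longrightarrow> K \<subseteq> U \<Longrightarrow> uniform_limit K f l F"
  shows "mero_tendsto (\<lambda>h. P * mero_of (f h)) (P * mero_of l) F"
proof -
  obtain p where p: "mero_fun p" "P = mero_of p" by (rule mero_cases)
  obtain V where V: "open V" "closure V = UNIV" "continuous_on V p" using mero_fun_continuous[OF p(1)] .
  have "uniform_limit K (\<lambda>h x. p x * f h x) (\<lambda>x. p x * l x) F" if K: "compact K" "K \<subseteq> U \<inter> V" for K
    using K assms(5,6) V(3) by (intro uniform_limit_mult_compact uniform_limit_const) (auto intro: continuous_on_subset)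
  then show ?thesis
    unfolding mero_tendsto_def p(2) using p(1) assms(1,2) open_dense_Int[OF assms(3,4) V(1,2)]
    by (intro exI[of _ "\<lambda>h x. p x * f h x"] exI[of _ "\<lambda>x. p x * l x"] exI[of _ "U \<inter> V"])
      (simp add: mero_of_mult mero_fun_mult)
qed

lemma mero_tendsto_ut:
  fixes P :: "('n::{finite,linorder}) mero"
  assumes i: "i \<in> {1..2 * CARD('n)}" and c: "(c \<longlongrightarrow> 0) F"
  shows "mero_tendsto (\<lambda>h. P * m_ut par (c h) i) (P * m_ut par 0 i) F"
    "mero_tendsto (\<lambda>h. P * m_vt par (c h) i) (P * m_vt par 0 i) F"
proof -
  obtain U :: "(complex^('n::{finite,linorder})) set"
    where U: "open U" "closure U = UNIV" "\<And>x. x \<in> U \<Longrightarrow> exp (2 * xx i x) \<noteq> 1"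
    by (rule dense_exp_xx[OF i]) blast
  have cx: "continuous_on S (xx i)" for S :: "(complex^('n::{finite,linorder})) set"
    by (rule holo_continuous_on[OF holo_xx])
  have lim: "uniform_limit K (\<lambda>h x. fn_ut par (c h) (xx i x)) (\<lambda>x. fn_ut par 0 (xx i x)) F"
    if "compact K" "K \<subseteq> U" for K
    using that U(3) by (intro fn_ut_uniform_limit c cx) auto
  have cont: "continuous_on U (\<lambda>x. fn_ut par 0 (xx i x))"
    unfolding fn_ut_def using U(3) by (intro continuous_intros cx) auto
  show "mero_tendsto (\<lambda>h. P * m_ut par (c h) i) (P * m_ut par 0 i) F"
    unfolding m_ut_def by (intro mero_tendsto_mult_left[OF _ _ U(1,2) cont lim] mero_fun_xx_diff)
  show "mero_tendsto (\<lambda>h. P * m_vt par (c h) i) (P * m_vt par 0 i) F"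
    unfolding m_vt_def fn_vt_def
    by (intro mero_tendsto_mult_left[OF _ _ U(1,2)] mero_fun_diff mero_fun_const mero_fun_xx_diff
       continuous_intros cont uniform_limit_minus uniform_limit_const lim)
qed

section \<open>Linear independence of translations and uniqueness of the limit\<close>

lemma transl_mult: "transl c \<mu> (f * g) = transl c \<mu> f * transl c \<mu> g"
  unfolding transl_def by (rule act_mult[OF aff_transl])

lemma transl_1: "transl c \<mu> 1 = 1"
  unfolding transl_def by (rule act_1[OF aff_transl])

lemma transl_zero: "transl c (0 :: int^'n) f = (f :: ('n::finite) mero)"
proof -
  have *: "(\<lambda>x. x - c *s (\<chi> k. of_int ((0 :: int^'n) $ k))) = (id :: complex^'n \<Rightarrow> _)"
    by (auto simp: fun_eq_iff vec_eq_iff)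
  show ?thesis unfolding transl_def * by (rule act_id)
qed

text \<open>A coordinate function x_k with different k-th components of \<mu> and \<nu> works:
  t(\<mu>) adds c times the component to it, and the origin tells the two results apart.\<close>

lemma transl_separate:
  assumes "c \<noteq> 0" "\<mu> \<noteq> (\<nu> :: int^('n::finite))"
  obtains f where "transl c \<mu> f \<noteq> transl c \<nu> f"
proof -
  obtain k where k: "\<mu> $ k \<noteq> \<nu> $ k" using assms(2) by (auto simp: vec_eq_iff)
  let ?f = "mero_of (\<lambda>x. x $ k)"
  have t: "transl c \<mu> ?f = mero_of (\<lambda>x. x $ k + c * of_int (\<mu> $ k))" for \<mu> :: "int^'n"
  proof -
    have "inv (\<lambda>x. x - c *s (\<chi> k. of_int (\<mu> $ k))) = (\<lambda>x. x + c *s (\<chi> k. of_int (\<mu> $ k)))"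
      by (rule inv_unique_comp) auto
    then show ?thesis
      unfolding transl_def by (simp add: act_mero aff_transl holo_mero_fun holo_nth)
  qed
  have "transl c \<mu> ?f \<noteq> transl c \<nu> ?f"
  proof
    assume "transl c \<mu> ?f = transl c \<nu> ?f"
    then have "(0 :: complex^'n) $ k + c * of_int (\<mu> $ k) = 0 $ k + c * of_int (\<nu> $ k)"
      unfolding t by (rule mero_of_holo_eqD) (intro holo_add holo_nth holo_const)+
    then show False using k assms(1) by simp
  qed
  then show thesis using that by blast
qed

lemma transl_independent:
  assumes "finite S" "c \<noteq> 0" "\<And>g. (\<Sum>\<mu>\<in>S. \<phi> \<mu> * transl c \<mu> g) = 0" "\<mu> \<in> S"
  shows "\<phi> \<mu> = (0 :: ('n::finite) mero)"
  using assms(1,3,4)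
proof (induction S arbitrary: \<phi> \<mu> rule: finite_induct)
  case (insert \<nu> S)
  have "\<phi> \<mu> = 0" if \<mu>: "\<mu> \<in> S" for \<mu>
  proof -
    have "\<mu> \<noteq> \<nu>" using insert.hyps \<mu> by blast
    then obtain h where h: "transl c \<mu> h \<noteq> transl c \<nu> h" using transl_separate[OF assms(2)] by blast
    have "(\<Sum>\<mu>\<in>S. \<phi> \<mu> * (transl c \<mu> h - transl c \<nu> h) * transl c \<mu> g) = 0" for g
    proof -
      \<comment> \<open>The relation for h * g minus \<open>transl c \<nu> h\<close> times the
        relation for g: as translations are multiplicative, the \<nu>-term cancels, and the
        coefficient at \<mu> gains a factor that h makes nonzero.\<close>
      have "(\<Sum>\<mu>\<in>insert \<nu> S. \<phi> \<mu> * transl c \<mu> (h * g)) - transl c \<nu> h * (\<Sum>\<mu>\<in>insert \<nu> S. \<phi> \<mu> * transl c \<mu> g) = 0"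
        using insert.prems(1) by simp
      then show ?thesis
        using insert.hyps by (simp add: transl_mult sum_distrib_left algebra_simps flip: sum_subtractf)
    qed
    from insert.IH[OF this \<mu>] show ?thesis using h by simp
  qed note S = this
  then have "\<phi> \<nu> = 0" using insert.prems(1)[of 1] insert.hyps by (simp add: transl_1)
  then show ?case using S insert.prems(2) by blast
qed simp

text \<open>One convergent expansion decides the limit. A competing one may use another finite index
  set; after extension by 0 to the union, independence of translations makes the coefficients equal
  for small h other than 0, where \<beta> being nonzero gives a nonzero c. Their limits then agree
  term by term.\<close>

lemma classical_limit_iff:
  fixes A :: "real \<Rightarrow> ('n::finite) mero_op"
  assumes \<beta>: "\<beta> \<noteq> 0" and S: "finite S"
    and A: "\<forall>\<^sub>F h in at 0. A h = (\<Sum>\<mu>\<in>S. mult_op (\<phi> h \<mu>) \<circ> transl (- \<i> * of_real h * \<beta>) \<mu>)"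
    and lim: "\<And>\<mu>. \<mu> \<in> S \<Longrightarrow> mero_tendsto (\<lambda>h. \<phi> h \<mu>) (\<psi> \<mu>) (at 0)"
  shows "classical_limit \<beta> A F \<longleftrightarrow> F = (\<lambda>p. \<Sum>\<mu>\<in>S. \<psi> \<mu> * mconst (exp (\<beta> * mom \<mu> p)))"
proof
  assume "F = (\<lambda>p. \<Sum>\<mu>\<in>S. \<psi> \<mu> * mconst (exp (\<beta> * mom \<mu> p)))"
  then show "classical_limit \<beta> A F" unfolding classical_limit_def using S A lim by blast
next
  assume "classical_limit \<beta> A F"
  then obtain S' \<phi>' \<psi>' where S': "finite S'"
    "\<forall>\<^sub>F h in at 0. A h = (\<Sum>\<mu>\<in>S'. mult_op (\<phi>' h \<mu>) \<circ> transl (- \<i> * of_real h * \<beta>) \<mu>)"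
    "\<And>\<mu>. \<mu> \<in> S' \<Longrightarrow> mero_tendsto (\<lambda>h. \<phi>' h \<mu>) (\<psi>' \<mu>) (at 0)"
    "F = (\<lambda>p. \<Sum>\<mu>\<in>S'. \<psi>' \<mu> * mconst (exp (\<beta> * mom \<mu> p)))"
    unfolding classical_limit_def by blast
  define T where "T = S \<union> S'"
  define \<Phi> where "\<Phi> h \<mu> = (if \<mu> \<in> S then \<phi> h \<mu> else 0)" for h \<mu>
  define \<Phi>' where "\<Phi>' h \<mu> = (if \<mu> \<in> S' then \<phi>' h \<mu> else 0)" for h \<mu>
  have T: "finite T" "S \<subseteq> T" "S' \<subseteq> T" using S S'(1) by (auto simp: T_def)
  have ext: "(\<Sum>\<mu>\<in>R. f \<mu> * g \<mu>) = (\<Sum>\<mu>\<in>T. (if \<mu> \<in> R then f \<mu> else 0) * g \<mu>)" if "R \<subseteq> T"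
    for R and f g :: "int^'n \<Rightarrow> 'n mero"
    using that T(1) by (intro sum.mono_neutral_cong_left) auto
  have ev: "\<forall>\<^sub>F h in at 0. \<forall>\<mu>\<in>T. \<Phi> h \<mu> = \<Phi>' h \<mu>"
    using A S'(2) eventually_neq_at_within[of 0 0 UNIV]
  proof eventually_elim
    case (elim h)
    have c: "- \<i> * of_real h * \<beta> \<noteq> 0" using elim(3) \<beta> by simp
    have z: "(\<Sum>\<mu>\<in>T. (\<Phi> h \<mu> - \<Phi>' h \<mu>) * transl (- \<i> * of_real h * \<beta>) \<mu> g) = 0" for g
    proof -
      have "(\<Sum>\<mu>\<in>S. mult_op (\<phi> h \<mu>) \<circ> transl (- \<i> * of_real h * \<beta>) \<mu>) g =
          (\<Sum>\<mu>\<in>S'. mult_op (\<phi>' h \<mu>) \<circ> transl (- \<i> * of_real h * \<beta>) \<mu>) g"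
        using elim(1,2) by metis
      then have "(\<Sum>\<mu>\<in>S. \<phi> h \<mu> * transl (- \<i> * of_real h * \<beta>) \<mu> g) =
          (\<Sum>\<mu>\<in>S'. \<phi>' h \<mu> * transl (- \<i> * of_real h * \<beta>) \<mu> g)"
        unfolding sum_fun by (simp only: comp_apply mult_op_def)
      then show ?thesis
        unfolding ext[OF T(2)] ext[OF T(3)] left_diff_distrib sum_subtractf \<Phi>_def \<Phi>'_def right_minus_eq .
    qed
    show ?case
    proof
      fix \<mu> assume "\<mu> \<in> T"
      then have "\<Phi> h \<mu> - \<Phi>' h \<mu> = 0" by (rule transl_independent[OF T(1) c z])
      then show "\<Phi> h \<mu> = \<Phi>' h \<mu>" by simp
    qed
  qed
  have "(if \<mu> \<in> S then \<psi> \<mu> else 0) = (if \<mu> \<in> S' then \<psi>' \<mu> else 0)" if \<mu>: "\<mu> \<in> T" for \<mu>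
  proof (rule mero_tendsto_unique)
    show "mero_tendsto (\<lambda>h. \<Phi> h \<mu>) (if \<mu> \<in> S then \<psi> \<mu> else 0) (at 0)"
      unfolding \<Phi>_def by (cases "\<mu> \<in> S") (simp_all only: if_True if_False lim mero_tendsto_zero)
    show "mero_tendsto (\<lambda>h. \<Phi>' h \<mu>) (if \<mu> \<in> S' then \<psi>' \<mu> else 0) (at 0)"
      unfolding \<Phi>'_def by (cases "\<mu> \<in> S'") (simp_all only: if_True if_False S'(3) mero_tendsto_zero)
    show "\<forall>\<^sub>F h in at 0. \<Phi> h \<mu> = \<Phi>' h \<mu>"
      using ev by eventually_elim (use \<mu> in blast)
  qed
  then show "F = (\<lambda>p. \<Sum>\<mu>\<in>S. \<psi> \<mu> * mconst (exp (\<beta> * mom \<mu> p)))"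
    unfolding S'(4) ext[OF T(2)] ext[OF T(3)] by (intro HOL.ext sum.cong) auto
qed

section \<open>The classical Lax matrix\<close>

lemma eps_nz: "i \<in> {1..2 * CARD('n)} \<Longrightarrow> eps i \<noteq> (0 :: int^('n::{finite,linorder}))"
  by (auto simp: eps_def vec_eq_iff axis_def)

lemma mom_zero: "mom 0 p = 0"
  by (simp add: mom_def)

lemma row_sum:
  fixes f :: "nat \<Rightarrow> 'b::comm_monoid_add"
  assumes j: "j \<in> {1..2 * n}" "1 \<le> n"
    and f: "\<And>k. k \<in> {1..2 * n} \<Longrightarrow> k \<noteq> j \<Longrightarrow> k \<noteq> neg_idx n j \<Longrightarrow> f k = 0"
  shows "(\<Sum>k=1..2 * n. f k) = f j + f (neg_idx n j)"
proof -
  have "(\<Sum>k=1..2 * n. f k) = (\<Sum>k\<in>{j, neg_idx n j}. f k)"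
    using j f neg_idx_in[OF j(1)] by (intro sum.mono_neutral_right) auto
  then show ?thesis using neg_idx_neq[OF j(2,1)] by simp
qed

text \<open>Column j of Q has nonzero entries at most in the rows j and -j, so only the translations
  by \<open>eps j\<close> and by 0 occur. They are distinct, which lets the \<open>if\<close> choose
  the coefficient. The matrix P does not involve c, so the limit concerns only the factors
  \<open>m_ut\<close> and \<open>m_vt\<close>.\<close>

lemma lax_entry_expand:
  assumes j: "j \<in> {1..2 * CARD('n)}"
  defines "k \<equiv> neg_idx CARD('n) j"
  shows "lax_entry par c i j = (\<Sum>\<mu>\<in>{eps j, 0}.
    mult_op (if \<mu> = eps j then P_mat par i j * m_ut par c j else P_mat par i k * m_vt par c k) \<circ>
      transl c (\<mu> :: int^('n::{finite,linorder})))"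
proof
  fix g :: "'n mero"
  have n: "1 \<le> CARD('n)" by simp
  have k: "k \<in> {1..2 * CARD('n)}" "k \<noteq> j" using neg_idx_in[OF j] neg_idx_neq[OF n j] by (auto simp: k_def)
  have "lax_entry par c i j g = (\<Sum>l=1..2 * CARD('n). P_mat par i l * Q_mat par c l j g)"
    unfolding lax_entry_def sum_fun by (simp add: mult_op_def)
  also have "\<dots> = P_mat par i j * Q_mat par c j j g + P_mat par i k * Q_mat par c k j g"
    unfolding k_def using opp_iff'[OF j] by (intro row_sum[OF j n]) (simp add: Q_mat_def)
  also have "\<dots> = P_mat par i j * m_ut par c j * transl c (eps j) g + P_mat par i k * m_vt par c k * g"
    using k opp_iff'[OF j k(1)] by (simp add: Q_mat_def mult_op_def k_def)
  finally show "lax_entry par c i j g = (\<Sum>\<mu>\<in>{eps j, 0}.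
    mult_op (if \<mu> = eps j then P_mat par i j * m_ut par c j else P_mat par i k * m_vt par c k) \<circ>
      transl c (\<mu> :: int^('n::{finite,linorder}))) g"
    unfolding sum_fun using eps_nz[OF j] by (simp add: mult_op_def transl_zero)
qed

lemma lax_classical:
  assumes j: "j \<in> {1..2 * CARD('n)}"
  defines "k \<equiv> neg_idx CARD('n) j"
  shows "(\<Sum>l=1..2 * CARD('n). P_mat par i l * Q_cl par \<beta> l j p) = (\<Sum>\<mu>\<in>{eps j, 0}.
    (if \<mu> = eps j then P_mat par i j * m_ut par 0 j else P_mat par i k * m_vt par 0 k) *
      mconst (exp (\<beta> * mom (\<mu> :: int^('n::{finite,linorder})) p)))"
proof -
  have n: "1 \<le> CARD('n)" by simp
  have k: "k \<in> {1..2 * CARD('n)}" "k \<noteq> j" using neg_idx_in[OF j] neg_idx_neq[OF n j] by (auto simp: k_def)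
  have "(\<Sum>l=1..2 * CARD('n). P_mat par i l * Q_cl par \<beta> l j p) =
      P_mat par i j * Q_cl par \<beta> j j p + P_mat par i k * Q_cl par \<beta> k j p"
    unfolding k_def using opp_iff'[OF j] by (intro row_sum[OF j n]) (simp add: Q_cl_def)
  also have "\<dots> = P_mat par i j * m_ut par 0 j * mconst (exp (\<beta> * mom (eps j) p)) + P_mat par i k * m_vt par 0 k"
    using k opp_iff'[OF j k(1)] by (simp add: Q_cl_def k_def)
  finally show ?thesis using eps_nz[OF j] by (simp add: mom_zero mconst_1)
qed

theorem corollary4p4:
  fixes par :: kvd_params and \<beta> :: complex
  assumes "tau par \<noteq> 0" "tau0 par \<noteq> 0" "tau0v par \<noteq> 0" "taun par \<noteq> 0" "taunv par \<noteq> 0"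
    and "\<beta> \<noteq> 0"
  shows
    "(\<forall>c. \<forall>LL :: nat \<Rightarrow> nat \<Rightarrow> ('n::{finite,linorder}) mero_op.
        is_matrix_of c (Y1 par c) LL \<longleftrightarrow>
        (\<forall>i\<in>{1..2 * CARD('n)}. \<forall>j\<in>{1..2 * CARD('n)}.
          LL i j = (\<Sum>k=1..2 * CARD('n). mult_op (P_mat par i k) \<circ> Q_mat par c k j)))
     \<and>
     (\<forall>LL :: real \<Rightarrow> nat \<Rightarrow> nat \<Rightarrow> 'n mero_op. \<forall>L :: nat \<Rightarrow> nat \<Rightarrow> 'n phase_fun.
        (\<forall>h. h \<noteq> 0 \<longrightarrow> is_matrix_of (- \<i> * of_real h * \<beta>) (Y1 par (- \<i> * of_real h * \<beta>)) (LL h)) \<longrightarrow>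
        ((\<forall>i\<in>{1..2 * CARD('n)}. \<forall>j\<in>{1..2 * CARD('n)}. classical_limit \<beta> (\<lambda>h. LL h i j) (L i j))
         \<longleftrightarrow>
         (\<forall>i\<in>{1..2 * CARD('n)}. \<forall>j\<in>{1..2 * CARD('n)}.
           L i j = (\<lambda>p. \<Sum>k=1..2 * CARD('n). P_mat par i k * Q_cl par \<beta> k j p))))"
proof (intro conjI allI impI)
  fix c and LL :: "nat \<Rightarrow> nat \<Rightarrow> 'n mero_op"
  show "is_matrix_of c (Y1 par c) LL \<longleftrightarrow>
        (\<forall>i\<in>{1..2 * CARD('n)}. \<forall>j\<in>{1..2 * CARD('n)}.
          LL i j = (\<Sum>k=1..2 * CARD('n). mult_op (P_mat par i k) \<circ> Q_mat par c k j))"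
    using is_matrix_of_Y1[OF assms(1,4,5)] unfolding lax_entry_def .
next
  fix LL :: "real \<Rightarrow> nat \<Rightarrow> nat \<Rightarrow> 'n mero_op" and L :: "nat \<Rightarrow> nat \<Rightarrow> 'n phase_fun"
  let ?c = "\<lambda>h :: real. - \<i> * of_real h * \<beta>"
  assume "\<forall>h. h \<noteq> 0 \<longrightarrow> is_matrix_of (?c h) (Y1 par (?c h)) (LL h)"
  then have LL: "LL h i j = lax_entry par (?c h) i j"
    if "h \<noteq> 0" "i \<in> {1..2 * CARD('n)}" "j \<in> {1..2 * CARD('n)}" for h i j
    using is_matrix_of_Y1[OF assms(1,4,5), of "?c h" "LL h"] that by blast
  have "((\<lambda>h. ?c h) \<longlongrightarrow> - \<i> * of_real 0 * \<beta>) (at 0)" by (intro tendsto_intros)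
  then have c: "(?c \<longlongrightarrow> 0) (at 0)" by simp
  have "classical_limit \<beta> (\<lambda>h. LL h i j) (L i j) \<longleftrightarrow>
      L i j = (\<lambda>p. \<Sum>k=1..2 * CARD('n). P_mat par i k * Q_cl par \<beta> k j p)"
    if i: "i \<in> {1..2 * CARD('n)}" and j: "j \<in> {1..2 * CARD('n)}" for i j
    unfolding lax_classical[OF j]
  proof (rule classical_limit_iff[OF assms(6)])
    show "finite {eps j, 0 :: int^('n::{finite,linorder})}" by simp
    show "\<forall>\<^sub>F h in at 0. LL h i j = (\<Sum>\<mu>\<in>{eps j, 0}.
        mult_op (if \<mu> = eps j then P_mat par i j * m_ut par (?c h) j
          else P_mat par i (neg_idx CARD('n) j) * m_vt par (?c h) (neg_idx CARD('n) j)) \<circ> transl (?c h) \<mu>)"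
      using eventually_neq_at_within[of 0 0 UNIV]
      by eventually_elim (use LL[OF _ i j] lax_entry_expand[OF j] in metis)
    fix \<mu> :: "int^('n::{finite,linorder})"
    show "mero_tendsto (\<lambda>h. if \<mu> = eps j then (P_mat par i j * m_ut par (?c h) j :: 'n mero)
          else P_mat par i (neg_idx CARD('n) j) * m_vt par (?c h) (neg_idx CARD('n) j))
        (if \<mu> = eps j then P_mat par i j * m_ut par 0 j
          else P_mat par i (neg_idx CARD('n) j) * m_vt par 0 (neg_idx CARD('n) j)) (at 0)"
    proof (cases "\<mu> = eps j")
      case True
      show ?thesis by (simp only: True simp_thms if_True) (rule mero_tendsto_ut(1)[OF j c])
    next
      case False
      show ?thesis by (simp only: False if_False) (rule mero_tendsto_ut(2)[OF neg_idx_in[OF j] c])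
    qed
  qed
  then show "(\<forall>i\<in>{1..2 * CARD('n)}. \<forall>j\<in>{1..2 * CARD('n)}. classical_limit \<beta> (\<lambda>h. LL h i j) (L i j))
         \<longleftrightarrow>
         (\<forall>i\<in>{1..2 * CARD('n)}. \<forall>j\<in>{1..2 * CARD('n)}.
           L i j = (\<lambda>p. \<Sum>k=1..2 * CARD('n). P_mat par i k * Q_cl par \<beta> k j p))" by simp
qed

end
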